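(* Let $d\ge 2$, $R\ge 1$, and let $q=q_0(|\cdot|)$ on $\mathbb{R}^d$, where $q_0\in L^\infty(\mathbb{R}_+,\mathbb{R})$ is supported in $(0,1]$. Assume that $q\in\mathcal{Q}_d^R$ for all $R\ge 1$. Then the eigenvalues $(\lambda_k[q])_{k\in\mathbb{N}_0}$ of the Dirichlet to Neumann map $\Lambda[q]$ of $q$ in the unit ball determine the eigenvalues $(\lambda_k^R[q])_{k\in\mathbb{N}_0}$ of the Dirichlet to Neumann map of $q$ in $B_R$ for all $R\ge 1$: $$\lambda_k^R[q]-\frac{k}{R}=R^{-(2k+d-1)}\,(\lambda_k[q]-k)\,\frac{2k+d-2}{\lambda_k[q]+k+d-2-R^{-(2k+d-2)}(\lambda_k[q]-k)}.$$
   Context: $\mathbb{N}_0=\{0,1,2,\dots\}$, $\mathbb{R}_+=(0,\infty)$, and $B_R\subset\mathbb{R}^d$ is the ball of radius $R$ centered at the origin. $\mathcal{Q}_d^R$ is the set of real-valued $q\in L^\infty(B_R,\mathbb{R})$ such that $0$ is not in the Dirichlet spectrum of $-\Delta+q$ on $B_R$, i.e. $0\notin\operatorname{Spec}_{H^1_0(B_R)}(-\Delta+q)$. For a function $q$ defined on $\mathbb{R}^d$, $q\in\mathcal{Q}_d^R$ means that its restriction to $B_R$ belongs to this set. For $q\in\mathcal{Q}_d^R$, the Dirichlet to Neumann map $\Lambda^R[q]:H^{1/2}(\partial B_R)\to H^{-1/2}(\partial B_R)$ is $\Lambda^R[q](f)=\partial_\nu v|_{\partial B_R}$ (understood in the usual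 weak sense), where $\partial_\nu$ is the outward normal derivative and $v\in H^1(B_R)$ is the unique solution of $-\Delta v+qv=0$ in $B_R$, $v=f$ on $\partial B_R$. One writes $\Lambda[q]=\Lambda^1[q]$. When $q$ is radial, $\Lambda^R[q]$ is diagonal on spherical harmonics: for each $k\in\mathbb{N}_0$ there is a real number $\lambda_k^R[q]$ such that $\Lambda^R[q](Y_k(\cdot/R))=\lambda_k^R[q]\,Y_k(\cdot/R)$ for every spherical harmonic $Y_k$ of degree $k$ on the unit sphere $\mathbb{S}^{d-1}$. One writes $\lambda_k[q]=\lambda_k^1[q]$. The displayed formula is for the eigenvalues of index $k\in\mathbb{N}_0$.
   Formalization: For d=2, k=0 the quotient in the displayed formula is 0/0; it is replaced there by its limit 1/(1+λ_0[q] ln R) as 2k+d-2→0, and all other cases are as stated, with the denominators also shown to be nonzero. *)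

theory Defs
  imports "HOL-Analysis.Analysis"
begin

section \<open>Function spaces on balls and spheres\<close>

text \<open>
  Elements of \<open>L\<^sup>2\<close>, \<open>H\<^sup>1\<close> and the trace space are complex-valued representatives, not classes modulo
  equality almost everywhere.
\<close>

abbreviation ball_measure :: "real \<Rightarrow> 'a::euclidean_space measure" where
  "ball_measure R \<equiv> lebesgue_on (ball 0 R)"

text \<open>
  Surface measure on the sphere of radius \<open>R > 0\<close>, as the cone measure: a Borel subset \<open>A\<close> of
  the sphere gets mass \<open>d / R\<close> times the volume of the cone of all \<open>t x\<close> with \<open>x \<in> A\<close>,
  \<open>0 < t < 1\<close>.
\<close>

definition sphere_measure :: "real \<Rightarrow> 'a::euclidean_space measure" where
  "sphere_measure R =
     scale_measure (ennreal (real DIM('a) / R))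
       (distr (lebesgue_on (ball 0 R - {0})) (restrict_space borel (sphere 0 R))
          (\<lambda>x. (R / norm x) *\<^sub>R x))"

definition L2 :: "'a measure \<Rightarrow> ('a \<Rightarrow> complex) set" where
  "L2 M = {u \<in> borel_measurable M. integrable M (\<lambda>x. (norm (u x))\<^sup>2)}"

definition L2norm :: "'a measure \<Rightarrow> ('a \<Rightarrow> complex) \<Rightarrow> real" where
  "L2norm M u = sqrt (\<integral>x. (norm (u x))\<^sup>2 \<partial>M)"

definition Linfty :: "'a measure \<Rightarrow> ('a \<Rightarrow> real) set" where
  "Linfty M = {q \<in> borel_measurable M. \<exists>C. AE x in M. \<bar>q x\<bar> \<le> C}"

definition partial_deriv :: "'a::euclidean_space \<Rightarrow> ('a \<Rightarrow> complex) \<Rightarrow> 'a \<Rightarrow> complex" where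
  "partial_deriv b f x = frechet_derivative f (at x) b"

definition C1 :: "('a::euclidean_space \<Rightarrow> complex) set" where
  "C1 = {f. (\<forall>x. f differentiable (at x)) \<and> (\<forall>b\<in>Basis. continuous_on UNIV (partial_deriv b f))}"

definition C1_c :: "real \<Rightarrow> ('a::euclidean_space \<Rightarrow> complex) set" where
  "C1_c R = {f \<in> C1. closure {x. f x \<noteq> 0} \<subseteq> ball 0 R}"

text \<open>
  Sobolev spaces of order one on the ball \<open>B\<^sub>R\<close>. As in Brezis' textbook, the test functions are the
  continuously differentiable functions of compact support, which gives the same spaces as the
  smooth ones.
\<close>

definition weak_partial ::
    "real \<Rightarrow> 'a::euclidean_space \<Rightarrow> ('a \<Rightarrow> complex) \<Rightarrow> ('a \<Rightarrow> complex) \<Rightarrow> bool" where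
  "weak_partial R b u w \<longleftrightarrow>
     (\<forall>\<phi>\<in>C1_c R. (\<integral>x. u x * partial_deriv b \<phi> x \<partial>ball_measure R)
                = - (\<integral>x. w x * \<phi> x \<partial>ball_measure R))"

definition H1 :: "real \<Rightarrow> ('a::euclidean_space \<Rightarrow> complex) set" where
  "H1 R = {u \<in> L2 (ball_measure R). \<forall>b\<in>Basis. \<exists>w\<in>L2 (ball_measure R). weak_partial R b u w}"

definition wderiv :: "real \<Rightarrow> 'a::euclidean_space \<Rightarrow> ('a \<Rightarrow> complex) \<Rightarrow> 'a \<Rightarrow> complex" where
  "wderiv R b u = (SOME w. w \<in> L2 (ball_measure R) \<and> weak_partial R b u w)"

definition H1norm :: "real \<Rightarrow> ('a::euclidean_space \<Rightarrow> complex) \<Rightarrow> real" where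
  "H1norm R u = sqrt ((L2norm (ball_measure R) u)\<^sup>2
                      + (\<Sum>b\<in>Basis. (L2norm (ball_measure R) (wderiv R b u))\<^sup>2))"

definition H10 :: "real \<Rightarrow> ('a::euclidean_space \<Rightarrow> complex) set" where
  "H10 R = {u \<in> H1 R. \<exists>\<phi>. (\<forall>n. \<phi> n \<in> C1_c R)
                        \<and> (\<lambda>n::nat. H1norm R (\<lambda>x. \<phi> n x - u x)) \<longlonglongrightarrow> 0}"

text \<open>
  The trace is the extension by continuity, from \<open>H\<^sup>1(B\<^sub>R)\<close> to \<open>L\<^sup>2(\<partial>B\<^sub>R)\<close>, of the restriction map on
  functions that are continuously differentiable up to the boundary; \<open>H\<^sup>1\<^sup>/\<^sup>2(\<partial>B\<^sub>R)\<close> is its range.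
\<close>

definition has_trace ::
    "real \<Rightarrow> ('a::euclidean_space \<Rightarrow> complex) \<Rightarrow> ('a \<Rightarrow> complex) \<Rightarrow> bool" where
  "has_trace R u g \<longleftrightarrow> u \<in> H1 R \<and> g \<in> L2 (sphere_measure R) \<and>
     (\<exists>\<phi>. (\<forall>n. \<phi> n \<in> C1)
        \<and> (\<lambda>n::nat. H1norm R (\<lambda>x. \<phi> n x - u x)) \<longlonglongrightarrow> 0
        \<and> (\<lambda>n. L2norm (sphere_measure R) (\<lambda>x. \<phi> n x - g x)) \<longlonglongrightarrow> 0)"

definition H_half :: "real \<Rightarrow> ('a::euclidean_space \<Rightarrow> complex) set" where
  "H_half R = {g. \<exists>u. has_trace R u g}"


section \<open>The operator \<open>-\<Delta> + q\<close> on \<open>B\<^sub>R\<close>\<close>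

definition schroedinger_form ::
    "real \<Rightarrow> ('a::euclidean_space \<Rightarrow> real) \<Rightarrow> ('a \<Rightarrow> complex) \<Rightarrow> ('a \<Rightarrow> complex) \<Rightarrow> complex" where
  "schroedinger_form R q u v =
     (\<integral>x. (\<Sum>b\<in>Basis. wderiv R b u x * wderiv R b v x) + of_real (q x) * u x * v x
        \<partial>ball_measure R)"

text \<open>\<open>-\<Delta>u + qu = h\<close> in \<open>B\<^sub>R\<close>, in the sense of distributions.\<close>

definition schroedinger_eq ::
    "real \<Rightarrow> ('a::euclidean_space \<Rightarrow> real) \<Rightarrow> ('a \<Rightarrow> complex) \<Rightarrow> ('a \<Rightarrow> complex) \<Rightarrow> bool" where
  "schroedinger_eq R q u h \<longleftrightarrow>
     (\<forall>\<phi>\<in>C1_c R. schroedinger_form R q u \<phi> = (\<integral>x. h x * \<phi> x \<partial>ball_measure R))"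

text \<open>
  The Dirichlet realization of \<open>-\<Delta> + q\<close> is the operator in \<open>L\<^sup>2(B\<^sub>R)\<close> whose domain consists of the
  \<open>u \<in> H\<^sup>1\<^sub>0(B\<^sub>R)\<close> with \<open>-\<Delta>u + qu \<in> L\<^sup>2(B\<^sub>R)\<close>. A number \<open>z\<close> is in its resolvent set iff
  \<open>-\<Delta> + q - z\<close> maps the domain onto \<open>L\<^sup>2(B\<^sub>R)\<close> and has a bounded inverse; the bound contains
  injectivity (take \<open>f = 0\<close>).
\<close>

definition dirichlet_resolvent_set ::
    "real \<Rightarrow> ('a::euclidean_space \<Rightarrow> real) \<Rightarrow> complex set" where
  "dirichlet_resolvent_set R q =
     {z. \<exists>C. \<forall>f\<in>L2 (ball_measure R).
           (\<exists>u\<in>H10 R. schroedinger_eq R q u (\<lambda>x. z * u x + f x)) \<and>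
           (\<forall>u\<in>H10 R. schroedinger_eq R q u (\<lambda>x. z * u x + f x) \<longrightarrow>
              L2norm (ball_measure R) u \<le> C * L2norm (ball_measure R) f)}"

definition dirichlet_spectrum :: "real \<Rightarrow> ('a::euclidean_space \<Rightarrow> real) \<Rightarrow> complex set" where
  "dirichlet_spectrum R q = - dirichlet_resolvent_set R q"

definition Q_class :: "real \<Rightarrow> ('a::euclidean_space \<Rightarrow> real) set" where
  "Q_class R = {q \<in> Linfty (ball_measure R). 0 \<notin> dirichlet_spectrum R q}"


section \<open>The Dirichlet to Neumann map and its eigenvalues\<close>

definition dirichlet_solution ::
    "real \<Rightarrow> ('a::euclidean_space \<Rightarrow> real) \<Rightarrow> ('a \<Rightarrow> complex) \<Rightarrow> ('a \<Rightarrow> complex) \<Rightarrow> bool" where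
  "dirichlet_solution R q f v \<longleftrightarrow> v \<in> H1 R \<and> schroedinger_eq R q v (\<lambda>x. 0) \<and> has_trace R v f"

text \<open>
  The map takes \<open>f \<in> H\<^sup>1\<^sup>/\<^sup>2(\<partial>B\<^sub>R)\<close> to the functional \<open>\<partial>\<^sub>\<nu>v \<in> H\<^sup>-\<^sup>1\<^sup>/\<^sup>2(\<partial>B\<^sub>R)\<close>, which is defined by Green's
  formula: its value at \<open>g \<in> H\<^sup>1\<^sup>/\<^sup>2(\<partial>B\<^sub>R)\<close> is the integral of \<open>\<nabla>v \<cdot> \<nabla>G + q v G\<close> over \<open>B\<^sub>R\<close> for any
  \<open>G \<in> H\<^sup>1(B\<^sub>R)\<close> with trace \<open>g\<close>. The pairing is bilinear, and a function \<open>h\<close> on the sphere is identified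
  with the functional that maps \<open>g\<close> to the surface integral of \<open>h g\<close>.
\<close>

definition DtN ::
    "real \<Rightarrow> ('a::euclidean_space \<Rightarrow> real) \<Rightarrow> ('a \<Rightarrow> complex) \<Rightarrow> ('a \<Rightarrow> complex) \<Rightarrow> complex" where
  "DtN R q f g = schroedinger_form R q (SOME v. dirichlet_solution R q f v) (SOME G. has_trace R G g)"

definition laplacian :: "('a::euclidean_space \<Rightarrow> complex) \<Rightarrow> 'a \<Rightarrow> complex" where
  "laplacian f x = (\<Sum>b\<in>Basis. partial_deriv b (partial_deriv b f) x)"

text \<open>Only the values on the unit sphere matter.\<close>

definition spherical_harmonic :: "nat \<Rightarrow> ('a::euclidean_space \<Rightarrow> complex) \<Rightarrow> bool" where
  "spherical_harmonic k Y \<longleftrightarrow>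
     (\<exists>P. polynomial_function P
        \<and> (\<forall>t x. P (t *\<^sub>R x) = of_real (t ^ k) * P x)
        \<and> (\<forall>x. laplacian P x = 0)
        \<and> (\<forall>x\<in>sphere 0 1. Y x = P x))"

definition DtN_eigenvalue :: "real \<Rightarrow> ('a::euclidean_space \<Rightarrow> real) \<Rightarrow> nat \<Rightarrow> real" where
  "DtN_eigenvalue R q k =
     (THE l. \<forall>Y. spherical_harmonic k Y \<longrightarrow>
        (\<forall>g\<in>H_half R. DtN R q (\<lambda>x. Y (x /\<^sub>R R)) g
                      = of_real l * (\<integral>x. Y (x /\<^sub>R R) * g x \<partial>sphere_measure R)))"


section \<open>The exceptional case \<open>d = 2\<close>, \<open>k = 0\<close>\<close>

text \<open>
  With \<open>s = 2k + d - 2\<close> and \<open>y = \<lambda>\<^sub>k - k\<close>, the quotient \<open>s / (\<lambda>\<^sub>k + k + d - 2 - R\<^sup>-\<^sup>s (\<lambda>\<^sub>k - k))\<close> is the one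
  below. For \<open>s = 0\<close>, which happens only if \<open>d = 2\<close> and \<open>k = 0\<close>, it is of the form \<open>0 / 0\<close> and
  has to be read as its limit.
\<close>

lemma exceptional_quotient_limit:
  fixes y R :: real
  assumes "R > 0" and "1 + y * ln R \<noteq> 0"
  shows "((\<lambda>s. s / (y + s - R powr (- s) * y)) \<longlongrightarrow> 1 / (1 + y * ln R)) (at 0)"
proof -
  have "((\<lambda>s. R powr (- s)) has_real_derivative - ln R) (at 0)"
    using assms(1) by (auto intro!: derivative_eq_intros)
  then have "((\<lambda>s. (R powr (- s) - 1) / s) \<longlongrightarrow> - ln R) (at 0)"
    using assms(1) by (simp add: has_field_derivative_iff)
  then have "((\<lambda>s. 1 / (1 - y * ((R powr (- s) - 1) / s))) \<longlongrightarrow> 1 / (1 - y * (- ln R))) (at 0)"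
    using assms(2) by (intro tendsto_intros) auto
  moreover have "\<forall>\<^sub>F s in at 0. 1 / (1 - y * ((R powr (- s) - 1) / s))
                             = s / (y + s - R powr (- s) * y)"
    unfolding eventually_at_filter
  proof (intro always_eventually allI impI)
    fix s :: real assume "s \<noteq> 0"
    then have "y + s - R powr (- s) * y = s * (1 - y * ((R powr (- s) - 1) / s))"
      by (simp add: field_simps)
    with \<open>s \<noteq> 0\<close> show "1 / (1 - y * ((R powr (- s) - 1) / s)) = s / (y + s - R powr (- s) * y)"
      by simp
  qed
  ultimately show ?thesis
    by (simp add: filterlim_cong)
qed

end

theory Submission
  imports Defs
begin

text \<open>
  Let \<open>P\<close> be a homogeneous harmonic polynomial of degree \<open>k\<close>, and put \<open>m = 2 k + d - 1\<close>. The function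
  \<open>a(\<bar>x\<bar>) P(x)\<close> solves \<open>-\<Delta>v + q v = 0\<close> if \<open>a\<close> solves the radial equation \<open>(r\<^sup>m a')' = r\<^sup>m q\<^sub>0 a\<close>. This equation has a
  solution on the whole half-line with \<open>a(0) = 1\<close> (\<open>radial_solution\<close>), which does not depend on \<open>P\<close> or on the
  radius. On the sphere of radius \<open>R\<close> the boundary values of the solution and of its normal derivative are
  \<open>a(R) P\<close> and \<open>(a'(R) + (k / R) a(R)) P\<close> (\<open>radial_times_harmonic_weak_equation\<close>), so
  \<open>\<lambda>\<^sub>k\<^sup>R = a'(R) / a(R) + k / R\<close> (\<open>DtN_eigenvalue_radial\<close>). Here \<open>a(R)\<close> is not zero, because otherwise
  \<open>a(\<bar>x\<bar>) P(x)\<close> would be a Dirichlet eigenfunction with eigenvalue 0 (\<open>radial_factor_nonzero\<close>).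

  For \<open>r \<ge> 1\<close> the potential vanishes, so \<open>r\<^sup>m a'(r)\<close> is constant, and \<open>a'(R)\<close> and \<open>a(R)\<close> are explicit in terms
  of \<open>a(1)\<close> and \<open>a'(1)\<close> (\<open>radial_solution_outside\<close>). Dividing by \<open>a(1)\<close> leaves only the quotient
  \<open>a'(1) / a(1) = \<lambda>\<^sub>k - k\<close>, which is the assertion; the denominator in it is a multiple of \<open>a(R) / a(1)\<close>.

  The rest connects this computation with the weak definitions. The Dirichlet to Neumann map is
  evaluated at an arbitrary weak solution and an arbitrary extension of the test function. The former
  agrees with the explicit solution, because a function in \<open>H\<^sup>1\<close> of vanishing trace belongs to \<open>H\<^sup>1\<^sub>0\<close>
  (\<open>vanishing_trace_H10\<close>), where the assumption on the spectrum gives uniqueness; the latter is handled by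
  density of \<open>C1\<close> functions (\<open>DtN_eq_of_flux\<close>). Both the theorem on traces and Green's formula are
  consequences of the divergence theorem on the ball (\<open>integral_partial_deriv_ball\<close>), which follows from
  polar coordinates for the cone measure on the sphere (\<open>polar_measure\<close>).
\<close>

section \<open>Continuously differentiable functions\<close>

lemma C1I:
  assumes "\<And>x. (f has_derivative D x) (at x)"
    and "\<And>b. b \<in> Basis \<Longrightarrow> continuous_on UNIV (\<lambda>x. D x b)"
  shows "f \<in> C1" and "partial_deriv b f x = D x b"
proof -
  have *: "partial_deriv b f x = D x b" for b x
    unfolding partial_deriv_def using frechet_derivative_at[OF assms(1)[of x]] by simp
  show "f \<in> C1"
    unfolding C1_def using assms by (auto simp: * differentiable_def)
  show "partial_deriv b f x = D x b" by (rule *)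
qed

lemma C1_has_derivative:
  assumes "f \<in> C1"
  shows "(f has_derivative (\<lambda>h. partial_deriv h f x)) (at x)"
  using assms unfolding C1_def partial_deriv_def by (auto simp: frechet_derivative_works)

lemma C1_has_derivative_compose:
  assumes "f \<in> C1" and "(g has_derivative g') (at t within S)"
  shows "((\<lambda>t. f (g t)) has_derivative (\<lambda>h. partial_deriv (g' h) f (g t))) (at t within S)"
  using has_derivative_compose[OF assms(2) C1_has_derivative[OF assms(1)]] .

lemma partial_deriv_eq:
  assumes "(f has_derivative D) (at x)" shows "partial_deriv b f x = D b"
  unfolding partial_deriv_def using frechet_derivative_at[OF assms] by simp

lemma partial_deriv_Basis_sum:
  assumes "f \<in> C1"
  shows "partial_deriv h f x = (\<Sum>b\<in>Basis. of_real (h \<bullet> b) * partial_deriv b f x)"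
proof -
  interpret bounded_linear "\<lambda>h. partial_deriv h f x"
    using C1_has_derivative[OF assms] by (rule has_derivative_bounded_linear)
  have "partial_deriv h f x = partial_deriv (\<Sum>b\<in>Basis. (h \<bullet> b) *\<^sub>R b) f x"
    by (simp add: euclidean_representation)
  also have "\<dots> = (\<Sum>b\<in>Basis. of_real (h \<bullet> b) * partial_deriv b f x)"
    by (simp add: sum scaleR scaleR_conv_of_real)
  finally show ?thesis .
qed

lemma C1_continuous: "f \<in> C1 \<Longrightarrow> continuous_on S f"
  unfolding C1_def
  by (metis (mono_tags, lifting) mem_Collect_eq continuous_at_imp_continuous_on differentiable_imp_continuous_within)

lemma C1_continuous_partial:
  assumes "f \<in> C1" shows "continuous_on S (partial_deriv b f)"
proof -
  have "continuous_on S (\<lambda>x. \<Sum>c\<in>Basis. of_real (b \<bullet> c) * partial_deriv c f x)"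
    using assms unfolding C1_def
    by (intro continuous_intros) (auto intro: continuous_on_subset)
  then show ?thesis
    by (subst partial_deriv_Basis_sum[OF assms, THEN ext]) 
qed

lemma C1_const [simp]: "(\<lambda>x. c) \<in> C1"
  and partial_deriv_const [simp]: "partial_deriv b (\<lambda>x. c) x = 0"
  by (rule C1I[of "\<lambda>x. c" "\<lambda>x h. 0"]; auto intro!: derivative_eq_intros)+

lemma C1_add:
  assumes "f \<in> C1" "g \<in> C1"
  shows "(\<lambda>x. f x + g x) \<in> C1"
    and "partial_deriv b (\<lambda>x. f x + g x) x = partial_deriv b f x + partial_deriv b g x"
  by (rule C1I[of "\<lambda>x. f x + g x" "\<lambda>x h. partial_deriv h f x + partial_deriv h g x"];
      auto intro!: has_derivative_add C1_has_derivative continuous_intros C1_continuous_partial assms)+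

lemma C1_diff:
  assumes "f \<in> C1" "g \<in> C1"
  shows "(\<lambda>x. f x - g x) \<in> C1"
    and "partial_deriv b (\<lambda>x. f x - g x) x = partial_deriv b f x - partial_deriv b g x"
  by (rule C1I[of "\<lambda>x. f x - g x" "\<lambda>x h. partial_deriv h f x - partial_deriv h g x"];
      auto intro!: has_derivative_diff C1_has_derivative continuous_intros C1_continuous_partial assms)+

lemma C1_mult:
  assumes "f \<in> C1" "g \<in> C1"
  shows "(\<lambda>x. f x * g x) \<in> C1"
    and "partial_deriv b (\<lambda>x. f x * g x) x = f x * partial_deriv b g x + partial_deriv b f x * g x"
  by (rule C1I[of "\<lambda>x. f x * g x" "\<lambda>x h. f x * partial_deriv h g x + partial_deriv h f x * g x"];
      auto intro!: has_derivative_mult C1_has_derivative continuous_intros C1_continuous_partial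
        C1_continuous[OF assms(1)] C1_continuous[OF assms(2)] assms)+

lemma C1_cmult:
  assumes "f \<in> C1"
  shows "(\<lambda>x. c * f x) \<in> C1"
    and "partial_deriv b (\<lambda>x. c * f x) x = c * partial_deriv b f x"
  using C1_mult[OF C1_const assms] by auto

lemma C1_cnj:
  assumes "f \<in> C1"
  shows "(\<lambda>x. cnj (f x)) \<in> C1"
    and "partial_deriv b (\<lambda>x. cnj (f x)) x = cnj (partial_deriv b f x)"
  by (rule C1I[of "\<lambda>x. cnj (f x)" "\<lambda>x h. cnj (partial_deriv h f x)"];
      auto intro!: bounded_linear.has_derivative[OF bounded_linear_cnj] C1_has_derivative assms
        continuous_intros C1_continuous_partial)+

lemma C1_prod:
  assumes "\<And>i. i \<in> I \<Longrightarrow> f i \<in> C1"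
  shows "(\<lambda>x. \<Prod>i\<in>I. f i x) \<in> C1"
  using assms by (induction I rule: infinite_finite_induct) (auto intro: C1_mult(1))

lemma C1_real_compose:
  fixes p :: "'a::euclidean_space \<Rightarrow> real"
  assumes h: "\<And>t. (h has_real_derivative h' t) (at t)" "continuous_on UNIV h'"
    and p: "\<And>x. (p has_derivative p' x) (at x)" "\<And>b. b \<in> Basis \<Longrightarrow> continuous_on UNIV (\<lambda>x. p' x b)"
  shows "(\<lambda>x. complex_of_real (h (p x))) \<in> C1"
    and "partial_deriv b (\<lambda>x. complex_of_real (h (p x))) x = of_real (h' (p x) * p' x b)"
proof -
  have 1: "((\<lambda>x. complex_of_real (h (p x))) has_derivative (\<lambda>b. of_real (h' (p x) * p' x b))) (at x)" for x
    using has_derivative_compose[OF p(1) h(1)[unfolded has_field_derivative_def], of x]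
    by (intro has_derivative_of_real) simp
  have "continuous_on UNIV p"
    using p(1) by (meson continuous_at_imp_continuous_on has_derivative_continuous)
  then have 2: "continuous_on UNIV (\<lambda>x. complex_of_real (h' (p x) * p' x b))" if "b \<in> Basis" for b
    using that by (intro continuous_intros p(2) continuous_on_compose2[OF h(2)]) auto
  show "(\<lambda>x. complex_of_real (h (p x))) \<in> C1" by (rule C1I(1)[OF 1 2])
  show "partial_deriv b (\<lambda>x. complex_of_real (h (p x))) x = of_real (h' (p x) * p' x b)"
    by (rule C1I(2)[OF 1 2])
qed

lemma C1_square_compose:
  assumes h: "\<And>t. (h has_real_derivative h' t) (at t)" "continuous_on UNIV h'"
  shows "(\<lambda>x::'a::euclidean_space. complex_of_real (h (x \<bullet> x))) \<in> C1"
    and "partial_deriv b (\<lambda>x::'a. complex_of_real (h (x \<bullet> x))) x = of_real (2 * (x \<bullet> b) * h' (x \<bullet> x))"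
proof -
  have p: "((\<lambda>x::'a. x \<bullet> x) has_derivative (\<lambda>h. 2 * (x \<bullet> h))) (at x)" for x
    by (auto intro!: derivative_eq_intros simp: inner_commute)
  have c: "continuous_on UNIV (\<lambda>x::'a. 2 * (x \<bullet> b))" for b by (intro continuous_intros)
  show "(\<lambda>x::'a. complex_of_real (h (x \<bullet> x))) \<in> C1"
    by (rule C1_real_compose(1)[OF h p c])
  show "partial_deriv b (\<lambda>x::'a. complex_of_real (h (x \<bullet> x))) x = of_real (2 * (x \<bullet> b) * h' (x \<bullet> x))"
    by (subst C1_real_compose(2)[OF h p c]) (simp add: mult_ac)
qed

lemma C1_inner_right:
  shows "(\<lambda>x. complex_of_real (x \<bullet> c)) \<in> C1"
    and "partial_deriv b (\<lambda>x. complex_of_real (x \<bullet> c)) x = of_real (b \<bullet> c)"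
proof -
  have *: "((\<lambda>x. x \<bullet> c) has_derivative (\<lambda>h. h \<bullet> c)) (at x)" for x :: 'a
    by (auto intro!: derivative_eq_intros)
  have **: "((\<lambda>t. t) has_real_derivative (\<lambda>t. 1) t) (at t)" for t by (auto intro!: derivative_eq_intros)
  show "(\<lambda>x. complex_of_real (x \<bullet> c)) \<in> C1"
    by (rule C1_real_compose(1)[OF ** _ *]) (auto intro!: continuous_intros)
  show "partial_deriv b (\<lambda>x. complex_of_real (x \<bullet> c)) x = of_real (b \<bullet> c)"
    by (subst C1_real_compose(2)[OF ** _ *]) (auto intro!: continuous_intros)
qed

text \<open>
  The induction carries along that the derivative is again polynomial in the base point; iterating
  this yields the second derivatives in the Laplacian.
\<close>

lemma real_polynomial_function_derivative:
  fixes p :: "'a::euclidean_space \<Rightarrow> real"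
  assumes "real_polynomial_function p"
  shows "\<exists>D. (\<forall>x. (p has_derivative D x) (at x)) \<and> (\<forall>b. real_polynomial_function (\<lambda>x. D x b))"
  using assms
proof induction
  case (linear f)
  then show ?case
    by (intro exI[of _ "\<lambda>x. f"]) (auto intro: bounded_linear_imp_has_derivative)
next
  case (const c)
  then show ?case by (intro exI[of _ "\<lambda>x h. 0"]) auto
next
  case (add f g)
  then obtain F G where "\<forall>x. (f has_derivative F x) (at x)" "\<forall>b. real_polynomial_function (\<lambda>x. F x b)"
    "\<forall>x. (g has_derivative G x) (at x)" "\<forall>b. real_polynomial_function (\<lambda>x. G x b)" by blast
  then show ?case
    by (intro exI[of _ "\<lambda>x h. F x h + G x h"]) (auto intro!: has_derivative_add)
next
  case (mult f g)
  then obtain F G where "\<forall>x. (f has_derivative F x) (at x)" "\<forall>b. real_polynomial_function (\<lambda>x. F x b)"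
    "\<forall>x. (g has_derivative G x) (at x)" "\<forall>b. real_polynomial_function (\<lambda>x. G x b)" by blast
  with mult.hyps show ?case
    by (intro exI[of _ "\<lambda>x h. f x * G x h + F x h * g x"])
       (auto intro!: has_derivative_mult real_polynomial_function.intros(3,4))
qed

lemma polynomial_function_complex_iff:
  fixes P :: "'a::euclidean_space \<Rightarrow> complex"
  shows "polynomial_function P \<longleftrightarrow>
    real_polynomial_function (\<lambda>x. Re (P x)) \<and> real_polynomial_function (\<lambda>x. Im (P x))"
  unfolding polynomial_function_iff_Basis_inner
  by (simp add: Basis_complex_def)

lemma polynomial_function_C1:
  assumes "polynomial_function P"
  shows "P \<in> C1" and "polynomial_function (partial_deriv b P)"
proof -
  obtain F where F: "\<And>x. ((\<lambda>x. Re (P x)) has_derivative F x) (at x)" "\<And>b. real_polynomial_function (\<lambda>x. F x b)"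
    using real_polynomial_function_derivative assms unfolding polynomial_function_complex_iff by metis
  obtain G where G: "\<And>x. ((\<lambda>x. Im (P x)) has_derivative G x) (at x)" "\<And>b. real_polynomial_function (\<lambda>x. G x b)"
    using real_polynomial_function_derivative assms unfolding polynomial_function_complex_iff by metis
  have D: "(P has_derivative (\<lambda>h. Complex (F x h) (G x h))) (at x)" for x
  proof -
    have "((\<lambda>x. of_real (Re (P x)) + \<i> * of_real (Im (P x))) has_derivative
      (\<lambda>h. of_real (F x h) + \<i> * of_real (G x h))) (at x)"
      by (intro has_derivative_add has_derivative_mult_right has_derivative_of_real F G)
    moreover have "(\<lambda>x. of_real (Re (P x)) + \<i> * of_real (Im (P x))) = P"
      by (auto simp: complex_eq_iff)
    moreover have "(\<lambda>h. of_real (F x h) + \<i> * of_real (G x h)) = (\<lambda>h. Complex (F x h) (G x h))"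
      by (auto simp: complex_eq_iff)
    ultimately show ?thesis by simp
  qed
  have pd: "partial_deriv b P = (\<lambda>x. Complex (F x b) (G x b))" for b
    using partial_deriv_eq[OF D] by blast
  show poly: "polynomial_function (partial_deriv b P)" for b
    unfolding pd polynomial_function_complex_iff using F G by simp
  show "P \<in> C1"
    by (rule C1I(1)[OF D]) (use poly pd continuous_on_polymonial_function in metis)
qed

section \<open>Polar coordinates\<close>

lemma sets_sphere_measure [measurable_cong]:
  "sets (sphere_measure R) = sets (restrict_space borel (sphere (0::'a::euclidean_space) R))"
  by (simp add: sphere_measure_def)

lemma space_sphere_measure [simp]:
  "space (sphere_measure R) = sphere (0::'a::euclidean_space) R"
  by (simp add: sphere_measure_def space_scale_measure space_restrict_space)

lemma borel_subset_sphere_measure: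
  "B \<in> sets (sphere_measure R) \<longleftrightarrow> B \<in> sets borel \<and> B \<subseteq> sphere (0::'a::euclidean_space) R"
  unfolding sets_sphere_measure by (subst sets_restrict_space_iff) auto

lemma borel_measurable_sphere_measure:
  "f \<in> borel_measurable borel \<Longrightarrow> f \<in> borel_measurable (sphere_measure R)"
  unfolding measurable_cong_sets[OF sets_sphere_measure refl] by (rule measurable_restrict_space1)

lemma emeasure_sphere_measure:
  fixes B :: "'a::euclidean_space set"
  assumes R: "R > 0" and B: "B \<in> sets (sphere_measure R)"
  shows "emeasure (sphere_measure R) B =
    ennreal (real DIM('a) / R) * emeasure lborel {x \<in> ball 0 R - {0}. (R / norm x) *\<^sub>R x \<in> B}"
    and "{x \<in> ball 0 R - {0}. (R / norm x) *\<^sub>R x \<in> B} \<in> sets borel"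
proof -
  have Bb: "B \<in> sets borel" using B by (simp add: borel_subset_sphere_measure)
  show Cb: "{x \<in> ball 0 R - {0}. (R / norm x) *\<^sub>R x \<in> B} \<in> sets borel"
    using Bb by measurable
  have m: "(\<lambda>x. (R / norm x) *\<^sub>R x) \<in> lebesgue_on (ball 0 R - {0}) \<rightarrow>\<^sub>M restrict_space borel (sphere (0::'a) R)"
    using R by (intro measurable_restrict_space2 continuous_imp_measurable_on_sets_lebesgue)
      (auto intro!: continuous_intros)
  have "emeasure (sphere_measure R) B = ennreal (real DIM('a) / R) *
     emeasure (lebesgue_on (ball 0 R - {0})) ((\<lambda>x. (R / norm x) *\<^sub>R x) -` B \<inter> space (lebesgue_on (ball 0 R - {0})))"
    unfolding sphere_measure_def emeasure_scale_measure
    using m B by (subst emeasure_distr) (auto simp: sets_sphere_measure)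
  also have "(\<lambda>x. (R / norm x) *\<^sub>R x) -` B \<inter> space (lebesgue_on (ball 0 R - {0}))
      = {x \<in> ball 0 R - {0}. (R / norm x) *\<^sub>R x \<in> B}" (is "_ = ?C")
    by (auto simp: space_restrict_space)
  also have "emeasure (lebesgue_on (ball 0 R - {0})) ?C = emeasure lebesgue ?C"
    by (rule emeasure_restrict_space) auto
  also have "\<dots> = emeasure lborel ?C" using Cb by simp
  finally show "emeasure (sphere_measure R) B = ennreal (real DIM('a) / R) * emeasure lborel ?C" .
qed

lemma finite_sphere_measure:
  assumes "R > 0" shows "finite_measure (sphere_measure R :: 'a::euclidean_space measure)"
proof
  have "emeasure lborel {x \<in> ball 0 R - {0}. (R / norm x) *\<^sub>R x \<in> sphere (0::'a) R} \<le> emeasure lborel (ball (0::'a) R)"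
    by (rule emeasure_mono) auto
  also have "\<dots> < \<infinity>" using emeasure_lborel_ball_finite by blast
  finally show "emeasure (sphere_measure R) (space (sphere_measure R :: 'a measure)) \<noteq> \<infinity>"
    using assms by (subst emeasure_sphere_measure)
      (auto simp: borel_subset_sphere_measure ennreal_mult_eq_top_iff)
qed

text \<open>
  The radial factor of Lebesgue measure on the ball of radius \<open>R\<close> in polar coordinates. The density is
  \<open>(r / R)\<close> to the power \<open>n - 1\<close>, and not a power of \<open>r\<close>, because the angular factor is the surface
  measure of the sphere of radius \<open>R\<close>.
\<close>

definition radial_measure :: "nat \<Rightarrow> real \<Rightarrow> real measure" where
  "radial_measure n R = density lborel (\<lambda>r. ennreal (indicat_real {0<..<R} r * (r / R) ^ (n - 1)))"

lemma sets_radial_measure [simp, measurable_cong]: "sets (radial_measure n R) = sets borel"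
  by (simp add: radial_measure_def)

lemma space_radial_measure [simp]: "space (radial_measure n R) = UNIV"
  by (simp add: radial_measure_def)

lemma emeasure_radial_measure_Ioi:
  assumes R: "R > 0" and n: "n > 0" and t: "0 \<le> t" "t \<le> R"
  shows "emeasure (radial_measure n R) {t<..} = ennreal (R / real n * (1 - (t / R) ^ n))"
proof -
  have "emeasure (radial_measure n R) {t<..} =
      (\<integral>\<^sup>+r. ennreal (indicat_real {0<..<R} r * (r / R) ^ (n - 1)) * indicator {t<..} r \<partial>lborel)"
    unfolding radial_measure_def by (rule emeasure_density) auto
  also have "\<dots> = (\<integral>\<^sup>+r. ennreal ((r / R) ^ (n - 1)) * indicator {t..R} r \<partial>lborel)"
  proof (rule nn_integral_cong_AE)
    show "AE r in lborel. ennreal (indicat_real {0<..<R} r * (r / R) ^ (n - 1)) * indicator {t<..} r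
        = ennreal ((r / R) ^ (n - 1)) * indicator {t..R} r"
      using AE_lborel_singleton[of t] AE_lborel_singleton[of R]
      by eventually_elim (use t in \<open>auto simp: indicator_def\<close>)
  qed
  also have "\<dots> = ennreal (R / real n * (R / R) ^ n - R / real n * (t / R) ^ n)"
  proof (rule nn_integral_FTC_Icc[where F = "\<lambda>r. R / real n * (r / R) ^ n"])
    fix r assume "r \<in> {t..R}" then have r: "t \<le> r" "r \<le> R" by auto
    have "((\<lambda>r. R / real n * (r / R) ^ n) has_real_derivative
        R / real n * (real n * (r / R) ^ (n - 1) * (1 / R))) (at r)"
      by (auto intro!: derivative_eq_intros)
    moreover have "R / real n * (real n * (r / R) ^ (n - 1) * (1 / R)) = (r / R) ^ (n - 1)"
      using R n by (simp add: field_simps)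
    ultimately show "((\<lambda>r. R / real n * (r / R) ^ n) has_real_derivative (r / R) ^ (n - 1)) (at r)"
      by simp
    show "0 \<le> (r / R) ^ (n - 1)" using R t r by simp
  qed (use t in auto)
  finally show ?thesis using R by (simp add: algebra_simps)
qed

lemma emeasure_radial_measure_Ioi':
  assumes R: "R > 0" and n: "n > 0"
  shows "t \<le> 0 \<Longrightarrow> emeasure (radial_measure n R) {t<..} = ennreal (R / real n)"
    and "t \<ge> R \<Longrightarrow> emeasure (radial_measure n R) {t<..} = 0"
proof -
  have 0: "emeasure (radial_measure n R) {t<..} =
      (\<integral>\<^sup>+r. ennreal (indicat_real {0<..<R} r * (r / R) ^ (n - 1)) * indicator {t<..} r \<partial>lborel)" for t
    unfolding radial_measure_def by (rule emeasure_density) auto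
  show "emeasure (radial_measure n R) {t<..} = 0" if "t \<ge> R"
    unfolding 0 using that by (subst nn_integral_0_iff_AE) (auto simp: indicator_def)
  show "emeasure (radial_measure n R) {t<..} = ennreal (R / real n)" if "t \<le> 0"
  proof -
    have "emeasure (radial_measure n R) {t<..} = emeasure (radial_measure n R) {0<..}"
      unfolding 0 using that by (intro nn_integral_cong) (auto simp: indicator_def)
    then show ?thesis
      using emeasure_radial_measure_Ioi[OF R n, of 0] R n by (simp add: power_0_left)
  qed
qed

text \<open>
  For a fixed set \<open>B\<close> of directions both sides are measures in \<open>A\<close>, so it is enough to compare them on
  half-lines. The points of norm less than \<open>t\<close> in the cone over \<open>B\<close> are the image of the whole cone
  under the scaling by \<open>t / R\<close>, so in dimension \<open>n\<close> their volume is the fraction \<open>(t / R) ^ n\<close> of that of the cone. This is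
  also the growth of the integral of the radial density.
\<close>

lemma emeasure_cone:
  fixes B :: "'a::euclidean_space set"
  assumes R: "R > 0" and A: "A \<in> sets borel" and B: "B \<in> sets (sphere_measure R)"
  shows "emeasure (radial_measure DIM('a) R) A * emeasure (sphere_measure R) B =
    emeasure lborel {x \<in> ball 0 R - {0}. norm x \<in> A \<and> (R / norm x) *\<^sub>R x \<in> B}"
proof -
  define n where "n = DIM('a)"
  have n: "n > 0" by (simp add: n_def)
  define C where "C = {x \<in> ball 0 R - {0::'a}. (R / norm x) *\<^sub>R x \<in> B}"
  have [measurable]: "C \<in> sets borel" unfolding C_def by (rule emeasure_sphere_measure(2)[OF R B])
  have "emeasure lborel C \<le> emeasure lborel (ball (0::'a) R)"
    unfolding C_def by (rule emeasure_mono) auto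
  also have "\<dots> < \<infinity>" using emeasure_lborel_ball_finite by blast
  finally have Cfin: "emeasure lborel C < \<infinity>" .
  define c where "c = measure lborel C"
  have c: "emeasure lborel C = ennreal c" "c \<ge> 0"
    unfolding c_def using Cfin by (auto simp: emeasure_eq_ennreal_measure)
  have sB: "emeasure (sphere_measure R) B = ennreal (real n / R * c)"
    unfolding emeasure_sphere_measure(1)[OF R B] C_def[symmetric] c(1) n_def
    using R c(2) by (simp add: ennreal_mult'[symmetric])
  define MB where "MB = distr (restrict_space lborel C) borel norm"
  define NB where "NB = scale_measure (emeasure (sphere_measure R) B) (radial_measure n R)"
  have MB: "emeasure MB A = emeasure lborel {x \<in> C. norm x \<in> A}" if "A \<in> sets borel" for A
  proof -
    have "emeasure MB A = emeasure (restrict_space lborel C) (norm -` A \<inter> space (restrict_space lborel C))"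
      unfolding MB_def using that by (intro emeasure_distr) (auto intro: measurable_restrict_space1)
    also have "norm -` A \<inter> space (restrict_space lborel C) = {x \<in> C. norm x \<in> A}"
      by (auto simp: space_restrict_space)
    also have "emeasure (restrict_space lborel C) {x \<in> C. norm x \<in> A} = emeasure lborel {x \<in> C. norm x \<in> A}"
      by (rule emeasure_restrict_space) auto
    finally show ?thesis .
  qed
  have "MB = NB"
  proof (rule measure_eqI_lessThan)
    show "sets MB = sets borel" "sets NB = sets borel" by (simp_all add: MB_def NB_def)
    fix t :: real
    have "emeasure MB {t<..} \<le> emeasure lborel C"
      by (subst MB) (auto intro: emeasure_mono)
    then show "emeasure MB {t<..} < \<infinity>" using Cfin by (rule le_less_trans)
    consider "t \<le> 0" | "0 < t" "t < R" | "t \<ge> R" by linarith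
    then show "emeasure MB {t<..} = emeasure NB {t<..}"
    proof cases
      case 1
      then have "{x \<in> C. norm x \<in> {t<..}} = C" by (auto simp: C_def intro: le_less_trans)
      then show ?thesis
        using 1 R n c by (simp add: MB c NB_def emeasure_radial_measure_Ioi' sB flip: ennreal_mult')
    next
      case 3
      then have *: "{x \<in> C. norm x \<in> {t<..}} = {}" by (auto simp: C_def)
      show ?thesis
        using 3 R n c by (simp add: MB * NB_def emeasure_radial_measure_Ioi' del: greaterThan_iff)
    next
      case 2
      define lo where "lo = {x \<in> C. norm x < t}"
      define hi where "hi = {x \<in> C. norm x > t}"
      define mid where "mid = {x \<in> C. norm x = t}"
      have [measurable]: "lo \<in> sets borel" "hi \<in> sets borel" "mid \<in> sets borel"
        unfolding lo_def hi_def mid_def by measurable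
      have "lo = (\<lambda>x. (t / R) *\<^sub>R x + 0) ` C"
      proof (intro set_eqI iffI)
        fix x assume "x \<in> lo"
        then have "(R / t) *\<^sub>R x \<in> C" using 2 R
          by (auto simp: lo_def C_def field_simps)
        then show "x \<in> (\<lambda>x. (t / R) *\<^sub>R x + 0) ` C"
          using 2 R by (intro image_eqI[of _ _ "(R / t) *\<^sub>R x"]) auto
      next
        fix x assume "x \<in> (\<lambda>x. (t / R) *\<^sub>R x + 0) ` C"
        then obtain y where y: "x = (t / R) *\<^sub>R y" "y \<in> C" by auto
        then show "x \<in> lo" using 2 R mult_strict_mono[of t R "norm y" R]
          by (auto simp: lo_def C_def field_simps)
      qed
      then have "emeasure lebesgue lo = \<bar>t / R\<bar> ^ DIM('a) * emeasure lebesgue C"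
        by (simp only: emeasure_lebesgue_affine)
      then have lo: "emeasure lborel lo = ennreal ((t / R) ^ n * c)"
        using 2 R c by (simp add: n_def ennreal_mult')
      have "mid \<in> null_sets lborel"
      proof -
        have "negligible mid" 
          by (rule negligible_subset[OF negligible_sphere[of 0 t]]) (auto simp: mid_def)
        then have "emeasure lebesgue mid = 0" by (simp add: negligible_iff_null_sets null_sets_def)
        then show ?thesis by (auto simp: null_sets_def)
      qed
      then have mid: "emeasure lborel mid = 0" by auto
      have "C = (lo \<union> hi) \<union> mid" by (auto simp: lo_def hi_def mid_def)
      then have "emeasure lborel C = emeasure lborel lo + emeasure lborel hi"
        using mid by (simp add: emeasure_Un_null_set null_setsI)
          (rule plus_emeasure[symmetric]; auto simp: lo_def hi_def)
      then have eq: "ennreal c = ennreal ((t / R) ^ n * c) + emeasure lborel hi"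
        by (simp add: c lo)
      have hifin: "emeasure lborel hi \<noteq> top"
        using Cfin emeasure_mono[of hi C lborel] by (auto simp: hi_def top_unique)
      then obtain h where h: "emeasure lborel hi = ennreal h" "h \<ge> 0"
        by (metis ennreal_cases)
      have "c = (t / R) ^ n * c + h"
        using eq h c 2 R by (simp flip: ennreal_plus)
      then have "h = (1 - (t / R) ^ n) * c" by (simp add: algebra_simps)
      moreover have "emeasure MB {t<..} = emeasure lborel hi"
        by (subst MB) (auto simp: hi_def)
      moreover have "0 \<le> 1 - (t / R) ^ n" using 2 R by (simp add: power_le_one)
      ultimately show ?thesis
        using 2 R n c by (simp add: NB_def sB h emeasure_radial_measure_Ioi ennreal_mult'[symmetric])
    qed
  qed
  then have "emeasure NB A = emeasure lborel {x \<in> C. norm x \<in> A}"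
    using MB[OF A] by simp
  moreover have "{x \<in> C. norm x \<in> A} = {x \<in> ball 0 R - {0}. norm x \<in> A \<and> (R / norm x) *\<^sub>R x \<in> B}"
    by (auto simp: C_def)
  ultimately show ?thesis by (simp add: NB_def n_def mult.commute)
qed

lemma sigma_finite_radial_measure:
  assumes "R > 0" "n > 0" shows "sigma_finite_measure (radial_measure n R)"
proof -
  have "emeasure (radial_measure n R) UNIV = emeasure (radial_measure n R) {0<..}"
    unfolding radial_measure_def
    by (subst (1 2) emeasure_density) (auto intro!: nn_integral_cong simp: indicator_def)
  then have "finite_measure (radial_measure n R)"
    using emeasure_radial_measure_Ioi'(1)[OF assms, of 0] by (intro finite_measureI) auto
  then show ?thesis by (simp add: finite_measure_def)
qed

text \<open>
  A measure on a product is determined by its values on rectangles, and these are the cones above.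
\<close>

lemma polar_measure:
  assumes R: "R > 0"
  shows "radial_measure DIM('a) R \<Otimes>\<^sub>M sphere_measure R =
    distr (restrict_space lborel (ball 0 R - {0::'a::euclidean_space})) (borel \<Otimes>\<^sub>M sphere_measure R)
      (\<lambda>x. (norm x, (R / norm x) *\<^sub>R x))"
    and "(\<lambda>x::'a. (norm x, (R / norm x) *\<^sub>R x)) \<in> restrict_space lborel (ball 0 R - {0}) \<rightarrow>\<^sub>M borel \<Otimes>\<^sub>M sphere_measure R"
proof -
  interpret S: finite_measure "sphere_measure R :: 'a measure" by (rule finite_sphere_measure[OF R])
  have m1: "(\<lambda>x::'a. (R / norm x) *\<^sub>R x) \<in> restrict_space lborel (ball 0 R - {0}) \<rightarrow>\<^sub>M sphere_measure R"
    unfolding measurable_cong_sets[OF refl sets_sphere_measure]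
    using R by (intro measurable_restrict_space2 measurable_restrict_space1) (auto simp: space_restrict_space)
  show m: "(\<lambda>x::'a. (norm x, (R / norm x) *\<^sub>R x)) \<in> restrict_space lborel (ball 0 R - {0}) \<rightarrow>\<^sub>M borel \<Otimes>\<^sub>M sphere_measure R"
    by (rule measurable_Pair[OF measurable_restrict_space1 m1]) auto
  show "radial_measure DIM('a) R \<Otimes>\<^sub>M sphere_measure R =
    distr (restrict_space lborel (ball 0 R - {0::'a})) (borel \<Otimes>\<^sub>M sphere_measure R)
      (\<lambda>x. (norm x, (R / norm x) *\<^sub>R x))" (is "_ = ?N")
  proof (rule pair_measure_eqI)
    show "sigma_finite_measure (radial_measure DIM('a) R)"
      using R by (intro sigma_finite_radial_measure) auto
    show "sigma_finite_measure (sphere_measure R :: 'a measure)" ..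
    show "sets (radial_measure DIM('a) R \<Otimes>\<^sub>M (sphere_measure R :: 'a measure)) = sets ?N"
      by (simp cong: sets_pair_measure_cong)
    fix A and B :: "'a set" 
    assume A: "A \<in> sets (radial_measure DIM('a) R)" and B: "B \<in> sets (sphere_measure R)"
    have "emeasure ?N (A \<times> B) = emeasure (restrict_space lborel (ball 0 R - {0::'a}))
        ((\<lambda>x. (norm x, (R / norm x) *\<^sub>R x)) -` (A \<times> B) \<inter> space (restrict_space lborel (ball 0 R - {0})))"
      using A B by (intro emeasure_distr m) auto
    also have "(\<lambda>x. (norm x, (R / norm x) *\<^sub>R x)) -` (A \<times> B) \<inter> space (restrict_space lborel (ball 0 R - {0}))
        = {x \<in> ball 0 R - {0}. norm x \<in> A \<and> (R / norm x) *\<^sub>R x \<in> B}" (is "_ = ?C")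
      by (auto simp: space_restrict_space)
    also have "emeasure (restrict_space lborel (ball 0 R - {0::'a})) ?C = emeasure lborel ?C"
      by (rule emeasure_restrict_space) auto
    also have "\<dots> = emeasure (radial_measure DIM('a) R) A * emeasure (sphere_measure R) B"
      using A by (intro emeasure_cone[OF R _ B, symmetric]) simp
    finally show "emeasure (radial_measure DIM('a) R) A * emeasure (sphere_measure R) B = emeasure ?N (A \<times> B)" ..
  qed
qed

lemma ball_measure_borel:
  fixes f :: "'a::euclidean_space \<Rightarrow> 'b::{banach, second_countable_topology}"
  assumes [measurable]: "f \<in> borel_measurable borel"
  shows "integrable (restrict_space lborel (ball 0 R - {0})) f \<longleftrightarrow> integrable (ball_measure R) f"
    and "integral\<^sup>L (restrict_space lborel (ball 0 R - {0})) f = integral\<^sup>L (ball_measure R) f"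
proof -
  have mm: "(\<lambda>x. indicat_real (ball 0 R - {0}) x *\<^sub>R f x) \<in> borel_measurable lborel"
    "(\<lambda>x. indicat_real (ball 0 R) x *\<^sub>R f x) \<in> borel_measurable lborel"
    by (intro borel_measurable_scaleR borel_measurable_indicator; use assms in simp)+
  have ae: "AE x in lborel. indicat_real (ball 0 R - {0}) x *\<^sub>R f x = indicat_real (ball 0 R) x *\<^sub>R f x"
    using AE_lborel_singleton[of "0::'a"] by eventually_elim (auto simp: indicator_def)
  have "integrable (restrict_space lborel (ball 0 R - {0})) f \<longleftrightarrow>
      integrable lborel (\<lambda>x. indicat_real (ball 0 R - {0}) x *\<^sub>R f x)"
    by (rule integrable_restrict_space) auto
  also have "\<dots> \<longleftrightarrow> integrable lborel (\<lambda>x. indicat_real (ball 0 R) x *\<^sub>R f x)"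
    by (rule integrable_cong_AE[OF mm ae])
  also have "\<dots> \<longleftrightarrow> integrable lebesgue (\<lambda>x. indicat_real (ball 0 R) x *\<^sub>R f x)"
    by (rule integrable_completion[symmetric, OF mm(2)])
  also have "\<dots> \<longleftrightarrow> integrable (ball_measure R) f"
    by (rule integrable_restrict_space[symmetric]) auto
  finally show "integrable (restrict_space lborel (ball 0 R - {0})) f \<longleftrightarrow> integrable (ball_measure R) f" .
  have "integral\<^sup>L (restrict_space lborel (ball 0 R - {0})) f =
      integral\<^sup>L lborel (\<lambda>x. indicat_real (ball 0 R - {0}) x *\<^sub>R f x)"
    by (rule integral_restrict_space) auto
  also have "\<dots> = integral\<^sup>L lborel (\<lambda>x. indicat_real (ball 0 R) x *\<^sub>R f x)"
    by (rule integral_cong_AE[OF mm ae])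
  also have "\<dots> = integral\<^sup>L lebesgue (\<lambda>x. indicat_real (ball 0 R) x *\<^sub>R f x)"
    by (rule integral_completion[symmetric, OF mm(2)])
  also have "\<dots> = integral\<^sup>L (ball_measure R) f"
    by (rule integral_restrict_space[symmetric]) auto
  finally show "integral\<^sup>L (restrict_space lborel (ball 0 R - {0})) f = integral\<^sup>L (ball_measure R) f" .
qed

lemma polar_integral:
  fixes f :: "'a::euclidean_space \<Rightarrow> 'b::{banach, second_countable_topology}"
  assumes R: "R > 0" and f [measurable]: "f \<in> borel_measurable borel" and int: "integrable (ball_measure R) f"
  shows "integral\<^sup>L (ball_measure R) f =
    (\<integral>w. (\<integral>r. (indicat_real {0<..<R} r * (r / R) ^ (DIM('a) - 1)) *\<^sub>R f ((r / R) *\<^sub>R w) \<partial>lborel) \<partial>sphere_measure R)"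
proof -
  let ?N = "radial_measure DIM('a) R \<Otimes>\<^sub>M (sphere_measure R :: 'a measure)"
  interpret S: finite_measure "sphere_measure R :: 'a measure" by (rule finite_sphere_measure[OF R])
  interpret D: sigma_finite_measure "radial_measure DIM('a) R"
    using R by (intro sigma_finite_radial_measure) auto
  interpret P: pair_sigma_finite "radial_measure DIM('a) R" "sphere_measure R :: 'a measure" ..
  define F where "F = (\<lambda>(r, w). f ((r / R) *\<^sub>R w))"
  have id: "(\<lambda>x. x) \<in> sphere_measure R \<rightarrow>\<^sub>M (borel :: 'a measure)"
    by (rule borel_measurable_sphere_measure) simp
  have F: "F \<in> borel_measurable (borel \<Otimes>\<^sub>M sphere_measure R)"
    unfolding F_def case_prod_beta
    by (intro measurable_compose[OF _ f] borel_measurable_scaleR measurable_compose[OF measurable_snd id]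
        borel_measurable_divide measurable_fst) auto
  have inv: "F (norm x, (R / norm x) *\<^sub>R x) = f x" if "x \<in> space (restrict_space lborel (ball 0 R - {0}))" for x
    using that R by (simp add: F_def space_restrict_space)
  have 1: "integral\<^sup>L ?N F = integral\<^sup>L (restrict_space lborel (ball 0 R - {0})) (\<lambda>x. F (norm x, (R / norm x) *\<^sub>R x))"
    unfolding polar_measure(1)[OF R] by (rule integral_distr[OF polar_measure(2)[OF R] F])
  also have "\<dots> = integral\<^sup>L (restrict_space lborel (ball 0 R - {0})) f"
    by (rule Bochner_Integration.integral_cong[OF refl inv])
  also have "\<dots> = integral\<^sup>L (ball_measure R) f" by (rule ball_measure_borel(2)[OF f])
  finally have 2: "integral\<^sup>L ?N F = integral\<^sup>L (ball_measure R) f" .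
  have "integrable (restrict_space lborel (ball 0 R - {0})) (\<lambda>x. F (norm x, (R / norm x) *\<^sub>R x))"
    using int ball_measure_borel(1)[OF f, of R] inv by (subst Bochner_Integration.integrable_cong[OF refl inv]) auto
  then have "integrable ?N F"
    unfolding polar_measure(1)[OF R] using integrable_distr_eq[OF polar_measure(2)[OF R] F] by simp
  then have "integral\<^sup>L ?N F = (\<integral>w. (\<integral>r. f ((r / R) *\<^sub>R w) \<partial>radial_measure DIM('a) R) \<partial>sphere_measure R)"
    unfolding F_def by (rule P.integral_snd[symmetric])
  also have "(\<lambda>w. \<integral>r. f ((r / R) *\<^sub>R w) \<partial>radial_measure DIM('a) R) =
     (\<lambda>w. \<integral>r. (indicat_real {0<..<R} r * (r / R) ^ (DIM('a) - 1)) *\<^sub>R f ((r / R) *\<^sub>R w) \<partial>lborel)"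
  proof
    fix w :: 'a
    show "(\<integral>r. f ((r / R) *\<^sub>R w) \<partial>radial_measure DIM('a) R) =
     (\<integral>r. (indicat_real {0<..<R} r * (r / R) ^ (DIM('a) - 1)) *\<^sub>R f ((r / R) *\<^sub>R w) \<partial>lborel)"
      unfolding radial_measure_def
      by (rule integral_density) (auto simp: indicator_def)
  qed
  finally show ?thesis using 2 by simp
qed

text \<open>
  A null set of radii gives a null set of points. Hence a radial potential may be altered on a null set
  of radii.
\<close>

lemma AE_ball_norm:
  assumes R: "R > 0" and N: "N \<in> null_sets (lborel :: real measure)"
  shows "AE x in ball_measure R. norm (x::'a::euclidean_space) \<notin> N"
proof -
  have [measurable]: "N \<in> sets borel" using N by auto
  have S: "sphere (0::'a) R \<in> sets (sphere_measure R)" by (simp add: borel_subset_sphere_measure)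
  have "AE r in lborel. r \<notin> N" using N by (rule AE_not_in)
  then have "emeasure (radial_measure DIM('a) R) N = 0"
    unfolding radial_measure_def
    by (subst emeasure_density, simp, simp, subst nn_integral_0_iff_AE, simp)
       (auto elim!: eventually_mono simp: indicator_def)
  then have "emeasure lborel {x \<in> ball 0 R - {0::'a}. norm x \<in> N \<and> (R / norm x) *\<^sub>R x \<in> sphere 0 R} = 0"
    using emeasure_cone[OF R _ S, of N] by simp
  also have "{x \<in> ball 0 R - {0::'a}. norm x \<in> N \<and> (R / norm x) *\<^sub>R x \<in> sphere 0 R} =
      {x \<in> ball 0 R - {0}. norm x \<in> N}" using R by auto
  finally have "{x \<in> ball 0 R - {0::'a}. norm x \<in> N} \<in> null_sets lborel"
    by (intro null_setsI) auto
  then have "AE x in lborel. x \<notin> {x \<in> ball 0 R - {0::'a}. norm x \<in> N}" by (rule AE_not_in)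
  then have "AE x in lborel. x \<in> ball 0 R \<longrightarrow> norm (x::'a) \<notin> N"
    using AE_lborel_singleton[of "0::'a"] by eventually_elim auto
  then have "AE x in lebesgue. x \<in> ball 0 R \<longrightarrow> norm (x::'a) \<notin> N"
    by (rule AE_completion)
  then show ?thesis by (subst AE_restrict_space_iff) auto
qed

section \<open>Cutoff functions\<close>

text \<open>
  A step from 0 to 1 with a piecewise linear derivative: a second difference of the square of the
  positive part.
\<close>

definition smoothstep :: "real \<Rightarrow> real" where
  "smoothstep t = 2 * (max 0 t)\<^sup>2 - 4 * (max 0 (t - 1/2))\<^sup>2 + 2 * (max 0 (t - 1))\<^sup>2"

definition smoothstep' :: "real \<Rightarrow> real" where
  "smoothstep' t = 4 * max 0 t - 8 * max 0 (t - 1/2) + 4 * max 0 (t - 1)"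

lemma has_real_derivative_pos_part_square:
  "((\<lambda>t. (max 0 t)\<^sup>2) has_real_derivative 2 * max 0 t) (at t)"
proof -
  consider "t < 0" | "t = 0" | "t > 0" using linorder_less_linear[of t 0] by blast
  then show ?thesis
  proof cases
    case 1
    have "((\<lambda>t. (max 0 t)\<^sup>2) has_real_derivative 0) (at t)"
      by (rule has_field_derivative_transform_within_open[of "\<lambda>t. 0" _ _ "{..<0}"]) (use 1 in auto)
    then show ?thesis using 1 by simp
  next
    case 3
    have "((\<lambda>t. t\<^sup>2) has_real_derivative 2 * t) (at t)"
      by (auto intro!: derivative_eq_intros)
    then have "((\<lambda>t. (max 0 t)\<^sup>2) has_real_derivative 2 * t) (at t)"
      by (rule has_field_derivative_transform_within_open[of _ _ _ "{0<..}"]) (use 3 in auto)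
    then show ?thesis using 3 by simp
  next
    case 2
    have "(\<lambda>y. ((max 0 y)\<^sup>2 - (max 0 0)\<^sup>2) / (y - 0)) \<midarrow>0\<rightarrow> (0::real)"
    proof (rule Lim_null_comparison)
      show "\<forall>\<^sub>F y::real in at 0. norm (((max 0 y)\<^sup>2 - (max 0 0)\<^sup>2) / (y - 0)) \<le> \<bar>y\<bar>"
        by (intro always_eventually) (auto simp: max_def power2_eq_square)
      show "(\<lambda>y. \<bar>y\<bar>) \<midarrow>0\<rightarrow> (0::real)" by (intro tendsto_eq_intros) auto
    qed
    then show ?thesis using 2 by (simp add: has_field_derivative_iff)
  qed
qed

lemma has_real_derivative_smoothstep:
  "(smoothstep has_real_derivative smoothstep' t) (at t)"
proof -
  have *: "((\<lambda>t. (max 0 (t - c))\<^sup>2) has_real_derivative 2 * max 0 (t - c)) (at t)" for c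
  proof -
    have "((\<lambda>t. t - c) has_real_derivative 1) (at t)" by (auto intro!: derivative_eq_intros)
    from DERIV_chain2[where f = "\<lambda>t. (max 0 t)\<^sup>2", OF has_real_derivative_pos_part_square this]
    show ?thesis by simp
  qed
  have "((\<lambda>t. 2 * (max 0 t)\<^sup>2 - 4 * (max 0 (t - 1/2))\<^sup>2 + 2 * (max 0 (t - 1))\<^sup>2) has_real_derivative smoothstep' t) (at t)"
    using DERIV_add[OF DERIV_diff[OF DERIV_cmult[OF has_real_derivative_pos_part_square, of 2 t]
      DERIV_cmult[OF *[of "1/2"], of 4]] DERIV_cmult[OF *[of 1], of 2]]
    by (simp add: smoothstep'_def)
  then show ?thesis unfolding smoothstep_def[abs_def] .
qed

lemma continuous_smoothstep' [continuous_intros]: "continuous_on S smoothstep'"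
  unfolding smoothstep'_def by (intro continuous_intros)

lemma continuous_smoothstep: "continuous_on S smoothstep"
  using DERIV_isCont[OF has_real_derivative_smoothstep] by (simp add: continuous_at_imp_continuous_on)

lemma smoothstep_0 [simp]: "t \<le> 0 \<Longrightarrow> smoothstep t = 0"
  and smoothstep'_0 [simp]: "t \<le> 0 \<Longrightarrow> smoothstep' t = 0"
  by (simp_all add: smoothstep_def smoothstep'_def max_absorb1)

lemma smoothstep_1 [simp]: "t \<ge> 1 \<Longrightarrow> smoothstep t = 1"
  and smoothstep'_1 [simp]: "t \<ge> 1 \<Longrightarrow> smoothstep' t = 0"
  by (simp_all add: smoothstep_def smoothstep'_def max_absorb2 power2_eq_square algebra_simps)

lemma smoothstep'_bounds: "0 \<le> smoothstep' t" "smoothstep' t \<le> 2"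
  by (auto simp: smoothstep'_def max_def)

lemma smoothstep_bounds: "0 \<le> smoothstep t" "smoothstep t \<le> 1"
proof -
  have mono: "smoothstep s \<le> smoothstep t" if "s \<le> t" for s t
    using that by (rule DERIV_nonneg_imp_nondecreasing)
      (use has_real_derivative_smoothstep smoothstep'_bounds in blast)
  show "0 \<le> smoothstep t" using mono[of "min 0 t" t] by simp
  show "smoothstep t \<le> 1" using mono[of t "max 1 t"] by simp
qed

text \<open>
  A function of \<open>x \<bullet> x\<close> and not of the norm, to keep it smooth at the origin. It vanishes where
  \<open>R\<^sup>2 - x \<bullet> x \<le> 1 / n\<close> and is 1 where \<open>R\<^sup>2 - x \<bullet> x \<ge> 2 / n\<close>, so its transition layer has width of
  order \<open>1 / n\<close>.
\<close>

definition cutoff :: "real \<Rightarrow> real \<Rightarrow> 'a::euclidean_space \<Rightarrow> complex" where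
  "cutoff R n x = of_real (smoothstep (n * (R\<^sup>2 - x \<bullet> x) - 1))"

lemma cutoff_C1: "cutoff R n \<in> C1"
  and partial_deriv_cutoff: "partial_deriv b (cutoff R n) x =
    - of_real (2 * n * (x \<bullet> b) * smoothstep' (n * (R\<^sup>2 - x \<bullet> x) - 1))"
proof -
  have d: "((\<lambda>t. smoothstep (n * (R\<^sup>2 - t) - 1)) has_real_derivative
      smoothstep' (n * (R\<^sup>2 - t) - 1) * (- n)) (at t)" for t
    by (rule DERIV_chain2[OF has_real_derivative_smoothstep]) (auto intro!: derivative_eq_intros)
  have c: "continuous_on UNIV (\<lambda>t. smoothstep' (n * (R\<^sup>2 - t) - 1) * (- n))"
    by (intro continuous_intros continuous_on_compose2[OF continuous_smoothstep'[of UNIV]]) auto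
  show "cutoff R n \<in> C1"
    using C1_square_compose(1)[OF d c] by (simp add: cutoff_def[abs_def])
  show "partial_deriv b (cutoff R n) x =
    - of_real (2 * n * (x \<bullet> b) * smoothstep' (n * (R\<^sup>2 - x \<bullet> x) - 1))"
    using C1_square_compose(2)[OF d c, of b x] by (simp add: cutoff_def[abs_def] mult_ac)
qed

lemma norm_cutoff_le: "norm (cutoff R n x) \<le> 1"
  using smoothstep_bounds by (simp add: cutoff_def)

lemma ball_square_diff_pos:
  assumes "x \<in> ball 0 R" shows "0 < R\<^sup>2 - x \<bullet> x"
proof -
  have "(norm x)\<^sup>2 < R\<^sup>2" using assms by (intro power_strict_mono) auto
  then show ?thesis by (simp add: power2_norm_eq_inner)
qed

lemma eventually_multiple_gt:
  fixes c K :: real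
  assumes "c > 0" shows "\<forall>\<^sub>F n in sequentially. real n * c > K"
proof -
  obtain N :: nat where "real N > K / c" using reals_Archimedean2 by blast
  then have "real n * c > K" if "n \<ge> N" for n
    using that assms by (simp add: field_simps) (meson less_le_trans mult_left_mono less_imp_le of_nat_le_iff)
  then show ?thesis by (rule eventually_sequentiallyI)
qed

lemma cutoff_tendsto:
  assumes "x \<in> ball 0 R"
  shows "(\<lambda>n. cutoff R (real n) x) \<longlonglongrightarrow> 1"
  using eventually_multiple_gt[OF ball_square_diff_pos[OF assms], of 2]
  by (intro tendsto_eventually) (auto elim!: eventually_mono simp: cutoff_def)

lemma norm_one_minus_cutoff_le: "norm (1 - cutoff R n x) \<le> 1"
proof -
  have "1 - cutoff R n x = of_real (1 - smoothstep (n * (R\<^sup>2 - x \<bullet> x) - 1))" by (simp add: cutoff_def)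
  then show ?thesis using smoothstep_bounds[of "n * (R\<^sup>2 - x \<bullet> x) - 1"] by (simp only: norm_of_real)
qed

lemma cutoff_mult_C1_c:
  fixes f :: "'a::euclidean_space \<Rightarrow> complex"
  assumes f: "f \<in> C1" and n: "n > 0" and R: "R > 0"
  shows "(\<lambda>x. cutoff R n x * f x) \<in> C1_c R"
proof -
  have "{x. cutoff R n x * f x \<noteq> 0} \<subseteq> {x. x \<bullet> x \<le> R\<^sup>2 - 1 / n}"
  proof
    fix x assume "x \<in> {x. cutoff R n x * f x \<noteq> 0}"
    then have "smoothstep (n * (R\<^sup>2 - x \<bullet> x) - 1) \<noteq> 0" by (simp add: cutoff_def)
    then have "n * (R\<^sup>2 - x \<bullet> x) - 1 > 0" by (meson smoothstep_0 not_le)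
    then show "x \<in> {x. x \<bullet> x \<le> R\<^sup>2 - 1 / n}" using n by (simp add: field_simps)
  qed
  moreover have "closed {x::'a. x \<bullet> x \<le> R\<^sup>2 - 1 / n}"
    by (intro closed_Collect_le continuous_intros)
  ultimately have "closure {x. cutoff R n x * f x \<noteq> 0} \<subseteq> {x. x \<bullet> x \<le> R\<^sup>2 - 1 / n}"
    by (rule closure_minimal)
  also have "\<dots> \<subseteq> ball 0 R"
  proof
    fix x :: 'a assume "x \<in> {x. x \<bullet> x \<le> R\<^sup>2 - 1 / n}"
    moreover have "1 / n > 0" using n by simp
    ultimately have "(norm x)\<^sup>2 < R\<^sup>2" unfolding power2_norm_eq_inner mem_Collect_eq by linarith
    then have "norm x < R" by (rule power2_less_imp_less) (use R in simp)
    then show "x \<in> ball 0 R" by simp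
  qed
  finally show ?thesis
    unfolding C1_c_def using C1_mult(1)[OF cutoff_C1 f] by simp
qed

lemma C1_c_C1: "\<phi> \<in> C1_c R \<Longrightarrow> \<phi> \<in> C1"
  by (simp add: C1_c_def)

lemma C1_c_zero:
  assumes "\<phi> \<in> C1_c R" and "x \<notin> ball 0 R"
  shows "\<phi> x = 0" and "partial_deriv b \<phi> x = 0"
proof -
  let ?K = "closure {x. \<phi> x \<noteq> 0}"
  have x: "x \<in> - ?K" using assms unfolding C1_c_def by blast
  have sub: "\<phi> y = 0" if "y \<in> - ?K" for y
    using that closure_subset[of "{x. \<phi> x \<noteq> 0}"] by auto
  show "\<phi> x = 0" by (rule sub[OF x])
  have "(\<phi> has_derivative (\<lambda>h. 0)) (at x)"
  proof (rule has_derivative_transform_within_open[of "\<lambda>x. 0" _ _ _ "- ?K"])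
    show "open (- ?K)" by (simp add: open_Compl)
    show "0 = \<phi> y" if "y \<in> - ?K" for y using sub[OF that] by (rule sym)
    show "x \<in> - ?K" by (rule x)
    show "((\<lambda>x. 0) has_derivative (\<lambda>h. 0)) (at x)" by (rule has_derivative_const)
  qed
  then show "partial_deriv b \<phi> x = 0" by (simp add: partial_deriv_eq)
qed

section \<open>The divergence theorem on a ball\<close>

lemma finite_ball_measure: "finite_measure (ball_measure R :: 'a::euclidean_space measure)"
  by (rule finite_measure_lebesgue_on) auto

lemma borel_measurable_ball_measure:
  "f \<in> borel_measurable borel \<Longrightarrow> f \<in> borel_measurable (ball_measure R)"
  by (intro measurable_restrict_space1 measurable_completion) auto

lemma integrable_ball_bounded:
  fixes f :: "'a::euclidean_space \<Rightarrow> 'b::{banach, second_countable_topology}"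
  assumes "f \<in> borel_measurable (ball_measure R)" and "AE x in ball_measure R. norm (f x) \<le> B"
  shows "integrable (ball_measure R) f"
  using finite_measure.integrable_const_bound[OF finite_ball_measure assms(2,1)] .

lemma continuous_bounded_ball:
  fixes f :: "'a::euclidean_space \<Rightarrow> 'b::real_normed_vector"
  assumes "continuous_on UNIV f"
  obtains B where "B > 0" "\<And>x. x \<in> cball 0 R \<Longrightarrow> norm (f x) \<le> B"
proof -
  have "bounded (f ` cball 0 R)"
    by (intro compact_imp_bounded compact_continuous_image continuous_on_subset[OF assms]) auto
  then show ?thesis using that unfolding bounded_pos by auto
qed

lemma integrable_ball_continuous:
  fixes f :: "'a::euclidean_space \<Rightarrow> 'b::{banach, second_countable_topology}"
  assumes "continuous_on UNIV f"
  shows "integrable (ball_measure R) f"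
proof -
  obtain B where "B > 0" "\<And>x. x \<in> cball 0 R \<Longrightarrow> norm (f x) \<le> B"
    using continuous_bounded_ball[OF assms, where R = R] by blast
  then show ?thesis
    using assms by (intro integrable_ball_bounded[where B = B] borel_measurable_ball_measure AE_I2)
      (auto simp: borel_measurable_continuous_onI space_restrict_space)
qed

lemma integral_ball_lborel:
  fixes f :: "'a::euclidean_space \<Rightarrow> 'b::{banach, second_countable_topology}"
  assumes "f \<in> borel_measurable borel" "\<And>x. x \<notin> ball 0 R \<Longrightarrow> f x = 0"
  shows "integral\<^sup>L (ball_measure R) f = integral\<^sup>L lborel f"
    and "integrable (ball_measure R) f \<longleftrightarrow> integrable lborel f"
proof -
  have *: "(\<lambda>x. indicat_real (ball 0 R) x *\<^sub>R f x) = f"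
    using assms(2) by (auto simp: fun_eq_iff indicator_def)
  have m: "f \<in> borel_measurable lborel" using assms(1) by simp
  have "integral\<^sup>L (ball_measure R) f = integral\<^sup>L lebesgue f"
    by (subst integral_restrict_space) (auto simp: *)
  then show "integral\<^sup>L (ball_measure R) f = integral\<^sup>L lborel f"
    using integral_completion[OF m] by simp
  have "integrable (ball_measure R) f \<longleftrightarrow> integrable lebesgue f"
    by (subst integrable_restrict_space) (auto simp: *)
  then show "integrable (ball_measure R) f \<longleftrightarrow> integrable lborel f"
    using integrable_completion[OF m] by simp
qed

lemma partial_deriv_scaleR:
  assumes "f \<in> C1" shows "partial_deriv (t *\<^sub>R b) f x = of_real t * partial_deriv b f x"
proof -
  interpret bounded_linear "\<lambda>h. partial_deriv h f x"
    using C1_has_derivative[OF assms] by (rule has_derivative_bounded_linear)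
  show ?thesis using scaleR[of t b] by (simp only: scaleR_conv_of_real)
qed

text \<open>
  By translation invariance the difference quotients in the direction \<open>b\<close> have integral zero, and they
  are uniformly bounded with supports in a common ball.
\<close>

lemma integral_partial_deriv_C1_c:
  fixes \<phi> :: "'a::euclidean_space \<Rightarrow> complex"
  assumes \<phi>: "\<phi> \<in> C1_c R"
  shows "(\<integral>x. partial_deriv b \<phi> x \<partial>ball_measure R) = 0"
proof -
  note C = C1_c_C1[OF \<phi>]
  have cont: "continuous_on UNIV (partial_deriv b \<phi>)" "continuous_on UNIV \<phi>"
    using C1_continuous[OF C] C1_continuous_partial[OF C] by auto
  obtain M where M: "M > 0" "\<And>x. x \<in> cball 0 R \<Longrightarrow> norm (partial_deriv b \<phi> x) \<le> M"
    using continuous_bounded_ball[OF cont(1), where R = R] by blast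
  then have M': "norm (partial_deriv b \<phi> x) \<le> M" for x
    using C1_c_zero(2)[OF \<phi>, of x b] M(1) M(2)[of x] by (cases "x \<in> ball 0 R") simp_all
  have [measurable]: "\<phi> \<in> borel_measurable borel" "partial_deriv b \<phi> \<in> borel_measurable borel"
    using cont by (auto simp: borel_measurable_continuous_onI)
  have int: "integrable lborel \<phi>"
    using integral_ball_lborel(2)[of \<phi> R] C1_c_zero(1)[OF \<phi>] integrable_ball_continuous[OF cont(2), of R] by simp
  have lip: "norm (\<phi> (x + t *\<^sub>R b) - \<phi> x) \<le> M * \<bar>t\<bar>" for x t
  proof -
    have "norm (\<phi> (x + t *\<^sub>R b) - \<phi> (x + 0 *\<^sub>R b)) \<le> M * norm (t - 0)"
    proof (rule differentiable_bound[of UNIV])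
      fix s :: real
      show "((\<lambda>s. \<phi> (x + s *\<^sub>R b)) has_derivative (\<lambda>h. partial_deriv (h *\<^sub>R b) \<phi> (x + s *\<^sub>R b))) (at s within UNIV)"
        by (rule C1_has_derivative_compose[OF C]) (auto intro!: derivative_eq_intros)
      show "onorm (\<lambda>h. partial_deriv (h *\<^sub>R b) \<phi> (x + s *\<^sub>R b)) \<le> M"
        using M(1) M'[of "x + s *\<^sub>R b"]
        by (intro onorm_le) (simp add: partial_deriv_scaleR[OF C] norm_mult mult.commute[of M] mult_left_mono)
    qed auto
    then show ?thesis by simp
  qed
  define q where "q n x = of_nat (Suc n) * (\<phi> (x + (1 / real (Suc n)) *\<^sub>R b) - \<phi> x)" for n x
  have q0: "integral\<^sup>L lborel (q n) = 0" for n
  proof -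
    let ?t = "(1 / real (Suc n)) *\<^sub>R b"
    have d: "distr lborel borel ((+) ?t) = lborel" by (rule lborel_distr_plus)
    have i: "integrable lborel (\<lambda>x. \<phi> (?t + x))"
      using integrable_distr_eq[of "(+) ?t" lborel borel \<phi>] int unfolding d by simp
    have "integral\<^sup>L lborel \<phi> = (\<integral>x. \<phi> (?t + x) \<partial>lborel)"
      using integral_distr[of "(+) ?t" lborel borel \<phi>] unfolding d by simp
    then have "(\<integral>x. (\<phi> (?t + x) - \<phi> x) \<partial>lborel) = 0"
      using Bochner_Integration.integral_diff[OF i int] by simp
    then show ?thesis unfolding q_def by (simp add: add.commute)
  qed
  have "(\<lambda>n. integral\<^sup>L lborel (q n)) \<longlonglongrightarrow> integral\<^sup>L lborel (partial_deriv b \<phi>)"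
  proof (rule integral_dominated_convergence[where w = "\<lambda>x. indicator (cball 0 (R + norm b)) x *\<^sub>R M"])
    show "integrable lborel (\<lambda>x::'a. indicat_real (cball 0 (R + norm b)) x *\<^sub>R M)"
      by (intro integrable_scaleR_left integrable_real_indicator) (simp_all add: emeasure_lborel_cball_finite[unfolded infinity_ennreal_def])
    show "AE x in lborel. (\<lambda>n. q n x) \<longlonglongrightarrow> partial_deriv b \<phi> x"
    proof (rule AE_I2)
      fix x
      have "((\<lambda>s. \<phi> (x + s *\<^sub>R b)) has_vector_derivative partial_deriv b \<phi> (x + 0 *\<^sub>R b)) (at 0)"
      proof -
        have "((\<lambda>s::real. \<phi> (x + s *\<^sub>R b)) has_derivative (\<lambda>h. partial_deriv (h *\<^sub>R b) \<phi> (x + 0 *\<^sub>R b))) (at 0)"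
          by (rule C1_has_derivative_compose[OF C]) (auto intro!: derivative_eq_intros)
        then show ?thesis
          by (simp add: has_vector_derivative_def partial_deriv_scaleR[OF C] scaleR_conv_of_real)
      qed
      then have "((\<lambda>h. (\<phi> (x + h *\<^sub>R b) - \<phi> x) /\<^sub>R h) \<longlongrightarrow> partial_deriv b \<phi> x) (at 0)"
      proof -
        assume "((\<lambda>s. \<phi> (x + s *\<^sub>R b)) has_vector_derivative partial_deriv b \<phi> (x + 0 *\<^sub>R b)) (at 0)"
        then have "((\<lambda>h. norm (\<phi> (x + h *\<^sub>R b) - \<phi> x - h *\<^sub>R partial_deriv b \<phi> x) / norm h) \<longlongrightarrow> 0) (at 0)"
          by (simp add: has_vector_derivative_def has_derivative_at)
        then have "((\<lambda>h. norm ((\<phi> (x + h *\<^sub>R b) - \<phi> x) /\<^sub>R h - partial_deriv b \<phi> x)) \<longlongrightarrow> 0) (at 0)"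
        proof (rule Lim_transform_eventually)
          show "\<forall>\<^sub>F h in at 0. norm (\<phi> (x + h *\<^sub>R b) - \<phi> x - h *\<^sub>R partial_deriv b \<phi> x) / norm h =
            norm ((\<phi> (x + h *\<^sub>R b) - \<phi> x) /\<^sub>R h - partial_deriv b \<phi> x)"
            unfolding eventually_at_filter
          proof (intro always_eventually allI impI)
            fix h :: real assume "h \<noteq> 0"
            then have "(\<phi> (x + h *\<^sub>R b) - \<phi> x) /\<^sub>R h - partial_deriv b \<phi> x =
              inverse h *\<^sub>R (\<phi> (x + h *\<^sub>R b) - \<phi> x - h *\<^sub>R partial_deriv b \<phi> x)"
              by (simp add: scaleR_diff_right)
            then show "norm (\<phi> (x + h *\<^sub>R b) - \<phi> x - h *\<^sub>R partial_deriv b \<phi> x) / norm h =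
              norm ((\<phi> (x + h *\<^sub>R b) - \<phi> x) /\<^sub>R h - partial_deriv b \<phi> x)"
              by (simp only: norm_scaleR norm_inverse abs_inverse real_norm_def divide_inverse mult.commute)
          qed
        qed
        then show ?thesis by (rule LIM_zero_cancel[OF tendsto_norm_zero_cancel])
      qed
      moreover have "filterlim (\<lambda>n. 1 / real (Suc n)) (at 0) sequentially"
        unfolding filterlim_at using lim_1_over_n[where 'a = real]
        by (auto intro!: LIMSEQ_Suc[of "\<lambda>n. 1 / real n"] simp del: of_nat_Suc)
      ultimately have "(\<lambda>n. (\<phi> (x + (1 / real (Suc n)) *\<^sub>R b) - \<phi> x) /\<^sub>R (1 / real (Suc n))) \<longlonglongrightarrow> partial_deriv b \<phi> x"
        by (rule filterlim_compose)
      then show "(\<lambda>n. q n x) \<longlonglongrightarrow> partial_deriv b \<phi> x"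
        by (simp add: q_def scaleR_conv_of_real)
    qed
    show "AE x in lborel. norm (q n x) \<le> indicat_real (cball 0 (R + norm b)) x *\<^sub>R M" for n
    proof (rule AE_I2)
      fix x
      let ?t = "1 / real (Suc n)"
      show "norm (q n x) \<le> indicat_real (cball 0 (R + norm b)) x *\<^sub>R M"
      proof (cases "x \<in> cball 0 (R + norm b)")
        case True
        have "norm (q n x) = real (Suc n) * norm (\<phi> (x + ?t *\<^sub>R b) - \<phi> x)"
          unfolding q_def norm_mult by (simp del: of_nat_Suc)
        also have "\<dots> \<le> real (Suc n) * (M * \<bar>?t\<bar>)"
          by (intro mult_left_mono lip) auto
        also have "\<dots> = M" by simp
        finally show ?thesis using True by simp
      next
        case False
        have "norm (?t *\<^sub>R b) \<le> norm b" by (simp add: divide_le_eq mult_le_cancel_left1)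
        moreover have "norm x \<le> norm (x + ?t *\<^sub>R b) + norm (?t *\<^sub>R b)" 
          using norm_triangle_ineq4[of "x + ?t *\<^sub>R b" "?t *\<^sub>R b"] by simp
        ultimately have "x \<notin> ball 0 R" "x + ?t *\<^sub>R b \<notin> ball 0 R"
          using False norm_ge_zero[of b] unfolding mem_ball_0 mem_cball_0 by linarith+
        then show ?thesis using False C1_c_zero(1)[OF \<phi>] by (simp add: q_def)
      qed
    qed
  qed (auto simp: q_def[abs_def])
  then have "integral\<^sup>L lborel (partial_deriv b \<phi>) = 0"
    using q0 by (simp add: LIMSEQ_const_iff)
  then show ?thesis
    using integral_ball_lborel(1)[of "partial_deriv b \<phi>" R] C1_c_zero(2)[OF \<phi>] by simp
qed

lemma C1_ray_vector_derivative:
  assumes f: "f \<in> C1" and R: "R > 0"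
  shows "((\<lambda>r. f ((r / R) *\<^sub>R w)) has_vector_derivative
    of_real (1 / R) * (\<Sum>c\<in>Basis. of_real (w \<bullet> c) * partial_deriv c f ((r / R) *\<^sub>R w))) (at r)"
proof -
  have "((\<lambda>r. f ((r / R) *\<^sub>R w)) has_derivative (\<lambda>h. partial_deriv ((h / R) *\<^sub>R w) f ((r / R) *\<^sub>R w))) (at r)"
    using R by (intro C1_has_derivative_compose[OF f]) (auto intro!: derivative_eq_intros)
  moreover have "partial_deriv ((h / R) *\<^sub>R w) f y =
     h *\<^sub>R (of_real (1 / R) * (\<Sum>c\<in>Basis. of_real (w \<bullet> c) * partial_deriv c f y))" for h y
    by (simp add: partial_deriv_scaleR[OF f] partial_deriv_Basis_sum[OF f, of w] scaleR_conv_of_real)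
  ultimately show ?thesis by (simp add: has_vector_derivative_def)
qed

lemma continuous_ray:
  fixes f :: "'a::euclidean_space \<Rightarrow> complex"
  assumes "continuous_on UNIV f"
  shows "continuous_on S (\<lambda>p. f ((fst p / R) *\<^sub>R snd p))"
  by (rule continuous_on_compose2[OF assms]) (auto intro!: continuous_intros simp: divide_inverse)

text \<open>
  Integration by parts along a ray. The derivative of the cutoff is an approximate point mass at \<open>R\<close>;
  on the right-hand side only the cutoff itself is left, whose limit is elementary.
\<close>

lemma integral_cutoff_ray:
  fixes H H' :: "real \<Rightarrow> complex" and n :: real
  assumes R: "R > 0"
    and H: "\<And>r. (H has_vector_derivative H' r) (at r)" "continuous_on {0..R} H'" "H 0 = 0"
  defines "ct \<equiv> \<lambda>r. smoothstep (n * (R\<^sup>2 - r\<^sup>2) - 1)"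
  shows "(\<integral>r. indicat_real {0..R} r *\<^sub>R (of_real (2 * n * r * smoothstep' (n * (R\<^sup>2 - r\<^sup>2) - 1)) * H r) \<partial>lborel)
       = (\<integral>r. indicat_real {0..R} r *\<^sub>R (of_real (ct r) * H' r) \<partial>lborel)"
proof -
  define k where "k r = 2 * n * r * smoothstep' (n * (R\<^sup>2 - r\<^sup>2) - 1)" for r
  have ct: "(ct has_real_derivative - k r) (at r)" for r
    unfolding ct_def k_def
    by (rule DERIV_cong, rule DERIV_chain2[OF has_real_derivative_smoothstep])
       (auto intro!: derivative_eq_intros)
  have ct': "((\<lambda>r. complex_of_real (ct r)) has_vector_derivative - of_real (k r)) (at r)" for r
    using has_vector_derivative_of_real[OF ct]
    by simp
  have ck: "continuous_on {0..R} (\<lambda>r. of_real (k r) * H r)"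
    and cct: "continuous_on {0..R} (\<lambda>r. of_real (ct r) * H' r)"
    unfolding k_def ct_def
    by (intro continuous_intros continuous_on_compose2[OF continuous_smoothstep'[of UNIV]]
        continuous_on_compose2[OF continuous_smoothstep[of UNIV]] H(2)
        continuous_at_imp_continuous_on ballI has_vector_derivative_continuous[OF H(1)]; simp)+
  have "(\<integral>r. indicat_real {0..R} r *\<^sub>R (of_real (ct r) * H' r + - of_real (k r) * H r) \<partial>lborel)
      = of_real (ct R) * H R - of_real (ct 0) * H 0"
  proof (rule integral_FTC_Icc)
    show "0 \<le> R" using R by simp
    show "((\<lambda>r. of_real (ct r) * H r) has_vector_derivative of_real (ct r) * H' r + - of_real (k r) * H r)
      (at r within {0..R})" for r
      by (rule has_vector_derivative_at_within, rule has_vector_derivative_mult[OF ct' H(1)])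
    show "continuous_on {0..R} (\<lambda>r. of_real (ct r) * H' r + - of_real (k r) * H r)"
      using continuous_on_diff[OF cct ck] by simp
  qed
  also have "\<dots> = 0" using H(3) by (simp add: ct_def)
  also have "(\<lambda>r. indicat_real {0..R} r *\<^sub>R (of_real (ct r) * H' r + - of_real (k r) * H r)) =
     (\<lambda>r. indicat_real {0..R} r *\<^sub>R (of_real (ct r) * H' r) - indicat_real {0..R} r *\<^sub>R (of_real (k r) * H r))"
    by (auto simp: indicator_def)
  also have "integral\<^sup>L lborel \<dots> =
    (\<integral>r. indicat_real {0..R} r *\<^sub>R (of_real (ct r) * H' r) \<partial>lborel) -
    (\<integral>r. indicat_real {0..R} r *\<^sub>R (of_real (k r) * H r) \<partial>lborel)"
    by (intro Bochner_Integration.integral_diff borel_integrable_compact ck cct) auto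
  finally show ?thesis unfolding k_def by simp
qed

lemma integral_interval_tendsto:
  fixes g :: "nat \<Rightarrow> real \<Rightarrow> complex"
  assumes "continuous_on {0..R} G" 
    and "\<And>n. continuous_on {0..R} (g n)"
    and "\<And>n r. r \<in> {0..R} \<Longrightarrow> norm (g n r) \<le> norm (G r)"
    and "\<And>r. r \<in> {0..<R} \<Longrightarrow> (\<lambda>n. g n r) \<longlonglongrightarrow> G r"
  shows "(\<lambda>n. \<integral>r. indicat_real {0..R} r *\<^sub>R g n r \<partial>lborel) \<longlonglongrightarrow> (\<integral>r. indicat_real {0..R} r *\<^sub>R G r \<partial>lborel)"
proof (rule integral_dominated_convergence[where w = "\<lambda>r. norm (indicat_real {0..R} r *\<^sub>R G r)"])
  have G: "integrable lborel (\<lambda>r. indicat_real {0..R} r *\<^sub>R G r)"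
    by (rule borel_integrable_compact) (auto intro: assms)
  then show "(\<lambda>r. indicat_real {0..R} r *\<^sub>R G r) \<in> borel_measurable lborel"
    by (rule borel_measurable_integrable)
  show "integrable lborel (\<lambda>r. norm (indicat_real {0..R} r *\<^sub>R G r))" using G by (rule integrable_norm)
  show "(\<lambda>r. indicat_real {0..R} r *\<^sub>R g n r) \<in> borel_measurable lborel" for n
    by (rule borel_measurable_integrable[OF borel_integrable_compact]) (auto intro: assms)
  show "AE r in lborel. (\<lambda>n. indicat_real {0..R} r *\<^sub>R g n r) \<longlonglongrightarrow> indicat_real {0..R} r *\<^sub>R G r"
    using AE_lborel_singleton[of R] by eventually_elim (auto simp: indicator_def intro!: assms)
  show "AE r in lborel. norm (indicat_real {0..R} r *\<^sub>R g n r) \<le> norm (indicat_real {0..R} r *\<^sub>R G r)" for n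
    by (intro AE_I2) (auto simp: indicator_def intro!: assms)
qed

text \<open>
  The divergence theorem for the vector field \<open>f b\<close>. The product of \<open>f\<close> with a cutoff has compact support,
  so its derivative has integral zero, and the product rule leaves two terms. One tends to the integral
  over the ball. The other contains the derivative of the cutoff and is evaluated ray by ray in polar
  coordinates, where it tends to the boundary value.
\<close>

theorem integral_partial_deriv_ball:
  fixes f :: "'a::euclidean_space \<Rightarrow> complex"
  assumes f: "f \<in> C1" and R: "R > 0" and dim: "DIM('a) \<ge> 2"
  shows "(\<integral>x. partial_deriv b f x \<partial>ball_measure R) =
    (\<integral>w. of_real ((w \<bullet> b) / R) * f w \<partial>sphere_measure R)"
proof -
  define D where "D = DIM('a)"
  interpret S: finite_measure "sphere_measure R :: 'a measure" by (rule finite_sphere_measure[OF R])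
  \<comment> \<open>The weight of polar coordinates is part of \<open>H\<close>; as the dimension is at least 2, it makes \<open>H\<close> vanish at \<open>r = 0\<close>.\<close>
  define H where "H w r = complex_of_real ((r / R) ^ (D - 1) * ((w \<bullet> b) / R)) * f ((r / R) *\<^sub>R w)" for w r
  define H' where "H' w r =
    complex_of_real ((r / R) ^ (D - 1) * ((w \<bullet> b) / R)) *
      (of_real (1 / R) * (\<Sum>c\<in>Basis. of_real (w \<bullet> c) * partial_deriv c f ((r / R) *\<^sub>R w)))
    + of_real (real (D - 1) / R * (r / R) ^ (D - 2) * ((w \<bullet> b) / R)) * f ((r / R) *\<^sub>R w)" for w r
  define ct where "ct n r = smoothstep (real n * (R\<^sup>2 - r\<^sup>2) - 1)" for n :: nat and r :: real
  have H: "(H w has_vector_derivative H' w r) (at r)" for w r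
  proof -
    have D2: "D - 1 - Suc 0 = D - Suc (Suc 0)" by simp
    have "((\<lambda>r. (r / R) ^ (D - 1) * ((w \<bullet> b) / R)) has_real_derivative
       real (D - 1) / R * (r / R) ^ (D - 2) * ((w \<bullet> b) / R)) (at r)"
      using R by (auto intro!: derivative_eq_intros simp: D2 numeral_2_eq_2)
    then have "((\<lambda>r. complex_of_real ((r / R) ^ (D - 1) * ((w \<bullet> b) / R))) has_vector_derivative
       of_real (real (D - 1) / R * (r / R) ^ (D - 2) * ((w \<bullet> b) / R))) (at r)"
      by (rule has_vector_derivative_of_real)
    from has_vector_derivative_mult[OF this C1_ray_vector_derivative[OF f R, of w r]]
    show ?thesis unfolding H_def[abs_def] H'_def .
  qed
  note fc = C1_continuous[OF f, of UNIV] C1_continuous_partial[OF f, of UNIV]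
  have H'c: "continuous_on T (\<lambda>p. H' (snd p) (fst p))" for T
    unfolding H'_def
    by (intro continuous_intros continuous_ray fc) (use R in auto)
  have H'r: "continuous_on T (H' w)" for T w
    by (rule continuous_on_compose2[OF H'c[of UNIV], of T "\<lambda>r. (r, w)", simplified])
       (intro continuous_intros)
  have "bounded ((\<lambda>p. H' (snd p) (fst p)) ` ({0..R} \<times> sphere 0 R))"
    by (intro compact_imp_bounded compact_continuous_image H'c compact_Times) auto
  then obtain K where K: "K > 0" "\<And>w r. w \<in> sphere 0 R \<Longrightarrow> r \<in> {0..R} \<Longrightarrow> norm (H' w r) \<le> K"
    unfolding bounded_pos by fastforce
  define L where "L n w = (\<integral>r. indicat_real {0..R} r *\<^sub>R (of_real (ct n r) * H' w r) \<partial>lborel)" for n w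
  have ctc: "continuous_on T (ct n)" for T n
    unfolding ct_def by (intro continuous_on_compose2[OF continuous_smoothstep[of UNIV]] continuous_intros) auto
  have ctb: "0 \<le> ct n r" "ct n r \<le> 1" for n r
    using smoothstep_bounds by (auto simp: ct_def)
  have lim: "(\<lambda>n. L n w) \<longlonglongrightarrow> H w R" if "w \<in> sphere 0 R" for w
  proof -
    have "(\<lambda>n. L n w) \<longlonglongrightarrow> (\<integral>r. indicat_real {0..R} r *\<^sub>R H' w r \<partial>lborel)"
      unfolding L_def
    proof (rule integral_interval_tendsto)
      show "continuous_on {0..R} (H' w)" by (rule H'r)
      show "continuous_on {0..R} (\<lambda>r. of_real (ct n r) * H' w r)" for n
        by (intro continuous_intros H'r ctc)
      show "norm (of_real (ct n r) * H' w r) \<le> norm (H' w r)" for n r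
        using ctb[of n r] by (simp add: norm_mult mult_left_le_one_le)
      fix r assume r: "r \<in> {0..<R}"
      then have "(r / R) *\<^sub>R w \<in> ball 0 R" "((r / R) *\<^sub>R w) \<bullet> ((r / R) *\<^sub>R w) = r\<^sup>2"
        using that R by (auto simp: dot_square_norm power2_eq_square field_simps)
      then have "(\<lambda>n. complex_of_real (ct n r)) \<longlonglongrightarrow> 1"
        using cutoff_tendsto[of "(r / R) *\<^sub>R w" R] by (simp only: cutoff_def ct_def)
      from tendsto_mult_right[OF this]
      show "(\<lambda>n. of_real (ct n r) * H' w r) \<longlonglongrightarrow> H' w r" by simp
    qed
    also have "(\<integral>r. indicat_real {0..R} r *\<^sub>R H' w r \<partial>lborel) = H w R - H w 0"
      by (rule integral_FTC_Icc) (use R in \<open>auto intro: H'r has_vector_derivative_at_within H\<close>)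
    also have "H w 0 = 0" using dim by (simp add: H_def D_def power_0_left)
    finally show ?thesis by simp
  qed
  have Leq: "(\<integral>x. - partial_deriv b (cutoff R (real n)) x * f x \<partial>ball_measure R) = (\<integral>w. L n w \<partial>sphere_measure R)" for n
  proof -
    define g where "g x = - partial_deriv b (cutoff R (real n)) x * f x" for x
    have gc: "continuous_on UNIV g"
      unfolding g_def by (intro continuous_intros C1_continuous_partial cutoff_C1 fc)
    have "(\<integral>x. g x \<partial>ball_measure R) = (\<integral>w. (\<integral>r. (indicat_real {0<..<R} r * (r / R) ^ (D - 1)) *\<^sub>R g ((r / R) *\<^sub>R w) \<partial>lborel) \<partial>sphere_measure R)"
      unfolding D_def by (rule polar_integral[OF R])
        (use gc in \<open>auto intro: integrable_ball_continuous borel_measurable_continuous_onI\<close>)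
    also have "\<dots> = (\<integral>w. L n w \<partial>sphere_measure R)"
    proof (rule Bochner_Integration.integral_cong[OF refl])
      fix w :: 'a assume "w \<in> space (sphere_measure R)"
      then have w: "norm w = R" by simp
      have r2: "((r / R) *\<^sub>R w) \<bullet> ((r / R) *\<^sub>R w) = r\<^sup>2" for r
        using w R by (simp add: dot_square_norm power2_eq_square)
      have geq: "(indicat_real {0<..<R} r * (r / R) ^ (D - 1)) *\<^sub>R g ((r / R) *\<^sub>R w) =
        indicat_real {0<..<R} r *\<^sub>R (of_real (2 * real n * r * smoothstep' (real n * (R\<^sup>2 - r\<^sup>2) - 1)) * H w r)" for r
        unfolding g_def partial_deriv_cutoff r2 H_def
        by (simp add: scaleR_conv_of_real field_simps)
      have mm: "(\<lambda>r. of_real (2 * real n * r * smoothstep' (real n * (R\<^sup>2 - r\<^sup>2) - 1)) * H w r) \<in> borel_measurable borel"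
        by (intro borel_measurable_continuous_onI continuous_intros
            continuous_on_compose2[OF continuous_smoothstep'[of UNIV]]
            continuous_at_imp_continuous_on ballI has_vector_derivative_continuous[OF H]; simp)
      have "(\<integral>r. (indicat_real {0<..<R} r * (r / R) ^ (D - 1)) *\<^sub>R g ((r / R) *\<^sub>R w) \<partial>lborel) =
        (\<integral>r. indicat_real {0..R} r *\<^sub>R (of_real (2 * real n * r * smoothstep' (real n * (R\<^sup>2 - r\<^sup>2) - 1)) * H w r) \<partial>lborel)"
        unfolding geq
      proof (rule integral_cong_AE)
        show "AE r in lborel.
          indicat_real {0<..<R} r *\<^sub>R (of_real (2 * real n * r * smoothstep' (real n * (R\<^sup>2 - r\<^sup>2) - 1)) * H w r) =
          indicat_real {0..R} r *\<^sub>R (of_real (2 * real n * r * smoothstep' (real n * (R\<^sup>2 - r\<^sup>2) - 1)) * H w r)"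
          using AE_lborel_singleton[of R] AE_lborel_singleton[of 0]
          by eventually_elim (auto simp: indicator_def)
      qed (use mm in simp_all)
      also have "\<dots> = L n w"
        unfolding L_def ct_def
        by (rule integral_cutoff_ray[OF R H H'r]) (use dim in \<open>simp_all add: H_def D_def power_0_left\<close>)
      finally show "(\<integral>r. (indicat_real {0<..<R} r * (r / R) ^ (D - 1)) *\<^sub>R g ((r / R) *\<^sub>R w) \<partial>lborel) = L n w" .
    qed
    finally show ?thesis unfolding g_def .
  qed
  have parts: "(\<integral>x. cutoff R (real n) x * partial_deriv b f x \<partial>ball_measure R) = (\<integral>w. L n w \<partial>sphere_measure R)" if "n > 0" for n
  proof -
    have "0 = (\<integral>x. partial_deriv b (\<lambda>x. cutoff R (real n) x * f x) x \<partial>ball_measure R)"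
      by (rule integral_partial_deriv_C1_c[symmetric], rule cutoff_mult_C1_c[OF f _ R]) (use that in simp)
    also have "\<dots> = (\<integral>x. cutoff R (real n) x * partial_deriv b f x - (- partial_deriv b (cutoff R (real n)) x * f x) \<partial>ball_measure R)"
      by (simp add: C1_mult(2)[OF cutoff_C1 f])
    also have "\<dots> = (\<integral>x. cutoff R (real n) x * partial_deriv b f x \<partial>ball_measure R)
       - (\<integral>x. - partial_deriv b (cutoff R (real n)) x * f x \<partial>ball_measure R)"
      by (intro Bochner_Integration.integral_diff integrable_ball_continuous continuous_intros
          C1_continuous_partial C1_continuous cutoff_C1 f)
    finally show ?thesis unfolding Leq by simp
  qed
  have "(\<lambda>n. \<integral>w. L n w \<partial>sphere_measure R) \<longlonglongrightarrow> (\<integral>w. H w R \<partial>sphere_measure R)"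
  proof (rule integral_dominated_convergence[where w = "\<lambda>w. R * K"])
    have Hm: "(\<lambda>w. H w R) \<in> borel_measurable (sphere_measure R)"
      unfolding H_def using R
      by (intro borel_measurable_sphere_measure borel_measurable_continuous_onI continuous_intros
          continuous_on_compose2[OF fc(1)]) auto
    then show "(\<lambda>w. H w R) \<in> borel_measurable (sphere_measure R)" .
    show "integrable (sphere_measure R :: 'a measure) (\<lambda>w. R * K)" by simp
    show "AE w in sphere_measure R. (\<lambda>n. L n w) \<longlonglongrightarrow> H w R"
      by (rule AE_I2) (use lim in simp)
    show "AE w in sphere_measure R. norm (L n w) \<le> R * K" for n
    proof (rule AE_I2)
      fix w :: 'a assume "w \<in> space (sphere_measure R)"
      then have w: "w \<in> sphere 0 R" by simp
      have "norm (L n w) \<le> (\<integral>r. indicat_real {0..R} r *\<^sub>R K \<partial>lborel)"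
        unfolding L_def
      proof (rule Bochner_Integration.integral_norm_bound_integral)
        show "integrable lborel (\<lambda>r. indicat_real {0..R} r *\<^sub>R (of_real (ct n r) * H' w r))"
          by (intro borel_integrable_compact continuous_intros H'r ctc) auto
        show "integrable lborel (\<lambda>r. indicat_real {0..R} r *\<^sub>R K)"
          by (intro integrable_scaleR_left integrable_real_indicator) (use R in simp_all)
        fix r 
        show "norm (indicat_real {0..R} r *\<^sub>R (of_real (ct n r) * H' w r)) \<le> indicat_real {0..R} r *\<^sub>R K"
          using ctb[of n r] K(2)[OF w, of r] K(1) mult_mono[of "ct n r" 1 "norm (H' w r)" K]
          by (auto simp: indicator_def norm_mult)
      qed
      also have "\<dots> = R * K" using R by simp
      finally show "norm (L n w) \<le> R * K" .
    qed
    show "L n \<in> borel_measurable (sphere_measure R)" for n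
    proof -
      have "(\<lambda>p. indicat_real {0..R} (snd p) *\<^sub>R (of_real (ct n (snd p)) * H' (fst p) (snd p))) \<in> borel_measurable (borel \<Otimes>\<^sub>M lborel)"
      proof -
        have 1: "continuous_on UNIV (\<lambda>p::'a \<times> real. complex_of_real (ct n (snd p)) * H' (fst p) (snd p))"
        proof -
          have sw: "continuous_on UNIV (\<lambda>p::'a \<times> real. (snd p, fst p))" by (intro continuous_intros)
          have "continuous_on UNIV (\<lambda>p::'a \<times> real. H' (fst p) (snd p))"
            using continuous_on_compose2[OF H'c[of UNIV] sw] by simp
          moreover have "continuous_on UNIV (\<lambda>p::'a \<times> real. ct n (snd p))"
            by (rule continuous_on_compose2[OF ctc[of UNIV]]) (auto intro: continuous_intros)
          ultimately show ?thesis by (intro continuous_intros)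
        qed
        have "(\<lambda>p. indicat_real {0..R} (snd p)) \<in> borel_measurable (borel \<Otimes>\<^sub>M (borel :: real measure) :: ('a \<times> real) measure)"
          by measurable
        moreover have "(\<lambda>p. complex_of_real (ct n (snd p)) * H' (fst p) (snd p)) \<in> borel_measurable (borel \<Otimes>\<^sub>M borel)"
          using borel_measurable_continuous_onI[OF 1] by (simp add: borel_prod)
        ultimately have "(\<lambda>p. indicat_real {0..R} (snd p) *\<^sub>R (of_real (ct n (snd p)) * H' (fst p) (snd p))) \<in> borel_measurable (borel \<Otimes>\<^sub>M borel)"
          by (rule borel_measurable_scaleR)
        then show ?thesis by (simp cong: measurable_cong_sets sets_pair_measure_cong)
      qed
      then have "(\<lambda>w. \<integral>r. indicat_real {0..R} r *\<^sub>R (of_real (ct n r) * H' w r) \<partial>lborel) \<in> borel_measurable borel"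
        using lborel.borel_measurable_lebesgue_integral[of "\<lambda>w r. indicat_real {0..R} r *\<^sub>R (of_real (ct n r) * H' w r)" borel]
        by (simp add: case_prod_beta)
      then show ?thesis unfolding L_def by (rule borel_measurable_sphere_measure)
    qed
  qed
  moreover have "(\<lambda>n. \<integral>x. cutoff R (real n) x * partial_deriv b f x \<partial>ball_measure R) \<longlonglongrightarrow> (\<integral>x. partial_deriv b f x \<partial>ball_measure R)"
  proof (rule integral_dominated_convergence[where w = "\<lambda>x. norm (partial_deriv b f x)"])
    show "partial_deriv b f \<in> borel_measurable (ball_measure R)"
      using fc(2) by (intro borel_measurable_ball_measure borel_measurable_continuous_onI)
    show "(\<lambda>x. cutoff R (real n) x * partial_deriv b f x) \<in> borel_measurable (ball_measure R)" for n
      using fc(2) C1_continuous[OF cutoff_C1]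
      by (intro borel_measurable_ball_measure borel_measurable_continuous_onI continuous_intros)
    show "integrable (ball_measure R) (\<lambda>x. norm (partial_deriv b f x))"
      by (intro integrable_ball_continuous continuous_intros fc)
    show "AE x in ball_measure R. (\<lambda>n. cutoff R (real n) x * partial_deriv b f x) \<longlonglongrightarrow> partial_deriv b f x"
      using tendsto_mult_right[OF cutoff_tendsto] by (intro AE_I2) (fastforce simp: space_restrict_space)
    show "AE x in ball_measure R. norm (cutoff R (real n) x * partial_deriv b f x) \<le> norm (partial_deriv b f x)" for n
      by (intro AE_I2) (simp add: norm_mult mult_left_le_one_le norm_cutoff_le)
  qed
  then have "(\<lambda>n. \<integral>w. L n w \<partial>sphere_measure R) \<longlonglongrightarrow> (\<integral>x. partial_deriv b f x \<partial>ball_measure R)"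
    by (rule Lim_transform_eventually) (use parts in \<open>auto intro!: eventually_sequentiallyI[of 1]\<close>)
  ultimately have "(\<integral>x. partial_deriv b f x \<partial>ball_measure R) = (\<integral>w. H w R \<partial>sphere_measure R)"
    using LIMSEQ_unique by blast
  then show ?thesis using R by (simp add: H_def)
qed

section \<open>Square-integrable functions\<close>

lemma L2_measurable: "u \<in> L2 M \<Longrightarrow> u \<in> borel_measurable M"
  and L2_integrable: "u \<in> L2 M \<Longrightarrow> integrable M (\<lambda>x. (norm (u x))\<^sup>2)"
  by (auto simp: L2_def)

lemma L2norm_square: "(L2norm M u)\<^sup>2 = (\<integral>x. (norm (u x))\<^sup>2 \<partial>M)"
  by (simp add: L2norm_def)

lemma L2norm_nonneg: "0 \<le> L2norm M u"
  by (simp add: L2norm_def)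

lemma L2_mult_integrable:
  assumes "u \<in> L2 M" "v \<in> L2 M"
  shows "integrable M (\<lambda>x. u x * v x)" and "integrable M (\<lambda>x. norm (u x) * norm (v x))"
proof -
  note [measurable] = L2_measurable[OF assms(1)] L2_measurable[OF assms(2)]
  have i: "integrable M (\<lambda>x. (norm (u x))\<^sup>2 + (norm (v x))\<^sup>2)"
    by (intro Bochner_Integration.integrable_add L2_integrable assms)
  have b: "norm (u x) * norm (v x) \<le> (norm (u x))\<^sup>2 + (norm (v x))\<^sup>2" for x
  proof -
    have "0 \<le> norm (u x) * norm (v x)" by simp
    then show ?thesis using sum_squares_bound[of "norm (u x)" "norm (v x)"] unfolding mult.assoc by linarith
  qed
  show "integrable M (\<lambda>x. u x * v x)"
    by (rule Bochner_Integration.integrable_bound[OF i]) (use b in \<open>auto simp: norm_mult intro!: AE_I2\<close>)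
  show "integrable M (\<lambda>x. norm (u x) * norm (v x))"
    by (rule Bochner_Integration.integrable_bound[OF i]) (use b in \<open>auto intro!: AE_I2\<close>)
qed

lemma norm_add_square_le: "(norm (a + b))\<^sup>2 \<le> 2 * (norm a)\<^sup>2 + 2 * (norm (b::'a::real_normed_vector))\<^sup>2"
proof -
  have "(norm (a + b))\<^sup>2 \<le> (norm a + norm b)\<^sup>2" by (intro power_mono norm_triangle_ineq) auto
  also have "\<dots> \<le> 2 * (norm a)\<^sup>2 + 2 * (norm b)\<^sup>2"
    using sum_squares_bound[of "norm a" "norm b"] by (simp add: power2_sum)
  finally show ?thesis .
qed

lemma L2_add:
  assumes "u \<in> L2 M" "v \<in> L2 M"
  shows "(\<lambda>x. u x + v x) \<in> L2 M"
    and "(L2norm M (\<lambda>x. u x + v x))\<^sup>2 \<le> 2 * (L2norm M u)\<^sup>2 + 2 * (L2norm M v)\<^sup>2"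
proof -
  note [measurable] = L2_measurable[OF assms(1)] L2_measurable[OF assms(2)]
  have i: "integrable M (\<lambda>x. 2 * (norm (u x))\<^sup>2 + 2 * (norm (v x))\<^sup>2)"
    by (intro Bochner_Integration.integrable_add integrable_mult_right L2_integrable assms)
  have j: "integrable M (\<lambda>x. (norm (u x + v x))\<^sup>2)"
    by (rule Bochner_Integration.integrable_bound[OF i]) (auto intro!: AE_I2 norm_add_square_le)
  then show "(\<lambda>x. u x + v x) \<in> L2 M" by (simp add: L2_def)
  have "(\<integral>x. (norm (u x + v x))\<^sup>2 \<partial>M) \<le> (\<integral>x. 2 * (norm (u x))\<^sup>2 + 2 * (norm (v x))\<^sup>2 \<partial>M)"
    by (rule integral_mono[OF j i norm_add_square_le])
  also have "\<dots> = 2 * (L2norm M u)\<^sup>2 + 2 * (L2norm M v)\<^sup>2"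
    using L2_integrable[OF assms(1)] L2_integrable[OF assms(2)] by (simp add: L2norm_square)
  finally show "(L2norm M (\<lambda>x. u x + v x))\<^sup>2 \<le> 2 * (L2norm M u)\<^sup>2 + 2 * (L2norm M v)\<^sup>2"
    by (simp add: L2norm_square)
qed

lemma L2_cmult:
  assumes "u \<in> L2 M"
  shows "(\<lambda>x. c * u x) \<in> L2 M" and "(L2norm M (\<lambda>x. c * u x)) = norm c * L2norm M u"
proof -
  note [measurable] = L2_measurable[OF assms]
  show "(\<lambda>x. c * u x) \<in> L2 M"
    using L2_integrable[OF assms] by (simp add: L2_def norm_mult power_mult_distrib)
  show "(L2norm M (\<lambda>x. c * u x)) = norm c * L2norm M u"
    by (simp add: L2norm_def norm_mult power_mult_distrib real_sqrt_mult)
qed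

lemma L2_diff:
  assumes "u \<in> L2 M" "v \<in> L2 M"
  shows "(\<lambda>x. u x - v x) \<in> L2 M"
    and "(L2norm M (\<lambda>x. u x - v x))\<^sup>2 \<le> 2 * (L2norm M u)\<^sup>2 + 2 * (L2norm M v)\<^sup>2"
  using L2_add[OF assms(1) L2_cmult(1)[OF assms(2), of "-1"]] L2_cmult(2)[OF assms(2), of "-1"] by simp_all

lemma L2norm_cong_AE:
  assumes "u \<in> borel_measurable M" "v \<in> borel_measurable M" "AE x in M. v x = u x"
  shows "L2norm M v = L2norm M u"
proof -
  note [measurable] = assms(1,2)
  show ?thesis unfolding L2norm_def
    by (intro arg_cong[where f = sqrt] integral_cong_AE) (use assms(3) in auto)
qed

text \<open>
  The quadratic polynomial \<open>t \<mapsto> \<integral> (t \<bar>u\<bar> - \<bar>v\<bar>)\<^sup>2\<close> is nonnegative, so its discriminant is not positive.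
\<close>

lemma L2_Cauchy_Schwarz:
  assumes u: "u \<in> L2 M" and v: "v \<in> L2 M"
  shows "norm (\<integral>x. u x * v x \<partial>M) \<le> L2norm M u * L2norm M v"
proof -
  define A where "A = (L2norm M u)\<^sup>2"
  define B where "B = (L2norm M v)\<^sup>2"
  define C where "C = (\<integral>x. norm (u x) * norm (v x) \<partial>M)"
  note i = L2_integrable[OF u] L2_integrable[OF v] L2_mult_integrable[OF u v]
  have C0: "0 \<le> C" unfolding C_def by (intro Bochner_Integration.integral_nonneg) auto
  have q: "0 \<le> t\<^sup>2 * A - 2 * t * C + B" for t
  proof -
    have "0 \<le> (\<integral>x. (t * norm (u x) - norm (v x))\<^sup>2 \<partial>M)" by (intro Bochner_Integration.integral_nonneg) auto
    also have "\<dots> = (\<integral>x. t\<^sup>2 * (norm (u x))\<^sup>2 - 2 * t * (norm (u x) * norm (v x)) + (norm (v x))\<^sup>2 \<partial>M)"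
      by (simp add: power2_diff power_mult_distrib algebra_simps)
    also have "\<dots> = t\<^sup>2 * A - 2 * t * C + B"
      unfolding A_def B_def C_def L2norm_square using i by simp
    finally show ?thesis .
  qed
  have A0: "A \<ge> 0" and B0: "B \<ge> 0" by (auto simp: A_def B_def)
  have "C\<^sup>2 \<le> A * B"
  proof (cases "A = 0")
    case True
    have "C = 0"
    proof (rule ccontr)
      assume "C \<noteq> 0"
      with C0 have "C > 0" by simp
      then show False using q[of "(B + 1) / (2 * C)"] True by (simp add: field_simps)
    qed
    then show ?thesis using True by simp
  next
    case False
    with A0 have "A > 0" by simp
    then show ?thesis using q[of "C / A"] by (simp add: field_simps power2_eq_square)
  qed
  then have "C \<le> L2norm M u * L2norm M v"
    unfolding A_def B_def power_mult_distrib[symmetric]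
    by (rule power2_le_imp_le) (simp add: L2norm_nonneg)
  moreover have "norm (\<integral>x. u x * v x \<partial>M) \<le> C"
    unfolding C_def using integral_norm_bound[of M "\<lambda>x. u x * v x"] by (simp add: norm_mult)
  ultimately show ?thesis by simp
qed

lemma L2_bounded_mult:
  assumes "u \<in> L2 M" "f \<in> borel_measurable M" "AE x in M. norm (f x) \<le> B"
  shows "(\<lambda>x. f x * u x) \<in> L2 M" and "(L2norm M (\<lambda>x. f x * u x))\<^sup>2 \<le> B\<^sup>2 * (L2norm M u)\<^sup>2"
proof -
  note [measurable] = L2_measurable[OF assms(1)] assms(2)
  have i: "integrable M (\<lambda>x. B\<^sup>2 * (norm (u x))\<^sup>2)" using L2_integrable[OF assms(1)] by simp
  have b: "AE x in M. (norm (f x * u x))\<^sup>2 \<le> B\<^sup>2 * (norm (u x))\<^sup>2"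
    using assms(3) by eventually_elim (auto simp: norm_mult power_mult_distrib intro!: mult_right_mono power_mono)
  have j: "integrable M (\<lambda>x. (norm (f x * u x))\<^sup>2)"
    by (rule Bochner_Integration.integrable_bound[OF i]) (use b in auto)
  then show "(\<lambda>x. f x * u x) \<in> L2 M" by (simp add: L2_def)
  have "(\<integral>x. (norm (f x * u x))\<^sup>2 \<partial>M) \<le> (\<integral>x. B\<^sup>2 * (norm (u x))\<^sup>2 \<partial>M)"
    by (rule integral_mono_AE[OF j i b])
  then show "(L2norm M (\<lambda>x. f x * u x))\<^sup>2 \<le> B\<^sup>2 * (L2norm M u)\<^sup>2"
    using L2_integrable[OF assms(1)] by (simp add: L2norm_square)
qed

lemma L2_ball_continuous:
  assumes "continuous_on UNIV f" shows "f \<in> L2 (ball_measure R)"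
  unfolding L2_def using assms
  by (auto intro!: borel_measurable_ball_measure borel_measurable_continuous_onI integrable_ball_continuous continuous_intros)

section \<open>Weak derivatives\<close>

lemma smoothstep_tendsto:
  "(\<lambda>n. smoothstep (real n * t)) \<longlonglongrightarrow> (if t > 0 then 1 else 0)"
proof (cases "t > 0")
  case True
  then show ?thesis using eventually_multiple_gt[OF True, of 1]
    by (intro tendsto_eventually) (auto elim!: eventually_mono)
next
  case False
  then have "smoothstep (real n * t) = 0" for n by (intro smoothstep_0) (simp add: mult_nonneg_nonpos)
  then show ?thesis using False by simp
qed

text \<open>
  An approximation of the indicator of the open box; multiplied by a cutoff it becomes a test function.
\<close>

definition box_bump :: "nat \<Rightarrow> 'a \<Rightarrow> 'a \<Rightarrow> 'a::euclidean_space \<Rightarrow> complex" where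
  "box_bump n a b x = (\<Prod>c\<in>Basis. of_real (smoothstep (real n * (x \<bullet> c - a \<bullet> c))) *
                                   of_real (smoothstep (real n * (b \<bullet> c - x \<bullet> c))))"

lemma box_bump_C1: "box_bump n a b \<in> C1"
proof -
  have 1: "(\<lambda>x. complex_of_real (smoothstep (real n * (x \<bullet> c - d)))) \<in> C1" for c :: 'a and d
  proof (rule C1_real_compose(1)[where h = "\<lambda>t. smoothstep (real n * (t - d))" and p = "\<lambda>x. x \<bullet> c"])
    show "((\<lambda>t. smoothstep (real n * (t - d))) has_real_derivative smoothstep' (real n * (t - d)) * real n) (at t)" for t
      by (rule DERIV_chain2[OF has_real_derivative_smoothstep]) (auto intro!: derivative_eq_intros)
    show "continuous_on UNIV (\<lambda>t. smoothstep' (real n * (t - d)) * real n)"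
      by (intro continuous_intros continuous_on_compose2[OF continuous_smoothstep'[of UNIV]]) auto
    show "((\<lambda>x. x \<bullet> c) has_derivative (\<lambda>h. h \<bullet> c)) (at x)" for x
      by (auto intro!: derivative_eq_intros)
  qed auto
  have 2: "(\<lambda>x. complex_of_real (smoothstep (real n * (d - x \<bullet> c)))) \<in> C1" for c :: 'a and d
    using 1[of "- c" "- d"] by (simp add: algebra_simps)
  show ?thesis unfolding box_bump_def[abs_def]
    by (intro C1_prod C1_mult(1) 1 2)
qed

lemma box_bump_tendsto: "(\<lambda>n. box_bump n a b x) \<longlonglongrightarrow> indicator (box a b) x"
proof -
  have "(\<lambda>n. box_bump n a b x) \<longlonglongrightarrow> (\<Prod>c\<in>Basis. of_real (if x \<bullet> c - a \<bullet> c > 0 then 1 else 0) *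
     of_real (if b \<bullet> c - x \<bullet> c > 0 then 1 else 0))"
    unfolding box_bump_def by (intro tendsto_intros smoothstep_tendsto)
  also have "(\<Prod>c\<in>Basis. of_real (if x \<bullet> c - a \<bullet> c > 0 then 1 else 0) *
     of_real (if b \<bullet> c - x \<bullet> c > 0 then 1 else 0)) = (indicator (box a b) x :: complex)"
  proof (cases "x \<in> box a b")
    case True
    then show ?thesis by (simp add: mem_box prod.neutral)
  next
    case False
    then show ?thesis by (auto simp: mem_box)
  qed
  finally show ?thesis .
qed

lemma norm_box_bump_le: "norm (box_bump n a b x) \<le> 1"
  unfolding box_bump_def prod_norm[symmetric]
  by (intro prod_le_1) (use smoothstep_bounds in \<open>auto simp: norm_mult intro!: mult_le_one\<close>)

text \<open>
  The sets over which \<open>f\<close> has integral zero form a Dynkin system, and boxes are an intersection-stable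
  generator of the Borel sets.
\<close>

lemma AE_zero_of_box_integrals:
  fixes f :: "'a::euclidean_space \<Rightarrow> complex"
  assumes int: "integrable lebesgue f"
    and box: "\<And>a b. (\<integral>x. indicat_real (box a b) x *\<^sub>R f x \<partial>lebesgue) = 0"
    and total: "(\<integral>x. f x \<partial>lebesgue) = 0"
  shows "AE x in lebesgue. f x = 0"
proof (rule sigma_finite_measure.density_zero[OF _ int])
  show "sigma_finite_measure (lebesgue :: 'a measure)"
  proof
    have "\<exists>n. x \<in> ball 0 (real n)" for x :: 'a
      using reals_Archimedean2[of "norm x"] by auto
    moreover have "emeasure lborel (ball (0::'a) (real n)) \<noteq> top" for n
      using emeasure_lborel_ball_finite[of "0::'a" "real n"] by auto
    ultimately show "\<exists>A. countable A \<and> A \<subseteq> sets (lebesgue :: 'a measure) \<and> \<Union> A = space lebesgue \<and> (\<forall>a\<in>A. emeasure lebesgue a \<noteq> \<infinity>)"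
      by (intro exI[of _ "range (\<lambda>n::nat. ball (0::'a) (real n))"])
        auto
  qed

  have borel: "set_lebesgue_integral lebesgue A f = 0" if "A \<in> sets borel" for A
  proof -
    let ?G = "range (\<lambda>(a, b). box a b :: 'a set)"
    have sb: "sigma_sets UNIV ?G = sets (borel :: 'a measure)"
      by (subst borel_eq_box) simp
    have "Int_stable ?G" by (auto simp: Int_stable_def box_Int_box)
    moreover have "?G \<subseteq> Pow UNIV" by auto
    moreover have "A \<in> sigma_sets UNIV ?G" using that sb by simp
    ultimately show ?thesis
    proof (induction A rule: sigma_sets_induct_disjoint)
      case (compl A)
      then have A: "A \<in> sets lebesgue" using sb by auto
      have i: "integrable lebesgue (\<lambda>x. indicat_real A x *\<^sub>R f x)"
        using A int by (rule integrable_mult_indicator)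
      have "set_lebesgue_integral lebesgue (UNIV - A) f = (\<integral>x. f x - indicat_real A x *\<^sub>R f x \<partial>lebesgue)"
        unfolding set_lebesgue_integral_def
        by (intro Bochner_Integration.integral_cong) (auto simp: indicator_def)
      also have "\<dots> = 0"
        using compl(2) total int i by (simp add: set_lebesgue_integral_def)
      finally show ?case .
    next
      case (union A)
      then have A: "A i \<in> sets lebesgue" for i using sb by auto
      have "set_lebesgue_integral lebesgue (\<Union>i. A i) f = (\<Sum>i. set_lebesgue_integral lebesgue (A i) f)"
      proof (rule lebesgue_integral_countable_add)
        show "A i \<inter> A j = {}" if "i \<noteq> j" for i j using union(1) that by (auto simp: disjoint_family_on_def)
        show "set_integrable lebesgue (\<Union>i. A i) f"
          unfolding set_integrable_def using int by (intro integrable_mult_indicator) (use A in auto)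
      qed (use A in auto)
      then show ?case using union(3) by simp
    qed (use box in \<open>auto simp: set_lebesgue_integral_def\<close>)
  qed
  fix A :: "'a set" assume "A \<in> sets lebesgue"
  then obtain S N N' where S: "A = S \<union> N" "N \<subseteq> N'" "N' \<in> null_sets lborel" "S \<in> sets lborel"
    by (rule sets_completionE)
  have "AE x in lebesgue. x \<notin> N'"
    using AE_not_in[OF S(3)] by (rule AE_completion)
  then have "AE x in lebesgue. indicat_real A x *\<^sub>R f x = indicat_real S x *\<^sub>R f x"
    by eventually_elim (use S in \<open>auto simp: indicator_def\<close>)
  then have "set_lebesgue_integral lebesgue A f = set_lebesgue_integral lebesgue S f"
    unfolding set_lebesgue_integral_def
    using \<open>A \<in> sets lebesgue\<close> S(4) borel_measurable_integrable[OF int]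
    by (intro integral_cong_AE) (auto intro!: borel_measurable_scaleR borel_measurable_indicator)
  then show "set_lebesgue_integral lebesgue A f = 0" using borel S(4) by simp
qed

text \<open>
  Uniqueness of weak derivatives rests on this. Products of cutoffs and box bumps are test functions that
  converge boundedly to the indicator of the intersection of a box with the ball.
\<close>

lemma fundamental_lemma_C1_c:
  fixes w :: "'a::euclidean_space \<Rightarrow> complex"
  assumes R: "R > 0" and w: "w \<in> L2 (ball_measure R)"
    and test: "\<And>\<phi>. \<phi> \<in> C1_c R \<Longrightarrow> (\<integral>x. w x * \<phi> x \<partial>ball_measure R) = 0"
  shows "AE x in ball_measure R. w x = 0"
proof -
  have iw: "integrable (ball_measure R) w"
    using L2_mult_integrable(1)[OF w L2_ball_continuous[of "\<lambda>x. 1"]] by simp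
  note [measurable] = L2_measurable[OF w]
  define f where "f x = indicat_real (ball 0 R) x *\<^sub>R w x" for x
  have f: "integrable lebesgue f"
    unfolding f_def using iw by (subst (asm) integrable_restrict_space) auto
  have box0: "(\<integral>x. indicat_real (box a b) x *\<^sub>R w x \<partial>ball_measure R) = 0" for a b
  proof -
    have bb: "box_bump n a b \<in> borel_measurable (ball_measure R)" "cutoff R (real n) \<in> borel_measurable (ball_measure R)" for n
      by (auto intro!: borel_measurable_ball_measure borel_measurable_continuous_onI C1_continuous box_bump_C1 cutoff_C1)
    have ind: "indicat_real (box a b) \<in> borel_measurable (ball_measure R)"
      by (rule borel_measurable_ball_measure) auto
    have "(\<lambda>n. \<integral>x. w x * (cutoff R (real n) x * box_bump n a b x) \<partial>ball_measure R) \<longlonglongrightarrow>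
       (\<integral>x. indicat_real (box a b) x *\<^sub>R w x \<partial>ball_measure R)"
    proof (rule integral_dominated_convergence[where w = "\<lambda>x. norm (w x)"])
      show "integrable (ball_measure R) (\<lambda>x. norm (w x))" using iw by (rule integrable_norm)
      show "(\<lambda>x. w x * (cutoff R (real n) x * box_bump n a b x)) \<in> borel_measurable (ball_measure R)" for n
        using bb by (intro borel_measurable_times L2_measurable[OF w])
      show "(\<lambda>x. indicat_real (box a b) x *\<^sub>R w x) \<in> borel_measurable (ball_measure R)"
        by (intro borel_measurable_scaleR ind L2_measurable[OF w])
      show "AE x in ball_measure R. (\<lambda>n. w x * (cutoff R (real n) x * box_bump n a b x)) \<longlonglongrightarrow> indicat_real (box a b) x *\<^sub>R w x"
      proof (rule AE_I2)
        fix x :: 'a assume "x \<in> space (ball_measure R)"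
        then have x: "x \<in> ball 0 R" by (simp add: space_restrict_space)
        have "(\<lambda>n. w x * (cutoff R (real n) x * box_bump n a b x)) \<longlonglongrightarrow> w x * (1 * indicator (box a b) x)"
          by (intro tendsto_intros cutoff_tendsto[OF x] box_bump_tendsto)
        then show "(\<lambda>n. w x * (cutoff R (real n) x * box_bump n a b x)) \<longlonglongrightarrow> indicat_real (box a b) x *\<^sub>R w x"
          by (auto simp: indicator_def split: if_splits)
      qed
      show "AE x in ball_measure R. norm (w x * (cutoff R (real n) x * box_bump n a b x)) \<le> norm (w x)" for n
        by (intro AE_I2) (simp add: norm_mult mult_left_le mult_le_one norm_cutoff_le norm_box_bump_le)
    qed
    moreover have "(\<integral>x. w x * (cutoff R (real n) x * box_bump n a b x) \<partial>ball_measure R) = 0" if "n > 0" for n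
      by (rule test, rule cutoff_mult_C1_c[OF box_bump_C1 _ R]) (use that in simp)
    then have "(\<lambda>n. \<integral>x. w x * (cutoff R (real n) x * box_bump n a b x) \<partial>ball_measure R) \<longlonglongrightarrow> 0"
      by (intro tendsto_eventually eventually_sequentiallyI[of 1]) simp
    ultimately show ?thesis by (rule LIMSEQ_unique)
  qed
  have conv: "(\<integral>x. indicat_real A x *\<^sub>R f x \<partial>lebesgue) = (\<integral>x. indicat_real A x *\<^sub>R w x \<partial>ball_measure R)" for A
    by (subst integral_restrict_space) (auto simp: f_def mult.commute)
  have "AE x in lebesgue. f x = 0"
  proof (rule AE_zero_of_box_integrals[OF f])
    show "(\<integral>x. indicat_real (box a b) x *\<^sub>R f x \<partial>lebesgue) = 0" for a b
      using conv box0 by simp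
    have fx: "f x = indicat_real (box (- R *\<^sub>R One) (R *\<^sub>R One)) x *\<^sub>R f x" for x
    proof (cases "x \<in> ball 0 R")
      case True
      then have "\<bar>x \<bullet> c\<bar> < R" if "c \<in> Basis" for c
        using Basis_le_norm[OF that, of x] by simp
      then have "x \<in> box (- R *\<^sub>R One) (R *\<^sub>R One)"
        by (simp add: mem_box abs_less_iff) (metis minus_less_iff)
      then show ?thesis by simp
    qed (simp add: f_def)
    have "(\<integral>x. f x \<partial>lebesgue) = (\<integral>x. indicat_real (box (- R *\<^sub>R One) (R *\<^sub>R One)) x *\<^sub>R f x \<partial>lebesgue)"
      by (rule Bochner_Integration.integral_cong[OF refl fx])
    also have "\<dots> = 0" unfolding conv by (rule box0)
    finally show "(\<integral>x. f x \<partial>lebesgue) = 0" .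
  qed
  then have "AE x in lebesgue. x \<in> ball 0 R \<longrightarrow> w x = 0"
    by eventually_elim (auto simp: f_def)
  then show ?thesis by (subst AE_restrict_space_iff) auto
qed

lemma C1_c_L2: "\<phi> \<in> C1_c R \<Longrightarrow> \<phi> \<in> L2 (ball_measure R)"
  and C1_c_partial_L2: "\<phi> \<in> C1_c R \<Longrightarrow> partial_deriv b \<phi> \<in> L2 (ball_measure R)"
  by (auto intro!: L2_ball_continuous C1_continuous C1_continuous_partial dest: C1_c_C1)

lemma weak_partial_unique:
  assumes R: "R > 0" and w: "w1 \<in> L2 (ball_measure R)" "w2 \<in> L2 (ball_measure R)"
    and p: "weak_partial R b u w1" "weak_partial R b u w2"
  shows "AE x in ball_measure R. w1 x = w2 x"
proof -
  have "AE x in ball_measure R. w1 x - w2 x = 0"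
  proof (rule fundamental_lemma_C1_c[OF R L2_diff(1)[OF w]])
    fix \<phi> :: "'a \<Rightarrow> complex" assume \<phi>: "\<phi> \<in> C1_c R"
    have "(\<integral>x. (w1 x - w2 x) * \<phi> x \<partial>ball_measure R) =
        (\<integral>x. w1 x * \<phi> x \<partial>ball_measure R) - (\<integral>x. w2 x * \<phi> x \<partial>ball_measure R)"
      unfolding left_diff_distrib using w C1_c_L2[OF \<phi>]
      by (intro Bochner_Integration.integral_diff L2_mult_integrable(1))
    then show "(\<integral>x. (w1 x - w2 x) * \<phi> x \<partial>ball_measure R) = 0"
      using p \<phi> by (auto simp: weak_partial_def)
  qed
  then show ?thesis by eventually_elim simp
qed

lemma weak_partial_add:
  assumes "u \<in> L2 (ball_measure R)" "v \<in> L2 (ball_measure R)" "w1 \<in> L2 (ball_measure R)" "w2 \<in> L2 (ball_measure R)"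
    and "weak_partial R b u w1" "weak_partial R b v w2"
  shows "weak_partial R b (\<lambda>x. u x + v x) (\<lambda>x. w1 x + w2 x)"
  unfolding weak_partial_def
proof
  fix \<phi> :: "'a \<Rightarrow> complex" assume \<phi>: "\<phi> \<in> C1_c R"
  have "(\<integral>x. (u x + v x) * partial_deriv b \<phi> x \<partial>ball_measure R) =
      (\<integral>x. u x * partial_deriv b \<phi> x \<partial>ball_measure R) + (\<integral>x. v x * partial_deriv b \<phi> x \<partial>ball_measure R)"
    unfolding distrib_right using assms C1_c_partial_L2[OF \<phi>]
    by (intro Bochner_Integration.integral_add L2_mult_integrable(1))
  moreover have "(\<integral>x. (w1 x + w2 x) * \<phi> x \<partial>ball_measure R) =
      (\<integral>x. w1 x * \<phi> x \<partial>ball_measure R) + (\<integral>x. w2 x * \<phi> x \<partial>ball_measure R)"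
    unfolding distrib_right using assms C1_c_L2[OF \<phi>]
    by (intro Bochner_Integration.integral_add L2_mult_integrable(1))
  ultimately show "(\<integral>x. (u x + v x) * partial_deriv b \<phi> x \<partial>ball_measure R) = - (\<integral>x. (w1 x + w2 x) * \<phi> x \<partial>ball_measure R)"
    using assms(5,6) \<phi> by (simp add: weak_partial_def)
qed

lemma weak_partial_cmult:
  assumes "weak_partial R b u w"
  shows "weak_partial R b (\<lambda>x. c * u x) (\<lambda>x. c * w x)"
  using assms by (simp add: weak_partial_def mult.assoc)

text \<open>
  The product of \<open>f\<close> with a test function is again a test function, so its derivative has integral zero.
\<close>

lemma weak_partial_C1:
  assumes f: "f \<in> C1"
  shows "weak_partial R b f (partial_deriv b f)"
  unfolding weak_partial_def
proof
  fix \<phi> :: "'a \<Rightarrow> complex" assume \<phi>: "\<phi> \<in> C1_c R"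
  have "{x. f x * \<phi> x \<noteq> 0} \<subseteq> {x. \<phi> x \<noteq> 0}" by auto
  then have "(\<lambda>x. f x * \<phi> x) \<in> C1_c R"
    using \<phi> C1_mult(1)[OF f C1_c_C1[OF \<phi>]] closure_mono unfolding C1_c_def by blast
  then have "(\<integral>x. f x * partial_deriv b \<phi> x + partial_deriv b f x * \<phi> x \<partial>ball_measure R) = 0"
    using integral_partial_deriv_C1_c[of "\<lambda>x. f x * \<phi> x" R b] by (simp add: C1_mult(2)[OF f C1_c_C1[OF \<phi>]])
  also have "(\<integral>x. f x * partial_deriv b \<phi> x + partial_deriv b f x * \<phi> x \<partial>ball_measure R) =
     (\<integral>x. f x * partial_deriv b \<phi> x \<partial>ball_measure R) + (\<integral>x. partial_deriv b f x * \<phi> x \<partial>ball_measure R)"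
    by (intro Bochner_Integration.integral_add integrable_ball_continuous continuous_intros
        C1_continuous C1_continuous_partial f C1_c_C1[OF \<phi>])
  finally show "(\<integral>x. f x * partial_deriv b \<phi> x \<partial>ball_measure R) = - (\<integral>x. partial_deriv b f x * \<phi> x \<partial>ball_measure R)"
    by (simp add: eq_neg_iff_add_eq_0)
qed

lemma H1_L2: "u \<in> H1 R \<Longrightarrow> u \<in> L2 (ball_measure R)"
  by (simp add: H1_def)

lemma H1_wderiv:
  assumes "u \<in> H1 R" "b \<in> Basis"
  shows "wderiv R b u \<in> L2 (ball_measure R)" and "weak_partial R b u (wderiv R b u)"
proof -
  have "\<exists>w. w \<in> L2 (ball_measure R) \<and> weak_partial R b u w"
    using assms by (auto simp: H1_def)
  from someI_ex[OF this] show "wderiv R b u \<in> L2 (ball_measure R)" "weak_partial R b u (wderiv R b u)"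
    by (auto simp: wderiv_def)
qed

lemma H1I:
  assumes "u \<in> L2 (ball_measure R)"
    and "\<And>b. b \<in> Basis \<Longrightarrow> w b \<in> L2 (ball_measure R)" "\<And>b. b \<in> Basis \<Longrightarrow> weak_partial R b u (w b)"
  shows "u \<in> H1 R"
  using assms by (auto simp: H1_def)

text \<open>
  The choice made in \<open>wderiv\<close> is immaterial up to null sets; all computations with weak derivatives go
  through this.
\<close>

lemma wderiv_AE:
  assumes R: "R > 0" and "w \<in> L2 (ball_measure R)" "weak_partial R b u w"
  shows "AE x in ball_measure R. wderiv R b u x = w x"
    and "wderiv R b u \<in> L2 (ball_measure R)"
proof -
  have "\<exists>w. w \<in> L2 (ball_measure R) \<and> weak_partial R b u w"
    using assms by auto
  from someI_ex[OF this] have *: "wderiv R b u \<in> L2 (ball_measure R)" "weak_partial R b u (wderiv R b u)"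
    by (auto simp: wderiv_def)
  show "AE x in ball_measure R. wderiv R b u x = w x"
    by (rule weak_partial_unique[OF R *(1) assms(2) *(2) assms(3)])
  show "wderiv R b u \<in> L2 (ball_measure R)" by (rule *(1))
qed

lemma H1_C1:
  assumes "f \<in> C1" shows "f \<in> H1 R"
    and "R > 0 \<Longrightarrow> AE x in ball_measure R. wderiv R b f x = partial_deriv b f x"
proof -
  have p: "partial_deriv b f \<in> L2 (ball_measure R)" for b
    by (intro L2_ball_continuous C1_continuous_partial assms)
  show "f \<in> H1 R"
    by (rule H1I[of _ _ "\<lambda>b. partial_deriv b f"])
       (auto intro: p weak_partial_C1 L2_ball_continuous C1_continuous assms)
  show "R > 0 \<Longrightarrow> AE x in ball_measure R. wderiv R b f x = partial_deriv b f x"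
    by (rule wderiv_AE(1)[OF _ p weak_partial_C1[OF assms]])
qed

lemma H1_add:
  assumes "R > 0" "u \<in> H1 R" "v \<in> H1 R"
  shows "(\<lambda>x. u x + v x) \<in> H1 R"
    and "b \<in> Basis \<Longrightarrow> AE x in ball_measure R. wderiv R b (\<lambda>x. u x + v x) x = wderiv R b u x + wderiv R b v x"
proof -
  note u = H1_L2[OF assms(2)] H1_L2[OF assms(3)]
  have w: "(\<lambda>x. wderiv R b u x + wderiv R b v x) \<in> L2 (ball_measure R)"
    "weak_partial R b (\<lambda>x. u x + v x) (\<lambda>x. wderiv R b u x + wderiv R b v x)" if "b \<in> Basis" for b
    using that H1_wderiv[OF assms(2)] H1_wderiv[OF assms(3)] u
    by (auto intro!: L2_add(1) weak_partial_add)
  show "(\<lambda>x. u x + v x) \<in> H1 R"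
    by (rule H1I[of _ _ "\<lambda>b x. wderiv R b u x + wderiv R b v x"]) (use u w L2_add(1) in auto)
  show "b \<in> Basis \<Longrightarrow> AE x in ball_measure R. wderiv R b (\<lambda>x. u x + v x) x = wderiv R b u x + wderiv R b v x"
    by (rule wderiv_AE(1)[OF assms(1)]) (use w in auto)
qed

lemma H1_cmult:
  assumes "R > 0" "u \<in> H1 R"
  shows "(\<lambda>x. c * u x) \<in> H1 R"
    and "b \<in> Basis \<Longrightarrow> AE x in ball_measure R. wderiv R b (\<lambda>x. c * u x) x = c * wderiv R b u x"
proof -
  have w: "(\<lambda>x. c * wderiv R b u x) \<in> L2 (ball_measure R)"
    "weak_partial R b (\<lambda>x. c * u x) (\<lambda>x. c * wderiv R b u x)" if "b \<in> Basis" for b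
    using that H1_wderiv[OF assms(2)]
    by (auto intro!: L2_cmult(1) weak_partial_cmult)
  show "(\<lambda>x. c * u x) \<in> H1 R"
    by (rule H1I[of _ _ "\<lambda>b x. c * wderiv R b u x"]) (use H1_L2[OF assms(2)] w L2_cmult(1) in auto)
  show "b \<in> Basis \<Longrightarrow> AE x in ball_measure R. wderiv R b (\<lambda>x. c * u x) x = c * wderiv R b u x"
    by (rule wderiv_AE(1)[OF assms(1)]) (use w in auto)
qed

lemma H1_diff:
  assumes "R > 0" "u \<in> H1 R" "v \<in> H1 R"
  shows "(\<lambda>x. u x - v x) \<in> H1 R"
    and "b \<in> Basis \<Longrightarrow> AE x in ball_measure R. wderiv R b (\<lambda>x. u x - v x) x = wderiv R b u x - wderiv R b v x"
proof -
  note m = H1_cmult[OF assms(1,3), where c = "-1"]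
  show "(\<lambda>x. u x - v x) \<in> H1 R" using H1_add(1)[OF assms(1,2) m(1)] by simp
  assume b: "b \<in> Basis"
  show "AE x in ball_measure R. wderiv R b (\<lambda>x. u x - v x) x = wderiv R b u x - wderiv R b v x"
    using H1_add(2)[OF assms(1,2) m(1) b] m(2)[OF b] by eventually_elim simp
qed

section \<open>The Schroedinger form\<close>

lemma L2norm_le_H1norm: "L2norm (ball_measure R) u \<le> H1norm R u"
  unfolding H1norm_def by (rule real_le_rsqrt) (simp add: sum_nonneg)

lemma L2norm_wderiv_le_H1norm:
  assumes "b \<in> Basis" shows "L2norm (ball_measure R) (wderiv R b u) \<le> H1norm R u"
proof -
  have "(L2norm (ball_measure R) (wderiv R b u))\<^sup>2 \<le> (\<Sum>b\<in>Basis. (L2norm (ball_measure R) (wderiv R b u))\<^sup>2)"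
    using assms by (intro member_le_sum) auto
  then show ?thesis unfolding H1norm_def
    by (intro real_le_rsqrt) (smt (verit) zero_le_power2)
qed

lemma H1norm_nonneg: "0 \<le> H1norm R u"
  unfolding H1norm_def by (simp add: sum_nonneg)

lemma H1norm_square:
  "(H1norm R u)\<^sup>2 = (L2norm (ball_measure R) u)\<^sup>2 + (\<Sum>b\<in>Basis. (L2norm (ball_measure R) (wderiv R b u))\<^sup>2)"
  unfolding H1norm_def by (simp add: sum_nonneg)

lemma Linfty_mult_L2:
  assumes "q \<in> Linfty M" "u \<in> L2 M"
  shows "(\<lambda>x. of_real (q x) * u x) \<in> L2 M"
proof -
  obtain C where "q \<in> borel_measurable M" "AE x in M. \<bar>q x\<bar> \<le> C" using assms(1) by (auto simp: Linfty_def)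
  then show ?thesis by (intro L2_bounded_mult(1)[OF assms(2), of _ C]) auto
qed

lemma schroedinger_form_split:
  assumes q: "q \<in> Linfty (ball_measure R)" and u: "u \<in> H1 R" and v: "v \<in> H1 R"
  shows "schroedinger_form R q u v =
    (\<Sum>b\<in>Basis. \<integral>x. wderiv R b u x * wderiv R b v x \<partial>ball_measure R) + (\<integral>x. (of_real (q x) * u x) * v x \<partial>ball_measure R)"
proof -
  have 1: "integrable (ball_measure R) (\<lambda>x. wderiv R b u x * wderiv R b v x)" if "b \<in> Basis" for b
    by (intro L2_mult_integrable(1) H1_wderiv(1) u v that)
  have 2: "integrable (ball_measure R) (\<lambda>x. (of_real (q x) * u x) * v x)"
    by (intro L2_mult_integrable(1) Linfty_mult_L2[OF q] H1_L2 u v)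
  show ?thesis unfolding schroedinger_form_def
    using 1 2 by (subst Bochner_Integration.integral_add) auto
qed

lemma schroedinger_form_commute: "schroedinger_form R q u v = schroedinger_form R q v u"
  unfolding schroedinger_form_def by (intro Bochner_Integration.integral_cong refl) (simp add: mult_ac)

lemma schroedinger_form_cong:
  assumes R: "R > 0" and q: "q \<in> Linfty (ball_measure R)" and uv: "u \<in> H1 R" "v \<in> H1 R"
    and ae: "\<And>b. b \<in> Basis \<Longrightarrow> AE x in ball_measure R. wderiv R b v x = g b x"
    and ae': "\<And>b. b \<in> Basis \<Longrightarrow> AE x in ball_measure R. wderiv R b u x = f b x"
    and m: "\<And>b. b \<in> Basis \<Longrightarrow> f b \<in> borel_measurable (ball_measure R)"
      "\<And>b. b \<in> Basis \<Longrightarrow> g b \<in> borel_measurable (ball_measure R)"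
  shows "schroedinger_form R q u v =
    (\<integral>x. (\<Sum>b\<in>Basis. f b x * g b x) + of_real (q x) * u x * v x \<partial>ball_measure R)"
proof -
  have [measurable]: "q \<in> borel_measurable (ball_measure R)" using q by (simp add: Linfty_def)
  note [measurable] = L2_measurable[OF H1_L2[OF uv(1)]] L2_measurable[OF H1_L2[OF uv(2)]] m
     L2_measurable[OF H1_wderiv(1)[OF uv(1)]] L2_measurable[OF H1_wderiv(1)[OF uv(2)]]
  have "AE x in ball_measure R. \<forall>b\<in>Basis. wderiv R b v x = g b x \<and> wderiv R b u x = f b x"
    using ae ae' by (intro AE_finite_allI) auto
  then show ?thesis unfolding schroedinger_form_def
    by (intro integral_cong_AE) (auto elim!: eventually_mono intro!: sum.cong)
qed

lemma schroedinger_form_C1: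
  assumes R: "R > 0" and q: "q \<in> Linfty (ball_measure R)" and uv: "u \<in> C1" "v \<in> C1"
  shows "schroedinger_form R q u v =
    (\<integral>x. (\<Sum>b\<in>Basis. partial_deriv b u x * partial_deriv b v x) + of_real (q x) * u x * v x \<partial>ball_measure R)"
  by (rule schroedinger_form_cong[OF R q])
     (use uv R in \<open>auto intro!: H1_C1 borel_measurable_ball_measure borel_measurable_continuous_onI C1_continuous_partial\<close>)

lemma schroedinger_form_diff_right:
  assumes R: "R > 0" and q: "q \<in> Linfty (ball_measure R)" and u: "u \<in> H1 R" and v: "v \<in> H1 R" "w \<in> H1 R"
  shows "schroedinger_form R q u (\<lambda>x. v x - w x) = schroedinger_form R q u v - schroedinger_form R q u w"
proof -
  have 1: "(\<integral>x. wderiv R b u x * wderiv R b (\<lambda>x. v x - w x) x \<partial>ball_measure R) =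
    (\<integral>x. wderiv R b u x * wderiv R b v x \<partial>ball_measure R) - (\<integral>x. wderiv R b u x * wderiv R b w x \<partial>ball_measure R)"
    if b: "b \<in> Basis" for b
  proof -
    note [measurable] = L2_measurable[OF H1_wderiv(1)[OF u b]] L2_measurable[OF H1_wderiv(1)[OF v(1) b]]
      L2_measurable[OF H1_wderiv(1)[OF v(2) b]] L2_measurable[OF H1_wderiv(1)[OF H1_diff(1)[OF R v] b]]
    have "(\<integral>x. wderiv R b u x * wderiv R b (\<lambda>x. v x - w x) x \<partial>ball_measure R) =
      (\<integral>x. wderiv R b u x * wderiv R b v x - wderiv R b u x * wderiv R b w x \<partial>ball_measure R)"
      using H1_diff(2)[OF R v b]
      by (intro integral_cong_AE) (auto elim!: eventually_mono simp: right_diff_distrib)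
    also have "\<dots> = (\<integral>x. wderiv R b u x * wderiv R b v x \<partial>ball_measure R) - (\<integral>x. wderiv R b u x * wderiv R b w x \<partial>ball_measure R)"
      by (intro Bochner_Integration.integral_diff L2_mult_integrable(1) H1_wderiv(1) u v b)
    finally show ?thesis .
  qed
  have 2: "(\<integral>x. (of_real (q x) * u x) * (v x - w x) \<partial>ball_measure R) =
    (\<integral>x. (of_real (q x) * u x) * v x \<partial>ball_measure R) - (\<integral>x. (of_real (q x) * u x) * w x \<partial>ball_measure R)"
    unfolding right_diff_distrib
    by (intro Bochner_Integration.integral_diff L2_mult_integrable(1) Linfty_mult_L2[OF q] H1_L2 u v)
  show ?thesis
    unfolding schroedinger_form_split[OF q u v(1)] schroedinger_form_split[OF q u v(2)]
      schroedinger_form_split[OF q u H1_diff(1)[OF R v]] 2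
    by (simp add: 1 sum_subtractf)
qed

lemma schroedinger_form_bound:
  assumes q: "q \<in> Linfty (ball_measure R)" and u: "u \<in> H1 R"
  obtains K where "\<And>v. v \<in> H1 R \<Longrightarrow> norm (schroedinger_form R q u v) \<le> K * H1norm R v"
proof
  let ?L = "L2norm (ball_measure R)"
  fix v :: "'a \<Rightarrow> complex" assume v: "v \<in> H1 R"
  have 1: "norm (\<integral>x. wderiv R b u x * wderiv R b v x \<partial>ball_measure R) \<le> ?L (wderiv R b u) * H1norm R v"
    if b: "b \<in> Basis" for b
    using L2_Cauchy_Schwarz[OF H1_wderiv(1)[OF u b] H1_wderiv(1)[OF v b]]
      mult_left_mono[OF L2norm_wderiv_le_H1norm[OF b, of R v] L2norm_nonneg]
    by (rule order_trans)
  have 2: "norm (\<integral>x. (of_real (q x) * u x) * v x \<partial>ball_measure R) \<le> ?L (\<lambda>x. of_real (q x) * u x) * H1norm R v"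
    using L2_Cauchy_Schwarz[OF Linfty_mult_L2[OF q H1_L2[OF u]] H1_L2[OF v]]
      mult_left_mono[OF L2norm_le_H1norm[of R v] L2norm_nonneg]
    by (rule order_trans)
  have "norm (schroedinger_form R q u v) \<le>
     (\<Sum>b\<in>Basis. norm (\<integral>x. wderiv R b u x * wderiv R b v x \<partial>ball_measure R)) + norm (\<integral>x. (of_real (q x) * u x) * v x \<partial>ball_measure R)"
    unfolding schroedinger_form_split[OF q u v]
    by (rule order_trans[OF norm_triangle_ineq]) (intro add_right_mono norm_sum)
  also have "\<dots> \<le> (\<Sum>b\<in>Basis. ?L (wderiv R b u) * H1norm R v) + ?L (\<lambda>x. of_real (q x) * u x) * H1norm R v"
    by (intro add_mono sum_mono 1 2)
  also have "\<dots> = ((\<Sum>b\<in>Basis. ?L (wderiv R b u)) + ?L (\<lambda>x. of_real (q x) * u x)) * H1norm R v"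
    by (simp add: sum_distrib_right distrib_right)
  finally show "norm (schroedinger_form R q u v) \<le>
    ((\<Sum>b\<in>Basis. ?L (wderiv R b u)) + ?L (\<lambda>x. of_real (q x) * u x)) * H1norm R v" .
qed

text \<open>
  The form is continuous in its second argument for the norm of \<open>H\<^sup>1\<close>. As traces are limits of
  restrictions of \<open>C1\<close> functions, identities for the form need to be checked on \<open>C1\<close> functions only.
\<close>

lemma schroedinger_form_tendsto:
  assumes R: "R > 0" and q: "q \<in> Linfty (ball_measure R)" and u: "u \<in> H1 R" and v: "v \<in> H1 R"
    and \<phi>: "\<And>n. \<phi> n \<in> C1" and lim: "(\<lambda>n. H1norm R (\<lambda>x. \<phi> n x - v x)) \<longlonglongrightarrow> 0"
  shows "(\<lambda>n. schroedinger_form R q u (\<phi> n)) \<longlonglongrightarrow> schroedinger_form R q u v"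
proof -
  obtain K where K: "\<And>v. v \<in> H1 R \<Longrightarrow> norm (schroedinger_form R q u v) \<le> K * H1norm R v"
    using schroedinger_form_bound[OF q u] by blast
  have "(\<lambda>n. schroedinger_form R q u (\<phi> n) - schroedinger_form R q u v) \<longlonglongrightarrow> 0"
  proof (rule Lim_null_comparison)
    show "\<forall>\<^sub>F n in sequentially. norm (schroedinger_form R q u (\<phi> n) - schroedinger_form R q u v) \<le> K * H1norm R (\<lambda>x. \<phi> n x - v x)"
      using K[OF H1_diff(1)[OF R H1_C1(1)[OF \<phi>] v]]
      by (simp add: schroedinger_form_diff_right[OF R q u H1_C1(1)[OF \<phi>] v])
    show "(\<lambda>n. K * H1norm R (\<lambda>x. \<phi> n x - v x)) \<longlonglongrightarrow> 0"
      using tendsto_mult_right[OF lim, of K] tendsto_mult_left[OF lim, of K] by simp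
  qed
  then show ?thesis by (rule LIM_zero_cancel)
qed

section \<open>Functions with vanishing trace\<close>

lemma integral_indicator_L2_tendsto_0:
  assumes g: "g \<in> L2 M" and h: "\<And>n. h n \<in> borel_measurable M"
    and b: "\<And>n x. x \<in> space M \<Longrightarrow> norm (h n x) \<le> 1"
    and l: "\<And>x. x \<in> space M \<Longrightarrow> (\<lambda>n::nat. h n x) \<longlonglongrightarrow> 0"
  shows "(\<lambda>n. (L2norm M (\<lambda>x. h n x * g x))\<^sup>2) \<longlonglongrightarrow> 0"
proof -
  note [measurable] = L2_measurable[OF g] h
  have "(\<lambda>n. \<integral>x. (norm (h n x * g x))\<^sup>2 \<partial>M) \<longlonglongrightarrow> (\<integral>x. 0 \<partial>M)"
  proof (rule integral_dominated_convergence[where w = "\<lambda>x. (norm (g x))\<^sup>2"])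
    show "integrable M (\<lambda>x. (norm (g x))\<^sup>2)" by (rule L2_integrable[OF g])
    show "AE x in M. (\<lambda>n. (norm (h n x * g x))\<^sup>2) \<longlonglongrightarrow> 0"
    proof (rule AE_I2)
      fix x assume "x \<in> space M"
      have "(\<lambda>n. (norm (h n x * g x))\<^sup>2) \<longlonglongrightarrow> (norm (0 * g x))\<^sup>2"
        by (intro tendsto_intros l) fact
      then show "(\<lambda>n. (norm (h n x * g x))\<^sup>2) \<longlonglongrightarrow> 0" by simp
    qed
    show "AE x in M. norm ((norm (h n x * g x))\<^sup>2) \<le> (norm (g x))\<^sup>2" for n
      using b by (intro AE_I2) (auto simp: norm_mult power_mult_distrib power_le_one intro!: mult_left_le_one_le)
  qed auto
  then show ?thesis by (simp add: L2norm_square)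
qed

text \<open>
  The indicator of a boundary layer that contains the region where the cutoff is not 1.
\<close>

definition shell :: "real \<Rightarrow> real \<Rightarrow> 'a::euclidean_space \<Rightarrow> complex" where
  "shell R n x = (if n * (R\<^sup>2 - x \<bullet> x) < 3 then 1 else 0)"

lemma shell_measurable [measurable]: "shell R n \<in> borel_measurable borel"
  unfolding shell_def by measurable

lemma norm_shell_le: "norm (shell R n x) \<le> 1"
  by (simp add: shell_def)

lemma shell_tendsto:
  assumes "x \<in> ball 0 R"
  shows "(\<lambda>n. shell R (real n) x) \<longlonglongrightarrow> 0"
  using eventually_multiple_gt[OF ball_square_diff_pos[OF assms], of 3]
  by (intro tendsto_eventually) (auto elim!: eventually_mono simp: shell_def)

text \<open>
  Expand the square in \<open>0 \<le> p (2 n \<bar>a\<bar> f - p g)\<^sup>2\<close>.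
\<close>

lemma young_weighted:
  fixes a f g p n :: real
  assumes "n > 0" "p \<ge> 0" "p \<le> 3" "f \<ge> 0" "g \<ge> 0"
  shows "2 * p\<^sup>2 * \<bar>a\<bar> * (f * g) \<le> 2 * n * a\<^sup>2 * p * f\<^sup>2 + 27 / (2 * n) * g\<^sup>2"
proof -
  define c where "c = \<bar>a\<bar>"
  have a2: "a\<^sup>2 = c\<^sup>2" by (simp add: c_def)
  have "0 \<le> p * (2 * n * c * f - p * g)\<^sup>2" using assms by simp
  then have "2 * p\<^sup>2 * c * (f * g) * (2 * n) \<le> (2 * n * c\<^sup>2 * p * f\<^sup>2) * (2 * n) + p ^ 3 * g\<^sup>2"
    by (simp add: power2_eq_square power3_eq_cube algebra_simps)
  also have "p ^ 3 * g\<^sup>2 \<le> 27 * g\<^sup>2"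
    using power_mono[OF assms(3,2), of 3] by (intro mult_right_mono) auto
  also have "(2 * n * c\<^sup>2 * p * f\<^sup>2) * (2 * n) + 27 * g\<^sup>2 = (2 * n * c\<^sup>2 * p * f\<^sup>2 + 27 / (2 * n) * g\<^sup>2) * (2 * n)"
    using assms by (simp add: field_simps)
  finally show ?thesis unfolding a2 c_def[symmetric] using assms by simp
qed

text \<open>
  The gradient of the cutoff is of order \<open>n\<close> on a layer of width \<open>1 / n\<close>. If \<open>f\<close> is small on the sphere,
  then it is controlled in that layer by its gradient, as in a Hardy inequality.

  With \<open>y = n (R\<^sup>2 - x \<bullet> x)\<close> and \<open>p = max 0 (3 - y)\<close>, apply the divergence theorem to the field
  \<open>x p\<^sup>2 \<bar>f\<bar>\<^sup>2\<close>. On the sphere \<open>y = 0\<close>, so the flux is \<open>9 R\<close> times the squared boundary norm. As \<open>p\<^sup>2\<close> increases towards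
  the sphere, the divergence contains the positive term \<open>4 n p \<bar>x\<bar>\<^sup>2 \<bar>f\<bar>\<^sup>2\<close>. Half of it absorbs the part
  with the gradient of \<open>f\<close>; the other half, times a multiple of \<open>n\<close>, dominates \<open>\<bar>f\<bar>\<^sup>2\<close> times the square of the
  gradient of the cutoff, which lives on \<open>1 \<le> y \<le> 2\<close>, where \<open>p \<ge> 1\<close>.
\<close>

lemma cutoff_gradient_estimate:
  fixes f :: "'a::euclidean_space \<Rightarrow> complex"
  assumes f: "f \<in> C1" and R: "R > 0" and dim: "DIM('a) \<ge> 2" and n: "n > 0"
  shows "(\<Sum>b\<in>Basis. (L2norm (ball_measure R) (\<lambda>x. partial_deriv b (cutoff R n) x * f x))\<^sup>2) \<le>
    72 * n * R * (L2norm (sphere_measure R) f)\<^sup>2 +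
    108 * (\<Sum>b\<in>Basis. (L2norm (ball_measure R) (\<lambda>x. shell R n x * partial_deriv b f x))\<^sup>2)"
proof -
  define p :: "'a \<Rightarrow> real" where "p x = max 0 (3 - n * (R\<^sup>2 - x \<bullet> x))" for x
  define \<theta> :: "'a \<Rightarrow> complex" where "\<theta> x = of_real ((p x)\<^sup>2)" for x
  have d: "((\<lambda>t. (max 0 (3 - n * (R\<^sup>2 - t)))\<^sup>2) has_real_derivative 2 * max 0 (3 - n * (R\<^sup>2 - t)) * n) (at t)" for t
    by (rule DERIV_chain2[where f = "\<lambda>t. (max 0 t)\<^sup>2" and g = "\<lambda>t. 3 - n * (R\<^sup>2 - t)", OF has_real_derivative_pos_part_square])
       (auto intro!: derivative_eq_intros)
  have c: "continuous_on UNIV (\<lambda>t. 2 * max 0 (3 - n * (R\<^sup>2 - t)) * n)" by (intro continuous_intros)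
  have \<theta>: "\<theta> \<in> C1" and d\<theta>: "partial_deriv b \<theta> x = of_real (4 * n * (x \<bullet> b) * p x)" for b x
    using C1_square_compose[OF d c] by (auto simp: \<theta>_def[abs_def] p_def mult_ac)
  \<comment> \<open>The components of the field \<open>x p\<^sup>2 \<bar>f\<bar>\<^sup>2\<close>.\<close>
  define G where "G b x = of_real (x \<bullet> b) * (\<theta> x * (f x * cnj (f x)))" for b x
  have fcf: "(\<lambda>x. f x * cnj (f x)) \<in> C1" by (intro C1_mult C1_cnj f)
  have G: "G b \<in> C1" for b unfolding G_def[abs_def] by (intro C1_mult C1_inner_right \<theta> fcf)
  let ?J = "\<lambda>b x. (x \<bullet> b)\<^sup>2 * 4 * n * p x * (norm (f x))\<^sup>2 + (p x)\<^sup>2 * (norm (f x))\<^sup>2 + (p x)\<^sup>2 * (x \<bullet> b) * (2 * Re (partial_deriv b f x * cnj (f x)))"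
  have dG: "partial_deriv b (G b) x = of_real (?J b x)" if "b \<in> Basis" for b x
  proof -
    have e: "f x * cnj (partial_deriv b f x) + partial_deriv b f x * cnj (f x) = of_real (2 * Re (partial_deriv b f x * cnj (f x)))"
      using complex_add_cnj[of "partial_deriv b f x * cnj (f x)"] by (simp add: mult.commute add.commute)
    have "partial_deriv b (G b) x = of_real (x \<bullet> b) * (\<theta> x * (f x * cnj (partial_deriv b f x) + partial_deriv b f x * cnj (f x))
        + partial_deriv b \<theta> x * (f x * cnj (f x))) + of_real (b \<bullet> b) * (\<theta> x * (f x * cnj (f x)))"
      unfolding G_def[abs_def]
      by (simp only: C1_mult(2)[OF C1_inner_right(1) C1_mult(1)[OF \<theta> fcf]] C1_mult(2)[OF \<theta> fcf]
          C1_mult(2)[OF f C1_cnj(1)[OF f]] C1_cnj(2)[OF f] C1_inner_right(2))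
    also have "\<dots> = of_real (?J b x)"
      unfolding e d\<theta> complex_norm_square[symmetric] \<theta>_def using that
      by (simp add: power2_eq_square algebra_simps)
    finally show ?thesis .
  qed
  let ?S = "(L2norm (sphere_measure R) f)\<^sup>2"
  have div: "(\<Sum>b\<in>Basis. \<integral>x. partial_deriv b (G b) x \<partial>ball_measure R) = of_real (9 * R * ?S)"
  proof -
    have "(\<Sum>b\<in>Basis. \<integral>x. partial_deriv b (G b) x \<partial>ball_measure R) =
       (\<Sum>b\<in>Basis. \<integral>w. of_real ((w \<bullet> b) / R) * G b w \<partial>sphere_measure R)"
      by (intro sum.cong integral_partial_deriv_ball G R dim refl)
    also have "\<dots> = (\<integral>w. (\<Sum>b\<in>Basis. of_real ((w \<bullet> b) / R) * G b w) \<partial>sphere_measure R)"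
    proof (rule Bochner_Integration.integral_sum[symmetric])
      fix b :: 'a
      have cG: "continuous_on UNIV (\<lambda>w. of_real ((w \<bullet> b) / R) * G b w)"
        using R by (intro continuous_on_mult[OF _ C1_continuous[OF G]] continuous_intros) auto
      obtain B where "\<And>x. x \<in> cball 0 R \<Longrightarrow> norm (of_real ((x \<bullet> b) / R) * G b x) \<le> B"
        using continuous_bounded_ball[OF cG, where R = R] by blast
      then show "integrable (sphere_measure R) (\<lambda>w. of_real ((w \<bullet> b) / R) * G b w)"
        using cG by (intro finite_measure.integrable_const_bound[OF finite_sphere_measure[OF R], where B = B] AE_I2
            borel_measurable_sphere_measure borel_measurable_continuous_onI) auto
    qed
    also have "\<dots> = (\<integral>w. complex_of_real (9 * R * (norm (f w))\<^sup>2) \<partial>sphere_measure R)"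
    proof (intro Bochner_Integration.integral_cong refl)
      fix w :: 'a assume "w \<in> space (sphere_measure R)"
      then have w: "w \<bullet> w = R\<^sup>2" by (simp add: dot_square_norm)
      have "(\<Sum>b\<in>Basis. of_real ((w \<bullet> b) / R) * G b w) =
          of_real ((\<Sum>b\<in>Basis. (w \<bullet> b) * (w \<bullet> b)) / R) * (\<theta> w * (f w * cnj (f w)))"
      proof -
        have "of_real ((w \<bullet> b) / R) * G b w = of_real ((w \<bullet> b) * (w \<bullet> b) / R) * (\<theta> w * (f w * cnj (f w)))" for b
          by (simp add: G_def)
        then show ?thesis by (simp only: sum_distrib_right[symmetric] of_real_sum[symmetric] sum_divide_distrib)
      qed
      also have "(\<Sum>b\<in>Basis. (w \<bullet> b) * (w \<bullet> b)) = R\<^sup>2" using w by (simp add: euclidean_inner[symmetric])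
      also have "of_real (R\<^sup>2 / R) * (\<theta> w * (f w * cnj (f w))) = complex_of_real (9 * R * (norm (f w))\<^sup>2)"
        unfolding \<theta>_def complex_norm_square[symmetric] p_def w using R by (simp add: power2_eq_square)
      finally show "(\<Sum>b\<in>Basis. of_real ((w \<bullet> b) / R) * G b w) = complex_of_real (9 * R * (norm (f w))\<^sup>2)" .
    qed
    also have "\<dots> = of_real (9 * R * ?S)" unfolding L2norm_square integral_complex_of_real by simp
    finally show ?thesis .
  qed
  note fc = C1_continuous[OF f, of UNIV] C1_continuous_partial[OF f, of UNIV]
  have pc: "continuous_on UNIV p" unfolding p_def by (intro continuous_intros)
  define I where "I x = (\<Sum>b\<in>Basis. ?J b x)" for x
  have Ic: "continuous_on UNIV I" unfolding I_def by (intro continuous_intros fc pc)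
  have I: "(\<integral>x. I x \<partial>ball_measure R) = 9 * R * ?S"
  proof -
    have "complex_of_real (9 * R * ?S) = (\<integral>x. (\<Sum>b\<in>Basis. partial_deriv b (G b) x) \<partial>ball_measure R)"
      unfolding div[symmetric]
      by (intro Bochner_Integration.integral_sum[symmetric] integrable_ball_continuous C1_continuous_partial G)
    also have "\<dots> = (\<integral>x. of_real (I x) \<partial>ball_measure R)"
      by (intro Bochner_Integration.integral_cong refl) (simp add: I_def dG)
    also have "\<dots> = of_real (\<integral>x. I x \<partial>ball_measure R)" by simp
    finally show ?thesis by (simp only: of_real_eq_iff)
  qed
  define A where "A x = (\<Sum>b\<in>Basis. (norm (partial_deriv b (cutoff R n) x * f x))\<^sup>2)" for x
  define E where "E x = (\<Sum>b\<in>Basis. (norm (shell R n x * partial_deriv b f x))\<^sup>2)" for x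
  have pw: "A x \<le> 8 * n * I x + 108 * E x" if x: "x \<in> ball 0 R" for x
  proof -
    have y: "n * (R\<^sup>2 - x \<bullet> x) > 0" using n ball_square_diff_pos[OF x] by simp
    then have p3: "0 \<le> p x" "p x \<le> 3" by (auto simp: p_def)
    have sb: "(smoothstep' (n * (R\<^sup>2 - x \<bullet> x) - 1))\<^sup>2 \<le> 4 * p x"
    proof (cases "n * (R\<^sup>2 - x \<bullet> x) < 2")
      case True
      then have "p x \<ge> 1" by (simp add: p_def)
      moreover have "(smoothstep' (n * (R\<^sup>2 - x \<bullet> x) - 1))\<^sup>2 \<le> 2\<^sup>2"
        by (intro power_mono smoothstep'_bounds)
      ultimately show ?thesis by simp
    next
      case False
      then show ?thesis using p3 by simp
    qed
    have "(norm (partial_deriv b (cutoff R n) x * f x))\<^sup>2 \<le> 8 * n * (?J b x) + 108 * (norm (shell R n x * partial_deriv b f x))\<^sup>2" for b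
    proof -
      have "(norm (partial_deriv b (cutoff R n) x * f x))\<^sup>2 = 4 * n\<^sup>2 * (x \<bullet> b)\<^sup>2 * (smoothstep' (n * (R\<^sup>2 - x \<bullet> x) - 1))\<^sup>2 * (norm (f x))\<^sup>2"
        unfolding partial_deriv_cutoff norm_mult norm_minus_cancel norm_of_real power_mult_distrib power2_abs by simp
      also have "\<dots> \<le> 4 * n\<^sup>2 * (x \<bullet> b)\<^sup>2 * (4 * p x) * (norm (f x))\<^sup>2"
        by (intro mult_right_mono mult_left_mono sb) auto
      finally have 1: "(norm (partial_deriv b (cutoff R n) x * f x))\<^sup>2 \<le> 8 * n * (2 * n * (x \<bullet> b)\<^sup>2 * p x * (norm (f x))\<^sup>2)"
        by (simp add: power2_eq_square mult_ac)
      have 2: "2 * n * (x \<bullet> b)\<^sup>2 * p x * (norm (f x))\<^sup>2 \<le> (?J b x) + 27 / (2 * n) * (norm (shell R n x * partial_deriv b f x))\<^sup>2"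
      proof (cases "p x = 0")
        case True
        then show ?thesis using n by simp
      next
        case False
        then have sh: "shell R n x = 1" by (auto simp: p_def shell_def)
        have "\<bar>Re (partial_deriv b f x * cnj (f x))\<bar> \<le> norm (f x) * norm (partial_deriv b f x)"
          using abs_Re_le_cmod[of "partial_deriv b f x * cnj (f x)"] by (simp add: norm_mult mult.commute)
        then have "2 * (p x)\<^sup>2 * \<bar>x \<bullet> b\<bar> * \<bar>Re (partial_deriv b f x * cnj (f x))\<bar> \<le> 2 * (p x)\<^sup>2 * \<bar>x \<bullet> b\<bar> * (norm (f x) * norm (partial_deriv b f x))"
          by (intro mult_left_mono) auto
        also have "\<dots> \<le> 2 * n * (x \<bullet> b)\<^sup>2 * p x * (norm (f x))\<^sup>2 + 27 / (2 * n) * (norm (partial_deriv b f x))\<^sup>2"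
          by (rule young_weighted[OF n p3]) auto
        finally have am: "2 * (p x)\<^sup>2 * \<bar>x \<bullet> b\<bar> * \<bar>Re (partial_deriv b f x * cnj (f x))\<bar> \<le> 2 * n * (x \<bullet> b)\<^sup>2 * p x * (norm (f x))\<^sup>2 + 27 / (2 * n) * (norm (partial_deriv b f x))\<^sup>2" .
        have "\<bar>(p x)\<^sup>2 * (x \<bullet> b) * (2 * Re (partial_deriv b f x * cnj (f x)))\<bar> \<le> 2 * n * (x \<bullet> b)\<^sup>2 * p x * (norm (f x))\<^sup>2 + 27 / (2 * n) * (norm (partial_deriv b f x))\<^sup>2"
        proof -
          have e: "\<bar>(p x)\<^sup>2 * (x \<bullet> b) * (2 * z)\<bar> = 2 * (p x)\<^sup>2 * \<bar>x \<bullet> b\<bar> * \<bar>z\<bar>" for z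
            by (simp add: abs_mult)
          show ?thesis unfolding e by (rule am)
        qed
        moreover have "(x \<bullet> b)\<^sup>2 * 4 * n * p x * (norm (f x))\<^sup>2 = 2 * (2 * n * (x \<bullet> b)\<^sup>2 * p x * (norm (f x))\<^sup>2)" by simp
        moreover have "0 \<le> (p x)\<^sup>2 * (norm (f x))\<^sup>2" by simp
        ultimately show ?thesis unfolding sh mult_1 abs_le_iff by linarith
      qed
      from mult_left_mono[OF this, of "8 * n"] n 
      have "8 * n * (2 * n * (x \<bullet> b)\<^sup>2 * p x * (norm (f x))\<^sup>2) \<le> 8 * n * (?J b x) + 108 * (norm (shell R n x * partial_deriv b f x))\<^sup>2"
        by (simp add: distrib_left)
      with 1 show ?thesis by (rule order_trans)
    qed
    then have "A x \<le> (\<Sum>b\<in>Basis. 8 * n * (?J b x) + 108 * (norm (shell R n x * partial_deriv b f x))\<^sup>2)"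
      unfolding A_def by (intro sum_mono)
    also have "\<dots> = 8 * n * I x + 108 * E x"
      unfolding I_def E_def sum_distrib_left sum.distrib[symmetric] ..
    finally show ?thesis .
  qed
  have L2A: "(\<lambda>x. partial_deriv b (cutoff R n) x * f x) \<in> L2 (ball_measure R)" for b
    by (intro L2_ball_continuous continuous_intros C1_continuous_partial cutoff_C1 fc)
  have L2E: "(\<lambda>x. shell R n x * partial_deriv b f x) \<in> L2 (ball_measure R)" for b
    by (rule L2_bounded_mult(1)[where B = 1, OF L2_ball_continuous[OF fc(2)]])
       (auto intro!: borel_measurable_ball_measure AE_I2 simp: shell_def)
  have "(\<integral>x. A x \<partial>ball_measure R) \<le> (\<integral>x. 8 * n * I x + 108 * E x \<partial>ball_measure R)"
  proof (rule integral_mono)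
    show "integrable (ball_measure R) A" unfolding A_def
      by (intro Bochner_Integration.integrable_sum L2_integrable L2A)
    show "integrable (ball_measure R) (\<lambda>x. 8 * n * I x + 108 * E x)" unfolding E_def
      by (intro Bochner_Integration.integrable_add integrable_mult_right Bochner_Integration.integrable_sum L2_integrable L2E
          integrable_ball_continuous Ic)
  qed (use pw in \<open>auto simp: space_restrict_space\<close>)
  also have "\<dots> = 8 * n * (9 * R * ?S) + 108 * (\<integral>x. E x \<partial>ball_measure R)"
    unfolding I[symmetric] E_def
    by (subst Bochner_Integration.integral_add)
       (auto intro!: integrable_mult_right[OF integrable_ball_continuous[OF Ic]]
         integrable_mult_right[OF Bochner_Integration.integrable_sum] L2_integrable L2E
         integrable_ball_continuous[OF Ic])
  finally show ?thesis
    unfolding A_def E_def L2norm_square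
    by (subst (asm) (1 2) Bochner_Integration.integral_sum) (auto intro!: L2_integrable L2A L2E simp: L2norm_square)
qed

text \<open>
  The last two lines are small for large \<open>n\<close> and depend on \<open>u\<close> only; the factor \<open>n\<close> is confined to the
  boundary norm of \<open>f\<close>.
\<close>

lemma vanishing_trace_approximation:
  fixes u :: "'a::euclidean_space \<Rightarrow> complex"
  assumes R: "R > 0" and dim: "DIM('a) \<ge> 2" and n: "n > 0" and u: "u \<in> H1 R" and f: "f \<in> C1"
  shows "(H1norm R (\<lambda>x. cutoff R n x * f x - u x))\<^sup>2 \<le>
    436 * (H1norm R (\<lambda>x. f x - u x))\<^sup>2 + 144 * (n * R * (L2norm (sphere_measure R) f)\<^sup>2)
    + (2 * (L2norm (ball_measure R) (\<lambda>x. (1 - cutoff R n x) * u x))\<^sup>2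
    + (\<Sum>b\<in>Basis. 4 * (L2norm (ball_measure R) (\<lambda>x. (1 - cutoff R n x) * wderiv R b u x))\<^sup>2
        + 432 * (L2norm (ball_measure R) (\<lambda>x. shell R n x * wderiv R b u x))\<^sup>2))"
proof -
  let ?L = "\<lambda>u. (L2norm (ball_measure R) u)\<^sup>2"
  have fC: "(\<lambda>x. cutoff R n x * f x) \<in> C1" by (rule C1_mult(1)[OF cutoff_C1 f])
  have fu: "(\<lambda>x. f x - u x) \<in> H1 R" by (rule H1_diff(1)[OF R H1_C1(1)[OF f] u])
  have cm: "cutoff R n \<in> borel_measurable (ball_measure R)" "(\<lambda>x. 1 - cutoff R n x) \<in> borel_measurable (ball_measure R)"
    by (auto intro!: borel_measurable_ball_measure borel_measurable_continuous_onI C1_continuous C1_diff(1) cutoff_C1)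
  have sm: "shell R n \<in> borel_measurable (ball_measure R)" by (rule borel_measurable_ball_measure[OF shell_measurable])
  have c1: "(\<lambda>x. cutoff R n x * v x) \<in> L2 (ball_measure R)" "?L (\<lambda>x. cutoff R n x * v x) \<le> ?L v"
    "(\<lambda>x. (1 - cutoff R n x) * v x) \<in> L2 (ball_measure R)"
    "(\<lambda>x. shell R n x * v x) \<in> L2 (ball_measure R)" "?L (\<lambda>x. shell R n x * v x) \<le> ?L v"
    if v: "v \<in> L2 (ball_measure R)" for v
    using L2_bounded_mult[OF v cm(1), of 1] L2_bounded_mult[OF v cm(2), of 1] L2_bounded_mult[OF v sm, of 1]
      norm_cutoff_le[of R n] norm_one_minus_cutoff_le[of R n] by (auto simp: shell_def)
  have 0: "?L (\<lambda>x. cutoff R n x * f x - u x) \<le> 2 * ?L (\<lambda>x. f x - u x) + 2 * ?L (\<lambda>x. (1 - cutoff R n x) * u x)"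
  proof -
    have "?L (\<lambda>x. cutoff R n x * f x - u x) = ?L (\<lambda>x. cutoff R n x * (f x - u x) - (1 - cutoff R n x) * u x)"
      by (simp add: algebra_simps)
    also have "\<dots> \<le> 2 * ?L (\<lambda>x. cutoff R n x * (f x - u x)) + 2 * ?L (\<lambda>x. (1 - cutoff R n x) * u x)"
      by (intro L2_diff(2) c1 H1_L2 fu u)
    also have "\<dots> \<le> 2 * ?L (\<lambda>x. f x - u x) + 2 * ?L (\<lambda>x. (1 - cutoff R n x) * u x)"
      using c1(2)[OF H1_L2[OF fu]] by simp
    finally show ?thesis .
  qed
  have sh: "?L (\<lambda>x. shell R n x * partial_deriv b f x) \<le> 2 * ?L (wderiv R b (\<lambda>x. f x - u x)) + 2 * ?L (\<lambda>x. shell R n x * wderiv R b u x)"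
    and db: "?L (wderiv R b (\<lambda>x. cutoff R n x * f x - u x)) \<le> 4 * ?L (wderiv R b (\<lambda>x. f x - u x))
       + 4 * ?L (\<lambda>x. (1 - cutoff R n x) * wderiv R b u x) + 2 * ?L (\<lambda>x. partial_deriv b (cutoff R n) x * f x)"
    if b: "b \<in> Basis" for b
  proof -
    note W = H1_wderiv(1)[OF u b] and V = H1_wderiv(1)[OF fu b]
    have pL: "partial_deriv b f \<in> L2 (ball_measure R)" by (intro L2_ball_continuous C1_continuous_partial f)
    have gL: "(\<lambda>x. partial_deriv b (cutoff R n) x * f x) \<in> L2 (ball_measure R)"
      by (intro L2_ball_continuous continuous_on_mult C1_continuous_partial cutoff_C1 C1_continuous f)
    have V': "AE x in ball_measure R. wderiv R b (\<lambda>x. f x - u x) x = partial_deriv b f x - wderiv R b u x"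
      using H1_diff(2)[OF R H1_C1(1)[OF f] u b] H1_C1(2)[OF f R, of b] by eventually_elim simp
    have "?L (\<lambda>x. shell R n x * partial_deriv b f x) = ?L (\<lambda>x. shell R n x * wderiv R b (\<lambda>x. f x - u x) x + shell R n x * wderiv R b u x)"
      using V' by (intro arg_cong[where f = "\<lambda>t. t\<^sup>2"] L2norm_cong_AE[OF L2_measurable L2_measurable] c1 L2_add(1) W V pL)
        (auto elim!: eventually_mono simp: right_diff_distrib)
    also have "\<dots> \<le> 2 * ?L (\<lambda>x. shell R n x * wderiv R b (\<lambda>x. f x - u x) x) + 2 * ?L (\<lambda>x. shell R n x * wderiv R b u x)"
      by (intro L2_add(2) c1 W V)
    also have "\<dots> \<le> 2 * ?L (wderiv R b (\<lambda>x. f x - u x)) + 2 * ?L (\<lambda>x. shell R n x * wderiv R b u x)"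
      using c1(5)[OF V] by simp
    finally show "?L (\<lambda>x. shell R n x * partial_deriv b f x) \<le> 2 * ?L (wderiv R b (\<lambda>x. f x - u x)) + 2 * ?L (\<lambda>x. shell R n x * wderiv R b u x)" .
    let ?A = "\<lambda>x. cutoff R n x * wderiv R b (\<lambda>x. f x - u x) x - (1 - cutoff R n x) * wderiv R b u x"
    have AL: "?A \<in> L2 (ball_measure R)" by (intro L2_diff(1) c1 W V)
    have "AE x in ball_measure R. wderiv R b (\<lambda>x. cutoff R n x * f x - u x) x = ?A x + partial_deriv b (cutoff R n) x * f x"
      using H1_diff(2)[OF R H1_C1(1)[OF fC] u b] H1_C1(2)[OF fC R, of b] V'
      by eventually_elim (simp only: C1_mult(2)[OF cutoff_C1 f], simp add: algebra_simps)
    then have "?L (wderiv R b (\<lambda>x. cutoff R n x * f x - u x)) = ?L (\<lambda>x. ?A x + partial_deriv b (cutoff R n) x * f x)"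
      by (intro arg_cong[where f = "\<lambda>t. t\<^sup>2"] L2norm_cong_AE[OF L2_measurable L2_measurable] L2_add(1) AL gL
          H1_wderiv(1)[OF H1_diff(1)[OF R H1_C1(1)[OF fC] u] b])
    also have "\<dots> \<le> 2 * ?L ?A + 2 * ?L (\<lambda>x. partial_deriv b (cutoff R n) x * f x)"
      by (rule L2_add(2)[OF AL gL])
    also have "?L ?A \<le> 2 * ?L (\<lambda>x. cutoff R n x * wderiv R b (\<lambda>x. f x - u x) x) + 2 * ?L (\<lambda>x. (1 - cutoff R n x) * wderiv R b u x)"
      by (intro L2_diff(2) c1 W V)
    also have "?L (\<lambda>x. cutoff R n x * wderiv R b (\<lambda>x. f x - u x) x) \<le> ?L (wderiv R b (\<lambda>x. f x - u x))"
      by (rule c1(2)[OF V])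
    finally show "?L (wderiv R b (\<lambda>x. cutoff R n x * f x - u x)) \<le> 4 * ?L (wderiv R b (\<lambda>x. f x - u x))
       + 4 * ?L (\<lambda>x. (1 - cutoff R n x) * wderiv R b u x) + 2 * ?L (\<lambda>x. partial_deriv b (cutoff R n) x * f x)" by simp
  qed
  define w where "w = (\<Sum>b\<in>Basis. ?L (wderiv R b (\<lambda>x. f x - u x)))"
  define c where "c = (\<Sum>b\<in>Basis. ?L (\<lambda>x. (1 - cutoff R n x) * wderiv R b u x))"
  define e where "e = (\<Sum>b\<in>Basis. ?L (\<lambda>x. shell R n x * wderiv R b u x))"
  define g where "g = (\<Sum>b\<in>Basis. ?L (\<lambda>x. partial_deriv b (cutoff R n) x * f x))"
  define s where "s = (\<Sum>b\<in>Basis. ?L (\<lambda>x. shell R n x * partial_deriv b f x))"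
  have "s \<le> (\<Sum>b\<in>Basis. 2 * ?L (wderiv R b (\<lambda>x. f x - u x)) + 2 * ?L (\<lambda>x. shell R n x * wderiv R b u x))"
    unfolding s_def by (rule sum_mono) (rule sh)
  also have "\<dots> = 2 * w + 2 * e" by (simp add: w_def e_def sum.distrib sum_distrib_left)
  finally have s: "s \<le> 2 * w + 2 * e" .
  have "g \<le> 72 * n * R * (L2norm (sphere_measure R) f)\<^sup>2 + 108 * s"
    unfolding g_def s_def by (rule cutoff_gradient_estimate[OF f R dim n])
  also have "\<dots> \<le> 72 * n * R * (L2norm (sphere_measure R) f)\<^sup>2 + 108 * (2 * w + 2 * e)"
    by (intro add_left_mono mult_left_mono s) simp
  finally have g: "g \<le> 72 * n * R * (L2norm (sphere_measure R) f)\<^sup>2 + 108 * (2 * w + 2 * e)" .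
  have "(\<Sum>b\<in>Basis. ?L (wderiv R b (\<lambda>x. cutoff R n x * f x - u x))) \<le>
      (\<Sum>b\<in>Basis. 4 * ?L (wderiv R b (\<lambda>x. f x - u x))
       + 4 * ?L (\<lambda>x. (1 - cutoff R n x) * wderiv R b u x) + 2 * ?L (\<lambda>x. partial_deriv b (cutoff R n) x * f x))"
    by (rule sum_mono) (rule db)
  also have "\<dots> = 4 * w + 4 * c + 2 * g" by (simp add: w_def c_def g_def sum.distrib sum_distrib_left)
  also have "\<dots> \<le> 436 * w + 4 * c + 432 * e + 144 * (n * R * (L2norm (sphere_measure R) f)\<^sup>2)" using g by simp
  finally have "(H1norm R (\<lambda>x. cutoff R n x * f x - u x))\<^sup>2 \<le> 2 * ?L (\<lambda>x. f x - u x) + 2 * ?L (\<lambda>x. (1 - cutoff R n x) * u x)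
     + (436 * w + 4 * c + 432 * e + 144 * (n * R * (L2norm (sphere_measure R) f)\<^sup>2))"
    unfolding H1norm_square using 0 by simp
  also have "\<dots> \<le> 436 * (H1norm R (\<lambda>x. f x - u x))\<^sup>2 + 144 * (n * R * (L2norm (sphere_measure R) f)\<^sup>2)
    + (2 * ?L (\<lambda>x. (1 - cutoff R n x) * u x) + (4 * c + 432 * e))"
    unfolding H1norm_square w_def by simp
  also have "4 * c + 432 * e = (\<Sum>b\<in>Basis. 4 * ?L (\<lambda>x. (1 - cutoff R n x) * wderiv R b u x)
        + 432 * ?L (\<lambda>x. shell R n x * wderiv R b u x))"
    by (simp add: c_def e_def sum.distrib sum_distrib_left)
  finally show ?thesis .
qed

text \<open>
  The cutoff is fixed first. Then the \<open>C1\<close> function is chosen so close to \<open>u\<close>, and so small on the sphere,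
  that the factor \<open>n\<close> in the estimate above is compensated. The products of the two are test functions that
  converge to \<open>u\<close>.
\<close>

theorem vanishing_trace_H10:
  fixes u :: "'a::euclidean_space \<Rightarrow> complex"
  assumes R: "R > 0" and dim: "DIM('a) \<ge> 2" and u: "u \<in> H1 R"
    and f: "\<And>m. f m \<in> C1"
    and fu: "(\<lambda>m. H1norm R (\<lambda>x. f m x - u x)) \<longlonglongrightarrow> 0"
    and ft: "(\<lambda>m. L2norm (sphere_measure R) (f m)) \<longlonglongrightarrow> 0"
  shows "u \<in> H10 R"
proof -
  define \<eta> where "\<eta> n = 2 * (L2norm (ball_measure R) (\<lambda>x. (1 - cutoff R (real n) x) * u x))\<^sup>2
    + (\<Sum>b\<in>Basis. 4 * (L2norm (ball_measure R) (\<lambda>x. (1 - cutoff R (real n) x) * wderiv R b u x))\<^sup>2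
        + 432 * (L2norm (ball_measure R) (\<lambda>x. shell R (real n) x * wderiv R b u x))\<^sup>2)" for n
  have cL: "(\<lambda>n. (L2norm (ball_measure R) (\<lambda>x. (1 - cutoff R (real n) x) * g x))\<^sup>2) \<longlonglongrightarrow> 0"
    and sL: "(\<lambda>n. (L2norm (ball_measure R) (\<lambda>x. shell R (real n) x * g x))\<^sup>2) \<longlonglongrightarrow> 0"
    if g: "g \<in> L2 (ball_measure R)" for g :: "'a \<Rightarrow> complex"
  proof -
    show "(\<lambda>n. (L2norm (ball_measure R) (\<lambda>x. shell R (real n) x * g x))\<^sup>2) \<longlonglongrightarrow> 0"
      by (rule integral_indicator_L2_tendsto_0[OF g])
        (auto intro!: borel_measurable_ball_measure shell_tendsto norm_shell_le simp: space_restrict_space)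
    show "(\<lambda>n. (L2norm (ball_measure R) (\<lambda>x. (1 - cutoff R (real n) x) * g x))\<^sup>2) \<longlonglongrightarrow> 0"
    proof (rule integral_indicator_L2_tendsto_0[OF g])
      show "(\<lambda>x. 1 - cutoff R (real n) x) \<in> borel_measurable (ball_measure R)" for n
        by (auto intro!: borel_measurable_ball_measure borel_measurable_continuous_onI C1_continuous C1_diff(1) cutoff_C1)
      show "norm (1 - cutoff R (real n) x) \<le> 1" for n x by (rule norm_one_minus_cutoff_le)
      fix x :: 'a assume "x \<in> space (ball_measure R)"
      then have "x \<in> ball 0 R" by (simp add: space_restrict_space)
      from tendsto_diff[OF tendsto_const cutoff_tendsto[OF this], of 1]
      show "(\<lambda>n. 1 - cutoff R (real n) x) \<longlonglongrightarrow> 0" by simp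
    qed
  qed
  have "\<eta> \<longlonglongrightarrow> 2 * 0 + (\<Sum>b\<in>(Basis::'a set). 4 * 0 + 432 * 0)"
    unfolding \<eta>_def by (intro tendsto_intros cL sL H1_L2 H1_wderiv(1) u)
  then have \<eta>: "\<eta> \<longlonglongrightarrow> 0" by simp
  have "\<exists>m. (H1norm R (\<lambda>x. f m x - u x))\<^sup>2 < 1 / real (Suc n) \<and> real (Suc n) * R * (L2norm (sphere_measure R) (f m))\<^sup>2 < 1 / real (Suc n)" for n
  proof -
    have "(\<lambda>m. (H1norm R (\<lambda>x. f m x - u x))\<^sup>2) \<longlonglongrightarrow> 0\<^sup>2" by (intro tendsto_power fu)
    then have 1: "\<forall>\<^sub>F m in sequentially. (H1norm R (\<lambda>x. f m x - u x))\<^sup>2 < 1 / real (Suc n)"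
      by (rule order_tendstoD) simp
    have "(\<lambda>m. real (Suc n) * R * (L2norm (sphere_measure R) (f m))\<^sup>2) \<longlonglongrightarrow> real (Suc n) * R * 0\<^sup>2"
      by (intro tendsto_intros ft)
    then have 2: "\<forall>\<^sub>F m in sequentially. real (Suc n) * R * (L2norm (sphere_measure R) (f m))\<^sup>2 < 1 / real (Suc n)"
      by (rule order_tendstoD) simp
    from eventually_happens[OF eventually_conj[OF 1 2]] show ?thesis by simp
  qed
  then obtain m where m: "\<And>n. (H1norm R (\<lambda>x. f (m n) x - u x))\<^sup>2 < 1 / real (Suc n)"
    "\<And>n. real (Suc n) * R * (L2norm (sphere_measure R) (f (m n)))\<^sup>2 < 1 / real (Suc n)" by metis
  define \<phi> where "\<phi> n x = cutoff R (real (Suc n)) x * f (m n) x" for n x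
  have \<phi>C: "\<phi> n \<in> C1_c R" for n
    unfolding \<phi>_def by (rule cutoff_mult_C1_c[OF f _ R]) simp
  have "(\<lambda>n. (H1norm R (\<lambda>x. \<phi> n x - u x))\<^sup>2) \<longlonglongrightarrow> 0"
  proof (rule Lim_null_comparison)
    show "\<forall>\<^sub>F n in sequentially. norm ((H1norm R (\<lambda>x. \<phi> n x - u x))\<^sup>2) \<le> 436 * (1 / real (Suc n)) + 144 * (1 / real (Suc n)) + \<eta> (Suc n)"
    proof (intro always_eventually allI)
      fix n
      have "(H1norm R (\<lambda>x. \<phi> n x - u x))\<^sup>2 \<le> 436 * (H1norm R (\<lambda>x. f (m n) x - u x))\<^sup>2
          + 144 * (real (Suc n) * R * (L2norm (sphere_measure R) (f (m n)))\<^sup>2) + \<eta> (Suc n)"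
        unfolding \<phi>_def \<eta>_def by (rule vanishing_trace_approximation[OF R dim _ u f]) simp
      also have "\<dots> \<le> 436 * (1 / real (Suc n)) + 144 * (1 / real (Suc n)) + \<eta> (Suc n)"
        by (intro add_mono mult_left_mono less_imp_le[OF m(1)] less_imp_le[OF m(2)] order_refl) auto
      finally show "norm ((H1norm R (\<lambda>x. \<phi> n x - u x))\<^sup>2) \<le> 436 * (1 / real (Suc n)) + 144 * (1 / real (Suc n)) + \<eta> (Suc n)"
        by simp
    qed
    have "(\<lambda>n. 436 * (1 / real (Suc n)) + 144 * (1 / real (Suc n)) + \<eta> (Suc n)) \<longlonglongrightarrow> 436 * 0 + 144 * 0 + 0"
      by (intro tendsto_add tendsto_mult tendsto_const LIMSEQ_Suc[OF \<eta>] LIMSEQ_Suc[OF lim_1_over_n])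
    then show "(\<lambda>n. 436 * (1 / real (Suc n)) + 144 * (1 / real (Suc n)) + \<eta> (Suc n)) \<longlonglongrightarrow> 0" by simp
  qed
  from tendsto_real_sqrt[OF this] have "(\<lambda>n. H1norm R (\<lambda>x. \<phi> n x - u x)) \<longlonglongrightarrow> 0"
    by (simp add: H1norm_nonneg)
  then show ?thesis unfolding H10_def using u \<phi>C by blast
qed

section \<open>The radial equation\<close>

text \<open>
  Integrating the equation \<open>(r\<^sup>m a')' = r\<^sup>m g a\<close> once, with \<open>a'\<close> bounded at the origin, expresses \<open>r\<^sup>m a'\<close> as
  this integral of \<open>a\<close>, and \<open>a'\<close> as the quotient \<open>slope\<close>.
\<close>

definition flux :: "nat \<Rightarrow> (real \<Rightarrow> real) \<Rightarrow> (real \<Rightarrow> real) \<Rightarrow> real \<Rightarrow> real" where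
  "flux m g \<alpha> t = (\<integral>s. indicat_real {0..t} s * (s ^ m * g s * \<alpha> s) \<partial>lborel)"

definition slope :: "nat \<Rightarrow> (real \<Rightarrow> real) \<Rightarrow> (real \<Rightarrow> real) \<Rightarrow> real \<Rightarrow> real" where
  "slope m g \<alpha> t = flux m g \<alpha> t / t ^ m"

context
  fixes g :: "real \<Rightarrow> real" and C :: real and m :: nat
  assumes g [measurable]: "g \<in> borel_measurable borel" and gC: "\<And>r. \<bar>g r\<bar> \<le> C" and m: "m \<ge> 1"
begin

lemma bound_nonneg: "C \<ge> 0"
  using gC[of 0] by linarith

lemma slope_0: "slope m g \<alpha> 0 = 0"
  using m by (simp add: slope_def power_0_left)

lemma flux_integrand_bound:
  assumes "0 \<le> t" and "\<And>s. 0 \<le> s \<Longrightarrow> s \<le> t \<Longrightarrow> \<bar>\<alpha> s\<bar> \<le> A s"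
  shows "\<bar>indicat_real {0..t} s * (s ^ m * g s * \<alpha> s)\<bar> \<le> indicat_real {0..t} s * (C * t ^ m * A s)"
proof (cases "s \<in> {0..t}")
  case True
  then have "\<bar>s ^ m\<bar> \<le> t ^ m" by (auto intro: power_mono)
  then have "\<bar>s ^ m\<bar> * \<bar>g s\<bar> * \<bar>\<alpha> s\<bar> \<le> t ^ m * C * A s"
    using assms True gC[of s] bound_nonneg by (intro mult_mono) auto
  then show ?thesis using True by (simp add: abs_mult mult_ac)
qed simp

lemma integrable_interval_continuous:
  assumes "continuous_on {a..b} (f :: real \<Rightarrow> real)"
  shows "integrable lborel (\<lambda>s. indicat_real {a..b} s * f s)"
  using borel_integrable_compact[of "{a..b}" f] assms by simp

lemma flux_integrable:
  assumes \<alpha>: "continuous_on UNIV \<alpha>"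
  shows "integrable lborel (\<lambda>s. indicat_real {0..t} s * (s ^ m * g s * \<alpha> s))"
proof (cases "t \<ge> 0")
  case True
  have [measurable]: "\<alpha> \<in> borel_measurable borel" using \<alpha> by (rule borel_measurable_continuous_onI)
  have "integrable lborel (\<lambda>s. indicat_real {0..t} s * (C * t ^ m * \<bar>\<alpha> s\<bar>))"
    by (intro integrable_interval_continuous continuous_intros continuous_on_subset[OF \<alpha>]) auto
  then show ?thesis
  proof (rule Bochner_Integration.integrable_bound)
    show "AE s in lborel. norm (indicat_real {0..t} s * (s ^ m * g s * \<alpha> s)) \<le> norm (indicat_real {0..t} s * (C * t ^ m * \<bar>\<alpha> s\<bar>))"
      unfolding real_norm_def
      by (intro AE_I2 order_trans[OF flux_integrand_bound[OF True] abs_ge_self]) simp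
  qed simp
qed simp

lemma flux_bound:
  assumes \<alpha>: "continuous_on UNIV \<alpha>" and t: "0 \<le> t"
    and A: "continuous_on {0..t} A" "\<And>s. 0 \<le> s \<Longrightarrow> s \<le> t \<Longrightarrow> \<bar>\<alpha> s\<bar> \<le> A s"
  shows "\<bar>flux m g \<alpha> t\<bar> \<le> C * t ^ m * (\<integral>s. indicat_real {0..t} s * A s \<partial>lborel)"
proof -
  have "\<bar>flux m g \<alpha> t\<bar> \<le> (\<integral>s. \<bar>indicat_real {0..t} s * (s ^ m * g s * \<alpha> s)\<bar> \<partial>lborel)"
    unfolding flux_def by (rule integral_abs_bound)
  also have "\<dots> \<le> (\<integral>s. indicat_real {0..t} s * (C * t ^ m * A s) \<partial>lborel)"
  proof (rule integral_mono)
    show "integrable lborel (\<lambda>s. \<bar>indicat_real {0..t} s * (s ^ m * g s * \<alpha> s)\<bar>)"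
      by (rule integrable_abs[OF flux_integrable[OF \<alpha>]])
    show "integrable lborel (\<lambda>s. indicat_real {0..t} s * (C * t ^ m * A s))"
      by (rule integrable_interval_continuous) (intro continuous_intros A(1))
    show "\<bar>indicat_real {0..t} s * (s ^ m * g s * \<alpha> s)\<bar> \<le> indicat_real {0..t} s * (C * t ^ m * A s)" for s
      using t A(2) by (rule flux_integrand_bound)
  qed
  also have "\<dots> = C * t ^ m * (\<integral>s. indicat_real {0..t} s * A s \<partial>lborel)"
    by (subst integral_mult_right_zero[symmetric]) (simp add: mult_ac)
  finally show ?thesis .
qed

lemma flux_bound_const:
  assumes \<alpha>: "continuous_on UNIV \<alpha>" and t: "0 \<le> t" and A: "\<And>s. 0 \<le> s \<Longrightarrow> s \<le> t \<Longrightarrow> \<bar>\<alpha> s\<bar> \<le> A"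
  shows "\<bar>flux m g \<alpha> t\<bar> \<le> C * t ^ m * (A * t)"
proof -
  have e: "(\<integral>s. indicat_real {0..t} s * A \<partial>lborel) = A * t" using t by simp
  show ?thesis using flux_bound[OF \<alpha> t continuous_on_const A] unfolding e .
qed

lemma slope_bound_const:
  assumes \<alpha>: "continuous_on UNIV \<alpha>" and t: "0 \<le> t" and A: "\<And>s. 0 \<le> s \<Longrightarrow> s \<le> t \<Longrightarrow> \<bar>\<alpha> s\<bar> \<le> A"
  shows "\<bar>slope m g \<alpha> t\<bar> \<le> C * A * t"
proof (cases "t = 0")
  case False
  then show ?thesis using flux_bound_const[OF assms] t by (simp add: slope_def abs_div field_simps)
qed (simp add: slope_0)

text \<open>
  Each of the two integrations in the equation gains a factor \<open>1 / K\<close> on functions that grow like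
  \<open>exp (K s)\<close>. For large \<open>K\<close> this makes the integral equation a contraction in a weighted norm.
\<close>

lemma slope_bound_exp:
  assumes \<alpha>: "continuous_on UNIV \<alpha>" and t: "0 \<le> t" and K: "K > 0"
    and A: "\<And>s. 0 \<le> s \<Longrightarrow> \<bar>\<alpha> s\<bar> \<le> M * exp (K * s)"
  shows "\<bar>slope m g \<alpha> t\<bar> \<le> C * M / K * exp (K * t)"
proof (cases "t = 0")
  case True
  have "0 \<le> M" using A[of 0] by simp
  then show ?thesis using True bound_nonneg K by (simp add: slope_0)
next
  case False
  have M: "0 \<le> M" using A[of 0] by simp
  have "(\<integral>s. (M * exp (K * s)) * indicat_real {0..t} s \<partial>lborel) = M / K * exp (K * t) - M / K * exp (K * 0)"
    by (rule integral_FTC_Icc_real) (use t K in \<open>auto intro!: derivative_eq_intros continuous_intros\<close>)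
  then have "(\<integral>s. indicat_real {0..t} s * (M * exp (K * s)) \<partial>lborel) \<le> M / K * exp (K * t)"
    using M K by (simp add: mult.commute)
  then have "C * t ^ m * (\<integral>s. indicat_real {0..t} s * (M * exp (K * s)) \<partial>lborel) \<le> C * t ^ m * (M / K * exp (K * t))"
    by (intro mult_left_mono) (use bound_nonneg t in auto)
  moreover have "\<bar>flux m g \<alpha> t\<bar> \<le> C * t ^ m * (\<integral>s. indicat_real {0..t} s * (M * exp (K * s)) \<partial>lborel)"
    by (rule flux_bound[OF \<alpha> t]) (auto intro!: continuous_intros A)
  ultimately have "\<bar>flux m g \<alpha> t\<bar> \<le> C * t ^ m * (M / K * exp (K * t))" by linarith
  then show ?thesis using False t by (simp add: slope_def abs_div field_simps)
qed

lemma flux_increment: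
  assumes \<alpha>: "continuous_on UNIV \<alpha>" and t: "0 \<le> t" "t \<le> t'" "t' \<le> L" and A: "\<And>s. 0 \<le> s \<Longrightarrow> s \<le> L \<Longrightarrow> \<bar>\<alpha> s\<bar> \<le> A"
  shows "\<bar>flux m g \<alpha> t' - flux m g \<alpha> t\<bar> \<le> C * L ^ m * A * (t' - t)"
proof -
  let ?f = "\<lambda>s. s ^ m * g s * \<alpha> s"
  have A0: "A \<ge> 0" using A[of 0] t by simp
  have eq: "flux m g \<alpha> t' - flux m g \<alpha> t = (\<integral>s. indicat_real {0..t'} s * ?f s - indicat_real {0..t} s * ?f s \<partial>lborel)"
    unfolding flux_def by (rule Bochner_Integration.integral_diff[OF flux_integrable[OF \<alpha>] flux_integrable[OF \<alpha>], symmetric])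
  have "\<bar>flux m g \<alpha> t' - flux m g \<alpha> t\<bar> \<le> (\<integral>s. \<bar>indicat_real {0..t'} s * ?f s - indicat_real {0..t} s * ?f s\<bar> \<partial>lborel)"
    unfolding eq by (rule integral_abs_bound)
  also have "\<dots> \<le> (\<integral>s. indicat_real {t..t'} s * (C * L ^ m * A) \<partial>lborel)"
  proof (rule integral_mono)
    show "integrable lborel (\<lambda>s. \<bar>indicat_real {0..t'} s * ?f s - indicat_real {0..t} s * ?f s\<bar>)"
      by (rule integrable_abs[OF Bochner_Integration.integrable_diff[OF flux_integrable[OF \<alpha>] flux_integrable[OF \<alpha>]]])
    show "integrable lborel (\<lambda>s. indicat_real {t..t'} s * (C * L ^ m * A))"
      by (intro integrable_interval_continuous continuous_intros)
    fix s
    show "\<bar>indicat_real {0..t'} s * ?f s - indicat_real {0..t} s * ?f s\<bar> \<le> indicat_real {t..t'} s * (C * L ^ m * A)"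
    proof (cases "s \<in> {t<..t'}")
      case True
      then have s: "0 \<le> s" "s \<le> L" using t by auto
      then have "\<bar>s ^ m\<bar> \<le> L ^ m" by (auto intro: power_mono)
      then have "\<bar>s ^ m\<bar> * \<bar>g s\<bar> * \<bar>\<alpha> s\<bar> \<le> L ^ m * C * A"
        using gC[of s] bound_nonneg A[OF s] s by (intro mult_mono) auto
      then show ?thesis using True t by (simp add: abs_mult mult_ac)
    next
      case False
      then have "indicat_real {0..t'} s = indicat_real {0..t} s" using t by (auto simp: indicator_def)
      moreover have "0 \<le> indicat_real {t..t'} s * (C * L ^ m * A)"
        using bound_nonneg A0 t by (auto simp: indicator_def)
      ultimately show ?thesis by simp
    qed
  qed
  also have "\<dots> = C * L ^ m * A * (t' - t)" using t by simp
  finally show ?thesis .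
qed

lemma continuous_bounded_Icc:
  assumes "continuous_on UNIV (\<alpha> :: real \<Rightarrow> real)"
  obtains A where "\<And>s. 0 \<le> s \<Longrightarrow> s \<le> L \<Longrightarrow> \<bar>\<alpha> s\<bar> \<le> A"
proof -
  have "bounded (\<alpha> ` {0..L})"
    by (intro compact_imp_bounded compact_continuous_image continuous_on_subset[OF assms]) auto
  then show ?thesis using that unfolding bounded_iff by (metis atLeastAtMost_iff image_eqI real_norm_def)
qed

lemma continuous_flux:
  assumes \<alpha>: "continuous_on UNIV \<alpha>"
  shows "continuous_on {0..L} (flux m g \<alpha>)"
proof -
  obtain A where A: "\<And>s. 0 \<le> s \<Longrightarrow> s \<le> L \<Longrightarrow> \<bar>\<alpha> s\<bar> \<le> A"
    using continuous_bounded_Icc[OF \<alpha>, of L] by blast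
  have "(max 0 (C * L ^ m * A))-lipschitz_on {0..L} (flux m g \<alpha>)"
  proof (rule lipschitz_onI)
    have *: "\<bar>flux m g \<alpha> y - flux m g \<alpha> x\<bar> \<le> max 0 (C * L ^ m * A) * (y - x)" if "0 \<le> x" "x \<le> y" "y \<le> L" for x y
      by (rule order_trans[OF flux_increment[OF \<alpha> that A]]) (use that in \<open>auto intro: mult_right_mono\<close>)
    show "dist (flux m g \<alpha> x) (flux m g \<alpha> y) \<le> max 0 (C * L ^ m * A) * dist x y" if "x \<in> {0..L}" "y \<in> {0..L}" for x y
    proof (cases "x \<le> y")
      case True
      then show ?thesis using *[of x y] that unfolding dist_commute[of "flux m g \<alpha> x"] dist_real_def by simp
    next
      case False
      then show ?thesis using *[of y x] that unfolding dist_real_def by simp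
    qed
  qed simp
  then show ?thesis by (rule lipschitz_on_continuous_on)
qed

lemma continuous_slope:
  assumes \<alpha>: "continuous_on UNIV \<alpha>"
  shows "continuous_on {0..L} (slope m g \<alpha>)"
  unfolding continuous_on_eq_continuous_within
proof
  fix x assume x: "x \<in> {0..L}"
  show "continuous (at x within {0..L}) (slope m g \<alpha>)"
  proof (cases "x = 0")
    case False
    then show ?thesis
      unfolding slope_def
      using continuous_flux[OF \<alpha>, of L] x
      by (auto intro!: continuous_intros simp: continuous_on_eq_continuous_within)
  next
    case True
    obtain A where A: "\<And>s. 0 \<le> s \<Longrightarrow> s \<le> L \<Longrightarrow> \<bar>\<alpha> s\<bar> \<le> A"
      using continuous_bounded_Icc[OF \<alpha>, of L] by blast
    have "(slope m g \<alpha> \<longlongrightarrow> 0) (at 0 within {0..L})"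
    proof (rule Lim_null_comparison)
      show "\<forall>\<^sub>F t in at 0 within {0..L}. norm (slope m g \<alpha> t) \<le> C * A * t"
        unfolding eventually_at_filter
        by (intro always_eventually allI impI) (auto intro!: slope_bound_const[OF \<alpha>] A)
      have "((\<lambda>t. C * A * t) \<longlongrightarrow> C * A * 0) (at 0 within {0..L})" by (intro tendsto_intros)
      then show "((\<lambda>t. C * A * t) \<longlongrightarrow> 0) (at 0 within {0..L})" by simp
    qed
    then show ?thesis using True by (simp add: continuous_within slope_0)
  qed
qed

lemma slope_diff:
  assumes "continuous_on UNIV \<alpha>" "continuous_on UNIV \<beta>"
  shows "slope m g (\<lambda>s. \<alpha> s - \<beta> s) t = slope m g \<alpha> t - slope m g \<beta> t"
proof -
  have "flux m g (\<lambda>s. \<alpha> s - \<beta> s) t = flux m g \<alpha> t - flux m g \<beta> t"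
    unfolding flux_def Bochner_Integration.integral_diff[OF flux_integrable[OF assms(1)] flux_integrable[OF assms(2)], symmetric]
    by (simp add: algebra_simps)
  then show ?thesis by (simp add: slope_def diff_divide_distrib)
qed

lemma integral_slope_bound_exp:
  assumes \<alpha>: "continuous_on UNIV \<alpha>" and r: "0 \<le> r" and K: "K > 0"
    and A: "\<And>s. 0 \<le> s \<Longrightarrow> \<bar>\<alpha> s\<bar> \<le> M * exp (K * s)"
  shows "\<bar>integral {0..r} (slope m g \<alpha>)\<bar> \<le> C * M / K\<^sup>2 * exp (K * r)"
proof -
  have M: "0 \<le> M" using A[of 0] by simp
  have 1: "((\<lambda>t. C * M / K * exp (K * t)) has_integral C * M / K\<^sup>2 * exp (K * r) - C * M / K\<^sup>2 * exp (K * 0)) {0..r}"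
    by (rule fundamental_theorem_of_calculus[OF r])
       (use K in \<open>auto intro!: derivative_eq_intros simp: has_real_derivative_iff_has_vector_derivative[symmetric] power2_eq_square\<close>)
  have "norm (integral {0..r} (slope m g \<alpha>)) \<le> integral {0..r} (\<lambda>t. C * M / K * exp (K * t))"
  proof (rule integral_norm_bound_integral)
    show "slope m g \<alpha> integrable_on {0..r}"
      using integrable_continuous_interval[OF continuous_slope[OF \<alpha>]] .
    show "(\<lambda>t. C * M / K * exp (K * t)) integrable_on {0..r}" using 1 by (rule has_integral_integrable)
    show "norm (slope m g \<alpha> t) \<le> C * M / K * exp (K * t)" if "t \<in> {0..r}" for t
      using slope_bound_exp[OF \<alpha> _ K A] that by simp
  qed
  also have "\<dots> \<le> C * M / K\<^sup>2 * exp (K * r)"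
    using integral_unique[OF 1] bound_nonneg M K by simp
  finally show ?thesis by simp
qed

text \<open>
  The integrated form of the radial equation with \<open>a(0) = 1\<close>. The unknown is \<open>exp (- K r) a(r)\<close> as an
  element of the space of bounded continuous functions on the line, extended by a constant to the left of
  the origin; with \<open>K = 2 C + 2\<close> the fixed point map has Lipschitz constant at most \<open>1 / 2\<close>.
\<close>

lemma radial_fixed_point:
  obtains a :: "real \<Rightarrow> real" where "continuous_on UNIV a" "\<And>r. r \<ge> 0 \<Longrightarrow> a r = 1 + integral {0..r} (slope m g a)"
proof -
  define K where "K = 2 * C + 2"
  have K: "K > 0" "C / K\<^sup>2 \<le> 1 / 2"
  proof -
    show "K > 0" using bound_nonneg by (simp add: K_def)
    moreover have "2 * C \<le> K\<^sup>2"
      using bound_nonneg mult_nonneg_nonneg[OF bound_nonneg bound_nonneg] by (simp add: K_def power2_eq_square algebra_simps)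
    ultimately show "C / K\<^sup>2 \<le> 1 / 2" by (simp add: divide_le_eq)
  qed
  define w :: "(real \<Rightarrow> real) \<Rightarrow> real \<Rightarrow> real" where "w \<phi> s = exp (K * s) * \<phi> s" for \<phi> s
  have wc: "continuous_on UNIV (w \<phi>)" if "continuous_on UNIV \<phi>" for \<phi>
    unfolding w_def by (intro continuous_intros that)
  define F where "F \<phi> r = exp (- K * max 0 r) * (1 + integral {0..max 0 r} (slope m g (w \<phi>)))" for \<phi> r
  have Ic: "continuous_on UNIV (\<lambda>r. integral {0..max 0 r} (slope m g (w \<phi>)))" if "continuous_on UNIV \<phi>" for \<phi>
  proof -
    have "continuous (at r) (\<lambda>r. integral {0..max 0 r} (slope m g (w \<phi>)))" for r
    proof -
      have "continuous_on {0..\<bar>r\<bar> + 1} (\<lambda>r. integral {0..r} (slope m g (w \<phi>)))"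
        by (intro indefinite_integral_continuous_1 integrable_continuous_interval continuous_slope wc that)
      then have "continuous_on {- \<bar>r\<bar> - 1<..<\<bar>r\<bar> + 1} (\<lambda>r. integral {0..max 0 r} (slope m g (w \<phi>)))"
        by (rule continuous_on_compose2) (auto intro!: continuous_intros)
      then show ?thesis by (rule continuous_on_interior) (auto simp: interior_open)
    qed
    then show ?thesis by (simp add: continuous_at_imp_continuous_on)
  qed
  have Fc: "continuous_on UNIV (F \<phi>)" if "continuous_on UNIV \<phi>" for \<phi>
    unfolding F_def by (intro continuous_intros Ic that)
  have Ib: "exp (- K * r) * \<bar>integral {0..r} (slope m g (w \<phi>))\<bar> \<le> M / 2"
    if "continuous_on UNIV \<phi>" "\<And>s. \<bar>\<phi> s\<bar> \<le> M" "r \<ge> 0" for \<phi> M r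
  proof -
    have M: "M \<ge> 0" using that(2)[of 0] by linarith
    have "\<bar>integral {0..r} (slope m g (w \<phi>))\<bar> \<le> C * M / K\<^sup>2 * exp (K * r)"
      by (rule integral_slope_bound_exp[OF wc[OF that(1)] that(3) K(1)])
         (use that(2) in \<open>simp add: w_def abs_mult mult.commute\<close>)
    then have "exp (- K * r) * \<bar>integral {0..r} (slope m g (w \<phi>))\<bar> \<le> exp (- K * r) * (C * M / K\<^sup>2 * exp (K * r))"
      by (intro mult_left_mono) auto
    also have "\<dots> = C / K\<^sup>2 * M" by (simp add: exp_minus field_simps)
    also have "\<dots> \<le> 1 / 2 * M" using K(2) M by (intro mult_right_mono)
    finally show ?thesis by simp
  qed
  have Fb: "\<bar>F \<phi> r\<bar> \<le> 1 + M / 2" if "continuous_on UNIV \<phi>" "\<And>s. \<bar>\<phi> s\<bar> \<le> M" for \<phi> M r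
  proof -
    let ?r = "max 0 r" and ?I = "integral {0..max 0 r} (slope m g (w \<phi>))"
    have "\<bar>F \<phi> r\<bar> = exp (- K * ?r) * \<bar>1 + ?I\<bar>" unfolding F_def by (simp add: abs_mult)
    also have "\<dots> \<le> exp (- K * ?r) * (1 + \<bar>?I\<bar>)" by (intro mult_left_mono) auto
    also have "\<dots> = exp (- K * ?r) + exp (- K * ?r) * \<bar>?I\<bar>" by (simp add: distrib_left)
    also have "\<dots> \<le> 1 + M / 2" using K by (intro add_mono Ib that) auto
    finally show ?thesis .
  qed
  define T where "T \<Phi> = Bcontfun (F (apply_bcontfun \<Phi>))" for \<Phi> :: "real \<Rightarrow>\<^sub>C real"
  have nb: "\<bar>apply_bcontfun \<Phi> s\<bar> \<le> norm \<Phi>" for \<Phi> :: "real \<Rightarrow>\<^sub>C real" and s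
    using norm_bounded[of \<Phi> s] by simp
  have T: "apply_bcontfun (T \<Phi>) = F (apply_bcontfun \<Phi>)" for \<Phi>
    unfolding T_def
    by (rule Bcontfun_inverse, rule bcontfun_normI[where b = "1 + norm \<Phi> / 2"])
       (auto intro!: Fc Fb nb)
  have "\<exists>!\<Phi>. T \<Phi> = \<Phi>"
  proof (rule banach_fix_type)
    show "0 \<le> (1/2 :: real)" "(1/2::real) < 1" by auto
    show "\<forall>\<Phi> \<Psi>. dist (T \<Phi>) (T \<Psi>) \<le> 1/2 * dist \<Phi> \<Psi>"
    proof (intro allI dist_bound)
      fix \<Phi> \<Psi> :: "real \<Rightarrow>\<^sub>C real" and r :: real
      let ?r = "max 0 r" and ?\<phi> = "apply_bcontfun \<Phi>" and ?\<psi> = "apply_bcontfun \<Psi>"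
      have c: "continuous_on UNIV ?\<phi>" "continuous_on UNIV ?\<psi>" by auto
      have wd: "w (\<lambda>s. ?\<phi> s - ?\<psi> s) = (\<lambda>s. w ?\<phi> s - w ?\<psi> s)" by (auto simp: w_def algebra_simps)
      have "integral {0..?r} (slope m g (w (\<lambda>s. ?\<phi> s - ?\<psi> s))) =
        integral {0..?r} (slope m g (w ?\<phi>)) - integral {0..?r} (slope m g (w ?\<psi>))"
        unfolding wd slope_diff[OF wc[OF c(1)] wc[OF c(2)], THEN ext]
        by (intro Henstock_Kurzweil_Integration.integral_diff integrable_continuous_interval continuous_slope wc c)
      then have "F ?\<phi> r - F ?\<psi> r = exp (- K * ?r) * integral {0..?r} (slope m g (w (\<lambda>s. ?\<phi> s - ?\<psi> s)))"
        unfolding F_def by (simp add: distrib_left right_diff_distrib)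
      then have "\<bar>F ?\<phi> r - F ?\<psi> r\<bar> = exp (- K * ?r) * \<bar>integral {0..?r} (slope m g (w (\<lambda>s. ?\<phi> s - ?\<psi> s)))\<bar>"
        by (simp add: abs_mult)
      also have "\<dots> \<le> dist \<Phi> \<Psi> / 2"
        by (rule Ib) (use dist_bounded[of \<Phi> _ \<Psi>] in \<open>auto intro!: continuous_intros simp: dist_real_def\<close>)
      finally show "dist (apply_bcontfun (T \<Phi>) r) (apply_bcontfun (T \<Psi>) r) \<le> 1/2 * dist \<Phi> \<Psi>"
        by (simp add: T dist_real_def)
    qed
  qed
  then obtain \<Phi> where \<Phi>: "T \<Phi> = \<Phi>" by blast
  define a where "a = w (apply_bcontfun \<Phi>)"
  have "a r = 1 + integral {0..r} (slope m g a)" if "r \<ge> 0" for r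
  proof -
    have "apply_bcontfun \<Phi> r = F (apply_bcontfun \<Phi>) r" using T[of \<Phi>] \<Phi> by simp
    then show ?thesis using that by (simp add: a_def[symmetric] F_def) (simp add: a_def w_def exp_minus field_simps)
  qed
  moreover have "continuous_on UNIV a" unfolding a_def by (intro wc) auto
  ultimately show ?thesis using that by blast
qed

end

text \<open>
  The linear bound on \<open>a'\<close> near the origin is what makes the radial function \<open>a(\<bar>x\<bar>)\<close> continuously
  differentiable there.
\<close>

lemma radial_solution:
  fixes g :: "real \<Rightarrow> real" and m :: nat
  assumes "g \<in> borel_measurable borel" "\<And>r. \<bar>g r\<bar> \<le> C" "m \<ge> 1"
  obtains a a' :: "real \<Rightarrow> real" where
    "continuous_on UNIV a" "a 0 = 1"
    "\<And>r. r > 0 \<Longrightarrow> (a has_real_derivative a' r) (at r)"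
    "continuous_on {0..} a'"
    "\<And>L. \<exists>B. \<forall>r\<in>{0..L}. \<bar>a' r\<bar> \<le> B * r"
    "\<And>r. r \<ge> 0 \<Longrightarrow> r ^ m * a' r = flux m g a r"
proof -
  obtain a where a: "continuous_on UNIV a" "\<And>r. r \<ge> 0 \<Longrightarrow> a r = 1 + integral {0..r} (slope m g a)"
    using radial_fixed_point[OF assms] by blast
  note c = continuous_slope[OF assms a(1)]
  show ?thesis
  proof (rule that[of a "slope m g a"])
    show "continuous_on UNIV a" by fact
    show "a 0 = 1" using a(2)[of 0] by simp
    show "(a has_real_derivative slope m g a r) (at r)" if "r > 0" for r
    proof -
      have "((\<lambda>x. 1 + integral {0..x} (slope m g a)) has_real_derivative 0 + slope m g a r) (at r within {0..r + 1})"
        by (intro DERIV_add DERIV_const integral_has_real_derivative c) (use that in auto)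
      then have "((\<lambda>x. 1 + integral {0..x} (slope m g a)) has_real_derivative slope m g a r) (at r)"
        using that by (simp add: at_within_interior[of r "{0..r+1}"])
      then show ?thesis
        by (rule has_field_derivative_transform_within_open[where S = "{0<..}"]) (use that a(2) in auto)
    qed
    show "continuous_on {0..} (slope m g a)"
      unfolding continuous_on_eq_continuous_within
    proof
      fix x :: real assume x: "x \<in> {0..}"
      have "continuous (at x within {0..x+1}) (slope m g a)"
        using c[of "x + 1"] x by (simp add: continuous_on_eq_continuous_within)
      moreover have "at x within {0..x+1} = at x within {0..}"
        by (rule at_within_nhd[of x "{..<x+1}"]) auto
      ultimately show "continuous (at x within {0..}) (slope m g a)" by (simp add: continuous_within)
    qed
    show "\<exists>B. \<forall>r\<in>{0..L}. \<bar>slope m g a r\<bar> \<le> B * r" for L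
    proof -
      obtain A where "\<And>s. 0 \<le> s \<Longrightarrow> s \<le> L \<Longrightarrow> \<bar>a s\<bar> \<le> A"
        using continuous_bounded_Icc[OF assms a(1), of L] by blast
      then show ?thesis using slope_bound_const[OF assms a(1)] by (intro exI[of _ "C * A"]) auto
    qed
    show "r ^ m * slope m g a r = flux m g a r" if "r \<ge> 0" for r
    proof (cases "r = 0")
      case True
      have "flux m g a 0 = 0" using flux_bound_const[OF assms a(1), of 0 "\<bar>a 0\<bar>"] by simp
      then show ?thesis using True assms(3) by simp
    qed (simp add: slope_def)
  qed
qed

section \<open>Radial functions times harmonic polynomials\<close>

lemma C1_radial:
  fixes a a' :: "real \<Rightarrow> real"
  assumes ac: "continuous_on UNIV a"
    and a: "\<And>r. r > 0 \<Longrightarrow> (a has_real_derivative a' r) (at r)"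
    and a'c: "continuous_on {0..} a'"
    and a'b: "\<And>r. 0 \<le> r \<Longrightarrow> r \<le> 1 \<Longrightarrow> \<bar>a' r\<bar> \<le> B * r"
  shows "(\<lambda>x::'a::euclidean_space. complex_of_real (a (norm x))) \<in> C1"
    and "partial_deriv b (\<lambda>x::'a. complex_of_real (a (norm x))) x = of_real (a' (norm x) * (b \<bullet> sgn x))"
proof -
  have a'0: "a' 0 = 0" using a'b[of 0] by simp
  have B: "0 \<le> B" using a'b[of 1] by simp
  have quad: "\<bar>a r - a 0\<bar> \<le> B * r\<^sup>2" if r: "0 \<le> r" "r \<le> 1" for r
  proof (cases "r = 0")
    case False
    then have r0: "0 < r" using r by simp
    obtain z where z: "0 < z" "z < r" "a r - a 0 = (r - 0) * a' z"
    proof -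
      have "\<exists>l z. 0 < z \<and> z < r \<and> (a has_real_derivative l) (at z) \<and> a r - a 0 = (r - 0) * l"
        by (rule MVT[OF r0]) (use ac a in \<open>auto intro: continuous_on_subset simp: real_differentiable_def\<close>)
      then obtain l z where lz: "0 < z" "z < r" "(a has_real_derivative l) (at z)" "a r - a 0 = (r - 0) * l" by blast
      then have "l = a' z" using a[of z] DERIV_unique by blast
      then show ?thesis using that lz by blast
    qed
    have "\<bar>a r - a 0\<bar> = r * \<bar>a' z\<bar>" using z r by (simp add: abs_mult)
    also have "\<dots> \<le> r * (B * r)"
    proof -
      have "\<bar>a' z\<bar> \<le> B * z" using z r by (intro a'b) auto
      also have "\<dots> \<le> B * r" using z B by (intro mult_left_mono) auto
      finally show ?thesis using r by (intro mult_left_mono)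
    qed
    finally show ?thesis by (simp add: power2_eq_square mult_ac)
  qed simp
  have D: "((\<lambda>x::'a. complex_of_real (a (norm x))) has_derivative (\<lambda>h. of_real (a' (norm x) * (h \<bullet> sgn x)))) (at x)" for x
  proof (cases "x = 0")
    case False
    have "((\<lambda>x. a (norm x)) has_derivative (\<lambda>h. a' (norm x) * (h \<bullet> sgn x))) (at x)"
      using has_derivative_compose[OF has_derivative_norm[OF False] a[unfolded has_field_derivative_def]] False by simp
    then show ?thesis by (rule has_derivative_of_real)
  next
    case True
    \<comment> \<open>At the origin the bound on \<open>a'\<close> makes \<open>a(\<bar>h\<bar>) - a(0)\<close> quadratically small.\<close>
    have "((\<lambda>h::'a. norm (complex_of_real (a (norm (0 + h))) - of_real (a (norm (0::'a))) - 0) / norm h) \<longlongrightarrow> 0) (at 0)"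
    proof (rule Lim_null_comparison)
      have "\<forall>\<^sub>F h::'a in at 0. norm h < 1" 
        using eventually_at[of "\<lambda>h::'a. norm h < 1" 0 UNIV] by (auto intro!: exI[of _ 1])
      then show "\<forall>\<^sub>F h::'a in at 0. norm (norm (complex_of_real (a (norm (0 + h))) - of_real (a (norm (0::'a))) - 0) / norm h) \<le> B * norm h"
      proof eventually_elim
        case (elim h)
        have "norm (complex_of_real (a (norm (0 + h))) - of_real (a (norm (0::'a))) - 0) = \<bar>a (norm h) - a 0\<bar>"
          by (simp flip: of_real_diff)
        also have "\<dots> \<le> B * (norm h)\<^sup>2" using quad[of "norm h"] elim by simp
        finally show ?case by (cases "h = 0") (auto simp: divide_le_eq power2_eq_square mult_ac)
      qed
      have "((\<lambda>h::'a. B * norm h) \<longlongrightarrow> B * norm (0::'a)) (at 0)" by (intro tendsto_intros)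
      then show "((\<lambda>h::'a. B * norm h) \<longlongrightarrow> 0) (at 0)" by simp
    qed
    then show ?thesis using True a'0 by (simp add: has_derivative_at)
  qed
  have Dc: "continuous_on UNIV (\<lambda>x::'a. complex_of_real (a' (norm x) * (b \<bullet> sgn x)))" for b
    unfolding continuous_on_eq_continuous_at[OF open_UNIV]
  proof
    fix x :: 'a
    show "isCont (\<lambda>x. complex_of_real (a' (norm x) * (b \<bullet> sgn x))) x"
    proof (cases "x = 0")
      case False
      have "continuous_on (- {0}) (\<lambda>x::'a. complex_of_real (a' (norm x) * (b \<bullet> sgn x)))"
        unfolding sgn_div_norm
        by (intro continuous_intros continuous_on_compose2[OF a'c]) auto
      then show ?thesis using False by (simp add: continuous_on_eq_continuous_at open_Compl)
    next
      case True
      have "((\<lambda>x::'a. complex_of_real (a' (norm x) * (b \<bullet> sgn x))) \<longlongrightarrow> 0) (at 0)"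
      proof (rule Lim_null_comparison)
        have "\<forall>\<^sub>F h::'a in at 0. norm h < 1" 
          using eventually_at[of "\<lambda>h::'a. norm h < 1" 0 UNIV] by (auto intro!: exI[of _ 1])
        then show "\<forall>\<^sub>F x::'a in at 0. norm (complex_of_real (a' (norm x) * (b \<bullet> sgn x))) \<le> B * norm x * norm b"
        proof eventually_elim
          case (elim x)
          have "\<bar>b \<bullet> sgn x\<bar> \<le> norm b * norm (sgn x)" by (rule Cauchy_Schwarz_ineq2)
          also have "\<dots> \<le> norm b" by (simp add: norm_sgn)
          finally have "\<bar>a' (norm x)\<bar> * \<bar>b \<bullet> sgn x\<bar> \<le> (B * norm x) * norm b"
            using a'b[of "norm x"] elim B by (intro mult_mono) auto
          then show ?case by (simp add: abs_mult norm_mult)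
        qed
        have "((\<lambda>x::'a. B * norm x * norm b) \<longlongrightarrow> B * norm (0::'a) * norm b) (at 0)" by (intro tendsto_intros)
        then show "((\<lambda>x::'a. B * norm x * norm b) \<longlongrightarrow> 0) (at 0)" by simp
      qed
      then show ?thesis using True by (simp add: isCont_def)
    qed
  qed
  show "(\<lambda>x::'a. complex_of_real (a (norm x))) \<in> C1" by (rule C1I(1)[OF D Dc])
  show "partial_deriv b (\<lambda>x::'a. complex_of_real (a (norm x))) x = of_real (a' (norm x) * (b \<bullet> sgn x))"
    by (rule partial_deriv_eq[OF D])
qed

text \<open>
  As \<open>\<beta>\<close> is only measurable, its integral \<open>b\<close> is not differentiated: the double integral of
  \<open>\<beta>(s) \<psi>'(r)\<close> over the triangle \<open>0 < s < r < R\<close> is evaluated in both orders. The function \<open>\<psi>\<close> may be singular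
  at the origin if \<open>\<beta>\<close> decays there; this is the purpose of the bound on the product.
\<close>

lemma ray_integration_by_parts:
  fixes \<beta> :: "real \<Rightarrow> real" and \<psi> \<psi>' :: "real \<Rightarrow> complex"
  assumes R: "R > 0" and \<beta> [measurable]: "\<beta> \<in> borel_measurable borel"
    and \<beta>b: "\<And>s. 0 < s \<Longrightarrow> s \<le> R \<Longrightarrow> \<bar>\<beta> s\<bar> \<le> B"
    and \<psi>: "\<And>r. r > 0 \<Longrightarrow> (\<psi> has_vector_derivative \<psi>' r) (at r)"
    and \<psi>'c: "continuous_on {0<..} \<psi>'"
    and K: "\<And>s r. 0 < s \<Longrightarrow> s \<le> r \<Longrightarrow> r \<le> R \<Longrightarrow> \<bar>\<beta> s\<bar> * norm (\<psi>' r) \<le> K"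
  defines "b \<equiv> \<lambda>t. \<integral>s. indicat_real {0..t} s * \<beta> s \<partial>lborel"
  shows "(\<integral>r. indicat_real {0<..<R} r *\<^sub>R (of_real (b r) * \<psi>' r + of_real (\<beta> r) * \<psi> r) \<partial>lborel) = of_real (b R) * \<psi> R"
proof -
  define p where "p r = indicat_real {0<..} r *\<^sub>R \<psi>' r" for r
  have [measurable]: "p \<in> borel_measurable borel"
    unfolding p_def by (rule borel_measurable_continuous_on_indicator[OF _ \<psi>'c]) simp
  define \<beta>1 where "\<beta>1 s = indicat_real {0<..<R} s * \<beta> s" for s
  have [measurable]: "\<beta>1 \<in> borel_measurable borel" unfolding \<beta>1_def by measurable
  \<comment> \<open>The indicator of the triangle is part of \<open>F\<close>, which makes it bounded with bounded support.\<close>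
  define F where "F s r = (if 0 < s \<and> s < r \<and> r < R then of_real (\<beta> s) * p r else 0)" for s r
  have K0: "K \<ge> 0" using K[of R R] R by (meson abs_ge_zero mult_nonneg_nonneg norm_ge_zero order_refl order_trans)
  have Fm: "(\<lambda>x. F (fst x) (snd x)) \<in> borel_measurable (lborel \<Otimes>\<^sub>M lborel)"
    unfolding F_def by measurable
  have Fint: "integrable (lborel \<Otimes>\<^sub>M lborel) (\<lambda>(s, r). F s r)"
  proof (rule Bochner_Integration.integrable_bound)
    show "integrable (lborel \<Otimes>\<^sub>M lborel) (\<lambda>x. indicat_real ({0..R} \<times> {0..R}) x *\<^sub>R K)"
    proof (intro integrable_scaleR_left integrable_real_indicator)
      have "emeasure (lborel \<Otimes>\<^sub>M lborel) ({0..R} \<times> {0..R}) = emeasure lborel {0..R} * emeasure lborel {0..R}"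
        by (rule lborel.emeasure_pair_measure_Times) auto
      then show "emeasure (lborel \<Otimes>\<^sub>M lborel) ({0..R} \<times> {0..R}) < \<infinity>"
        using R by (simp add: ennreal_mult_less_top)
    qed auto
    show "(\<lambda>(s, r). F s r) \<in> borel_measurable (lborel \<Otimes>\<^sub>M lborel)" using Fm by (simp add: case_prod_beta')
    show "AE x in lborel \<Otimes>\<^sub>M lborel. norm (case x of (s, r) \<Rightarrow> F s r) \<le> norm (indicat_real ({0..R} \<times> {0..R}) x *\<^sub>R K)"
      using K K0 by (intro AE_I2) (auto simp: F_def p_def norm_mult indicator_def split: if_splits)
  qed
  have \<beta>int: "integrable lborel \<beta>1"
  proof (rule Bochner_Integration.integrable_bound)
    show "integrable lborel (\<lambda>s. indicat_real {0..R} s *\<^sub>R \<bar>B\<bar>)"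
      by (intro integrable_scaleR_left integrable_real_indicator) (use R in simp_all)
    show "AE s in lborel. norm (\<beta>1 s) \<le> norm (indicat_real {0..R} s *\<^sub>R \<bar>B\<bar>)"
      using \<beta>b by (intro AE_I2) (force simp: \<beta>1_def indicator_def)
  qed simp
  have bR: "(\<integral>s. \<beta>1 s \<partial>lborel) = b R"
    unfolding b_def
  proof (rule integral_cong_AE)
    show "AE s in lborel. \<beta>1 s = indicat_real {0..R} s * \<beta> s"
      using AE_lborel_singleton[of 0] AE_lborel_singleton[of R] by eventually_elim (auto simp: \<beta>1_def indicator_def)
  qed auto
  have inner_s: "(\<integral>s. F s r \<partial>lborel) = indicat_real {0<..<R} r *\<^sub>R (of_real (b r) * \<psi>' r)" for r
  proof (cases "r \<in> {0<..<R}")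
    case True
    have "(\<integral>s. F s r \<partial>lborel) = (\<integral>s. of_real (indicat_real {0..r} s * \<beta> s) * p r \<partial>lborel)"
    proof (rule integral_cong_AE)
      show "AE s in lborel. F s r = of_real (indicat_real {0..r} s * \<beta> s) * p r"
        using AE_lborel_singleton[of 0] AE_lborel_singleton[of r] by eventually_elim (use True in \<open>auto simp: F_def indicator_def\<close>)
    qed (auto simp: F_def)
    also have "\<dots> = of_real (b r) * p r" unfolding b_def integral_mult_left_zero integral_complex_of_real ..
    finally show ?thesis using True by (simp add: p_def)
  next
    case False
    then have "F s r = 0" for s by (auto simp: F_def)
    then show ?thesis using False by simp
  qed
  have inner_r: "(\<integral>r. F s r \<partial>lborel) = of_real (\<beta>1 s) * (\<psi> R - \<psi> s)" for s
  proof (cases "s \<in> {0<..<R}")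
    case True
    have "(\<integral>r. F s r \<partial>lborel) = (\<integral>r. of_real (\<beta> s) * (indicat_real {s..R} r *\<^sub>R p r) \<partial>lborel)"
    proof (rule integral_cong_AE)
      show "AE r in lborel. F s r = of_real (\<beta> s) * (indicat_real {s..R} r *\<^sub>R p r)"
        using AE_lborel_singleton[of s] AE_lborel_singleton[of R] by eventually_elim (use True in \<open>auto simp: F_def indicator_def\<close>)
    qed (auto simp: F_def)
    also have "\<dots> = of_real (\<beta> s) * (\<integral>r. indicat_real {s..R} r *\<^sub>R p r \<partial>lborel)"
      by (rule integral_mult_right_zero)
    also have "(\<integral>r. indicat_real {s..R} r *\<^sub>R p r \<partial>lborel) = (\<integral>r. indicat_real {s..R} r *\<^sub>R \<psi>' r \<partial>lborel)"
      using True by (intro Bochner_Integration.integral_cong) (auto simp: p_def indicator_def)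
    also have "\<dots> = \<psi> R - \<psi> s"
    proof (rule integral_FTC_Icc)
      show "s \<le> R" using True by simp
      show "(\<psi> has_vector_derivative \<psi>' x) (at x within {s..R})" if "s \<le> x" for x
        by (rule has_vector_derivative_at_within[OF \<psi>]) (use True that in simp)
      show "continuous_on {s..R} \<psi>'" by (rule continuous_on_subset[OF \<psi>'c]) (use True in auto)
    qed
    finally show ?thesis using True by (simp add: \<beta>1_def)
  next
    case False
    then have "F s r = 0" for r by (auto simp: F_def)
    then show ?thesis using False by (simp add: \<beta>1_def)
  qed
  have i1: "integrable lborel (\<lambda>r. indicat_real {0<..<R} r *\<^sub>R (of_real (b r) * \<psi>' r))"
    using lborel_pair.integrable_snd[OF Fint] by (simp add: inner_s)
  have i2: "integrable lborel (\<lambda>s. of_real (\<beta>1 s) * (\<psi> R - \<psi> s))"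
    using lborel_pair.integrable_fst[OF Fint] by (simp add: inner_r)
  have i3: "integrable lborel (\<lambda>s. of_real (\<beta>1 s) * \<psi> R)"
    using \<beta>int by (intro integrable_mult_left integrable_of_real) auto
  have i4: "integrable lborel (\<lambda>s. of_real (\<beta>1 s) * \<psi> s)"
    using Bochner_Integration.integrable_diff[OF i3 i2] by (simp add: algebra_simps)
  have "(\<integral>r. indicat_real {0<..<R} r *\<^sub>R (of_real (b r) * \<psi>' r) \<partial>lborel) = (\<integral>r. \<integral>s. F s r \<partial>lborel \<partial>lborel)"
    by (simp add: inner_s)
  also have "\<dots> = (\<integral>s. \<integral>r. F s r \<partial>lborel \<partial>lborel)"
    by (rule lborel_pair.Fubini_integral[OF Fint])
  also have "\<dots> = (\<integral>s. of_real (\<beta>1 s) * \<psi> R - of_real (\<beta>1 s) * \<psi> s \<partial>lborel)"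
    by (simp add: inner_r right_diff_distrib)
  also have "\<dots> = of_real (b R) * \<psi> R - (\<integral>s. of_real (\<beta>1 s) * \<psi> s \<partial>lborel)"
    by (subst Bochner_Integration.integral_diff[OF i3 i4])
       (simp only: integral_mult_left_zero integral_complex_of_real bR)
  finally have "(\<integral>r. indicat_real {0<..<R} r *\<^sub>R (of_real (b r) * \<psi>' r) \<partial>lborel) + (\<integral>s. of_real (\<beta>1 s) * \<psi> s \<partial>lborel) = of_real (b R) * \<psi> R"
    by simp
  also have "(\<integral>r. indicat_real {0<..<R} r *\<^sub>R (of_real (b r) * \<psi>' r) \<partial>lborel) + (\<integral>s. of_real (\<beta>1 s) * \<psi> s \<partial>lborel)
     = (\<integral>r. indicat_real {0<..<R} r *\<^sub>R (of_real (b r) * \<psi>' r) + of_real (\<beta>1 r) * \<psi> r \<partial>lborel)"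
    by (rule Bochner_Integration.integral_add[OF i1 i4, symmetric])
  also have "(\<lambda>r. indicat_real {0<..<R} r *\<^sub>R (of_real (b r) * \<psi>' r) + of_real (\<beta>1 r) * \<psi> r) =
     (\<lambda>r. indicat_real {0<..<R} r *\<^sub>R (of_real (b r) * \<psi>' r + of_real (\<beta> r) * \<psi> r))"
    by (auto simp: \<beta>1_def indicator_def)
  finally show ?thesis .
qed

text \<open>
  Euler's identity: differentiate \<open>P (t x)\<close> at \<open>t = 1\<close>.
\<close>

lemma euler_homogeneous:
  fixes P :: "'a::euclidean_space \<Rightarrow> complex"
  assumes P: "P \<in> C1" and hom: "\<And>t x. P (t *\<^sub>R x) = of_real (t ^ k) * P x"
  shows "(\<Sum>b\<in>Basis. of_real (x \<bullet> b) * partial_deriv b P x) = of_nat k * P x"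
proof -
  have "((\<lambda>t. P ((t / 1) *\<^sub>R x)) has_vector_derivative of_real (1 / 1) * (\<Sum>b\<in>Basis. of_real (x \<bullet> b) * partial_deriv b P ((1 / 1) *\<^sub>R x))) (at 1)"
    by (rule C1_ray_vector_derivative[OF P]) simp
  then have 1: "((\<lambda>t. of_real (t ^ k) * P x) has_vector_derivative (\<Sum>b\<in>Basis. of_real (x \<bullet> b) * partial_deriv b P x)) (at 1)"
    by (simp add: hom)
  have "((\<lambda>t. t ^ k) has_real_derivative real k) (at 1)"
    by (auto intro!: derivative_eq_intros)
  from has_vector_derivative_mult[OF has_vector_derivative_of_real[OF this] has_vector_derivative_const[of "P x"]]
  have "((\<lambda>t. of_real (t ^ k) * P x) has_vector_derivative of_nat k * P x) (at 1)" by simp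
  with 1 show ?thesis by (rule vector_derivative_unique_at)
qed

lemma integrable_sphere_continuous:
  fixes f :: "'a::euclidean_space \<Rightarrow> 'b::{banach, second_countable_topology}"
  assumes R: "R > 0" and f: "continuous_on UNIV f"
  shows "integrable (sphere_measure R) f"
proof -
  obtain B where "\<And>x. x \<in> cball 0 R \<Longrightarrow> norm (f x) \<le> B"
    using continuous_bounded_ball[OF f, where R = R] by blast
  then show ?thesis
    using f by (intro finite_measure.integrable_const_bound[OF finite_sphere_measure[OF R], where B = B] AE_I2
        borel_measurable_sphere_measure borel_measurable_continuous_onI) auto
qed

text \<open>
  Along the ray through \<open>w\<close> the integrand is, up to a constant, the derivative of
  \<open>r ^ (k + d - 1) a'(r) \<phi>\<close>. That function is the product of \<open>r ^ m a'(r)\<close>, whose derivative \<open>r ^ m g a\<close> is given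
  by the radial equation, with \<open>\<phi> / r ^ k\<close>, which is singular at the origin.
\<close>

lemma radial_ray_integral:
  fixes \<phi> :: "'a::euclidean_space \<Rightarrow> complex" and w :: 'a
  assumes R: "R > 0" and m: "m = 2 * k + DIM('a) - 1" and dim: "DIM('a) \<ge> 2"
    and g: "g \<in> borel_measurable borel" "\<And>r. \<bar>g r\<bar> \<le> C"
    and ac: "continuous_on UNIV a" and fl: "\<And>r. r \<ge> 0 \<Longrightarrow> r ^ m * a' r = flux m g a r"
    and \<phi>: "\<phi> \<in> C1"
  defines "D \<equiv> \<lambda>r. of_real (1 / R) * (\<Sum>c\<in>Basis. of_real (w \<bullet> c) * partial_deriv c \<phi> ((r / R) *\<^sub>R w))"
  shows "(\<integral>r. indicat_real {0<..<R} r *\<^sub>R (of_real ((r / R) ^ (DIM('a) - 1) * (r / R) ^ k) *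
      (of_real (a' r) * (D r - of_real (real k / r) * \<phi> ((r / R) *\<^sub>R w)) + of_real (g r * a r) * \<phi> ((r / R) *\<^sub>R w))) \<partial>lborel)
      = of_real (a' R) * \<phi> w"
proof -
  \<comment> \<open>The constant left over from the two normalizations by \<open>R\<close> is \<open>1 / R ^ n\<close>, and \<open>m = n + k\<close>.\<close>
  define n where "n = k + DIM('a) - 1"
  have mn: "m = n + k" "n = (DIM('a) - 1) + k" "m \<ge> 1" "m \<ge> k + 1" using m dim by (auto simp: n_def)
  define f where "f r = \<phi> ((r / R) *\<^sub>R w)" for r
  define \<beta> where "\<beta> s = s ^ m * g s * a s" for s
  define \<psi> where "\<psi> r = of_real (1 / r ^ k) * f r" for r
  define \<psi>' where "\<psi>' r = of_real (1 / r ^ k) * D r + of_real (- (real k / r ^ Suc k)) * f r" for r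
  have fD: "(f has_vector_derivative D r) (at r)" for r
    unfolding f_def D_def by (rule C1_ray_vector_derivative[OF \<phi> R])
  have fc: "continuous_on T f" for T
    using has_vector_derivative_continuous[OF fD] by (simp add: continuous_at_imp_continuous_on)
  have Dc: "continuous_on T D" for T
    unfolding D_def
    by (intro continuous_intros continuous_on_compose2[OF C1_continuous_partial[OF \<phi>, of UNIV]]) (use R in auto)
  have [measurable]: "a \<in> borel_measurable borel" using ac by (rule borel_measurable_continuous_onI)
  note [measurable] = g(1)
  have \<psi>: "(\<psi> has_vector_derivative \<psi>' r) (at r)" if r: "r > 0" for r
  proof -
    have "((\<lambda>r. 1 / r ^ k) has_real_derivative - (real k / r ^ Suc k)) (at r)"
    proof (cases k)
      case (Suc j)
      have "((\<lambda>r. r ^ k) has_real_derivative real k * r ^ j) (at r)"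
        using DERIV_pow[of k r] Suc by simp
      then have "((\<lambda>r. inverse (r ^ k)) has_real_derivative - (inverse (r ^ k) * (real k * r ^ j) * inverse (r ^ k))) (at r)"
        by (rule DERIV_inverse') (use r in simp)
      moreover have "inverse (r ^ k) * (real k * r ^ j) * inverse (r ^ k) = real k / r ^ Suc k"
        using r by (simp add: Suc field_simps)
      ultimately show ?thesis by (simp add: inverse_eq_divide)
    qed (auto intro!: derivative_eq_intros)
    from has_vector_derivative_mult[OF has_vector_derivative_of_real[OF this] fD]
    show ?thesis unfolding \<psi>_def[abs_def] \<psi>'_def by simp
  qed
  have C0: "C \<ge> 0" using g(2)[of 0] by linarith
  obtain A where A: "\<And>s. 0 \<le> s \<Longrightarrow> s \<le> R \<Longrightarrow> \<bar>a s\<bar> \<le> A"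
    using continuous_bounded_Icc[OF g mn(3) ac, of R] by blast
  have A0: "A \<ge> 0" using A[of 0] R by simp
  have "bounded (f ` {0..R})" "bounded (D ` {0..R})"
    by (intro compact_imp_bounded compact_continuous_image fc Dc compact_Icc)+
  then obtain M N where M: "\<And>r. r \<in> {0..R} \<Longrightarrow> norm (f r) \<le> M" and N: "\<And>r. r \<in> {0..R} \<Longrightarrow> norm (D r) \<le> N"
    unfolding bounded_iff by (metis imageI)
  have M0: "M \<ge> 0" "N \<ge> 0" using M[of R] N[of R] R norm_ge_zero order_trans by (auto, blast+)
  have \<beta>r: "\<bar>\<beta> s\<bar> \<le> r ^ m * C * A" if "0 < s" "s \<le> r" "r \<le> R" for s r
    unfolding \<beta>_def abs_mult using that C0 A0
    by (intro mult_mono g(2) A) (auto intro: power_mono)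
  have pw: "r ^ m / r ^ j \<le> R ^ (m - j)" if "0 < r" "r \<le> R" "j \<le> m" for r and j
  proof -
    have "r ^ m / r ^ j = r ^ (m - j)" using that by (simp add: power_diff)
    also have "\<dots> \<le> R ^ (m - j)" using that by (intro power_mono) auto
    finally show ?thesis .
  qed
  have "(\<integral>r. indicat_real {0<..<R} r *\<^sub>R (of_real (\<integral>s. indicat_real {0..r} s * \<beta> s \<partial>lborel) * \<psi>' r + of_real (\<beta> r) * \<psi> r) \<partial>lborel)
      = of_real (\<integral>s. indicat_real {0..R} s * \<beta> s \<partial>lborel) * \<psi> R"
  proof (rule ray_integration_by_parts[OF R])
    show "\<beta> \<in> borel_measurable borel" unfolding \<beta>_def by measurable
    show "\<bar>\<beta> s\<bar> \<le> R ^ m * C * A" if "0 < s" "s \<le> R" for s using \<beta>r[OF that] by simp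
    show "continuous_on {0<..} \<psi>'"
      unfolding \<psi>'_def by (intro continuous_intros fc Dc) auto
    show "\<bar>\<beta> s\<bar> * norm (\<psi>' r) \<le> C * A * (R ^ (m - k) * N + R ^ (m - Suc k) * (real k * M))" if sr: "0 < s" "s \<le> r" "r \<le> R" for s r
    proof -
      have r: "0 < r" using sr by simp
      have "norm (\<psi>' r) \<le> norm (of_real (1 / r ^ k) * D r) + norm (of_real (- (real k / r ^ Suc k)) * f r)"
        unfolding \<psi>'_def by (rule norm_triangle_ineq)
      also have "\<dots> = 1 / r ^ k * norm (D r) + real k / r ^ Suc k * norm (f r)"
        using r by (simp only: norm_mult norm_of_real) (simp add: abs_div)
      also have "\<dots> \<le> 1 / r ^ k * N + real k / r ^ Suc k * M"
        using r sr by (intro add_mono mult_left_mono M N) auto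
      finally have "\<bar>\<beta> s\<bar> * norm (\<psi>' r) \<le> (r ^ m * C * A) * (1 / r ^ k * N + real k / r ^ Suc k * M)"
        using C0 A0 r by (intro mult_mono \<beta>r[OF sr]) auto
      also have "\<dots> = C * A * ((r ^ m / r ^ k) * N + (r ^ m / r ^ Suc k) * (real k * M))"
        using r by (simp add: field_simps)
      also have "\<dots> \<le> C * A * (R ^ (m - k) * N + R ^ (m - Suc k) * (real k * M))"
        using C0 A0 M0 r sr mn by (intro mult_left_mono add_mono mult_right_mono pw) auto
      finally show ?thesis .
    qed
  qed (rule \<psi>)
  then have main: "(\<integral>r. indicat_real {0<..<R} r *\<^sub>R (of_real (flux m g a r) * \<psi>' r + of_real (\<beta> r) * \<psi> r) \<partial>lborel)
      = of_real (flux m g a R) * \<psi> R"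
    unfolding flux_def \<beta>_def .
  have pt: "indicat_real {0<..<R} r *\<^sub>R (of_real ((r / R) ^ (DIM('a) - 1) * (r / R) ^ k) *
      (of_real (a' r) * (D r - of_real (real k / r) * f r) + of_real (g r * a r) * f r))
      = of_real (1 / R ^ n) * (indicat_real {0<..<R} r *\<^sub>R (of_real (flux m g a r) * \<psi>' r + of_real (\<beta> r) * \<psi> r))" for r
  proof (cases "r \<in> {0<..<R}")
    case True
    then have r: "0 < r" "r \<noteq> 0" by auto
    have e1: "(r / R) ^ (DIM('a) - 1) * (r / R) ^ k = 1 / R ^ n * r ^ n"
      unfolding mn(2) power_add power_divide by simp
    have e2: "flux m g a r * (1 / r ^ k) = r ^ n * a' r"
      using fl[of r] r by (simp add: mn(1) power_add field_simps)
    have e3: "flux m g a r * (- (real k / r ^ Suc k)) = - (r ^ n * a' r * (real k / r))"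
      using fl[of r] r by (simp add: mn(1) power_add field_simps)
    have e4: "\<beta> r * (1 / r ^ k) = r ^ n * (g r * a r)"
      using r by (simp add: \<beta>_def mn(1) power_add field_simps)
    have "of_real (flux m g a r) * \<psi>' r + of_real (\<beta> r) * \<psi> r =
      of_real (flux m g a r * (1 / r ^ k)) * D r + of_real (flux m g a r * (- (real k / r ^ Suc k))) * f r + of_real (\<beta> r * (1 / r ^ k)) * f r"
      unfolding \<psi>'_def \<psi>_def of_real_mult by (simp only: distrib_left mult.assoc)
    also have "\<dots> = of_real (r ^ n) * (of_real (a' r) * (D r - of_real (real k / r) * f r) + of_real (g r * a r) * f r)"
      unfolding e2 e3 e4 by (simp add: algebra_simps)
    finally show ?thesis using True unfolding e1 of_real_mult by simp
  qed simp
  have "R ^ m = R ^ n * R ^ k" by (simp add: mn(1) power_add)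
  then have "of_real (1 / R ^ n) * (of_real (flux m g a R) * \<psi> R) = of_real (a' R) * f R"
    using fl[of R, symmetric] R by (simp add: \<psi>_def)
  then show ?thesis
    using main unfolding f_def[symmetric] pt integral_mult_right_zero using R by (simp add: f_def)
qed

text \<open>
  Green's formula for \<open>v = A P\<close> with \<open>A = a(\<bar>x\<bar>)\<close>. In general \<open>v\<close> has no continuous second derivatives,
  so the part that comes from \<open>P\<close> is separated from the radial part:
  \<open>\<nabla>v \<bullet> \<nabla>\<phi> = \<nabla>P \<bullet> \<nabla>(A \<phi>) + (P \<nabla>A \<bullet> \<nabla>\<phi> - \<phi> \<nabla>A \<bullet> \<nabla>P)\<close>.
  As \<open>P\<close> is harmonic, the first term is the divergence of \<open>A \<phi> \<nabla>P\<close>, and its flux is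
  \<open>(k / R) a(R) P \<phi>\<close> by Euler's identity. The bracket involves radial derivatives only; together with
  \<open>q v \<phi>\<close> it is integrated ray by ray and contributes \<open>a'(R) P \<phi>\<close>.
\<close>

theorem radial_times_harmonic_weak_equation:
  fixes P \<phi> :: "'a::euclidean_space \<Rightarrow> complex"
  assumes R: "R > 0" and dim: "DIM('a) \<ge> 2" and m: "m = 2 * k + DIM('a) - 1"
    and P: "polynomial_function P" "\<And>t x. P (t *\<^sub>R x) = of_real (t ^ k) * P x" "\<And>x. laplacian P x = 0"
    and g: "g \<in> borel_measurable borel" "\<And>r. \<bar>g r\<bar> \<le> C"
    and q: "q \<in> Linfty (ball_measure R)" "AE x in ball_measure R. q x = g (norm x)"
    and a: "continuous_on UNIV a" "\<And>r. r > 0 \<Longrightarrow> (a has_real_derivative a' r) (at r)"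
      "continuous_on {0..} a'" "\<And>L. \<exists>B. \<forall>r\<in>{0..L}. \<bar>a' r\<bar> \<le> B * r"
      "\<And>r. r \<ge> 0 \<Longrightarrow> r ^ m * a' r = flux m g a r"
    and \<phi>: "\<phi> \<in> C1"
  shows "(\<lambda>x. of_real (a (norm x)) * P x) \<in> C1"
    and "schroedinger_form R q (\<lambda>x. of_real (a (norm x)) * P x) \<phi> =
      of_real (a' R + real k / R * a R) * (\<integral>w. P w * \<phi> w \<partial>sphere_measure R)"
proof -
  define A :: "'a \<Rightarrow> complex" where "A x = of_real (a (norm x))" for x
  obtain B where "\<forall>r\<in>{0..1}. \<bar>a' r\<bar> \<le> B * r" using a(4)[of 1] by blast
  then have B: "\<And>r. 0 \<le> r \<Longrightarrow> r \<le> 1 \<Longrightarrow> \<bar>a' r\<bar> \<le> B * r" by simp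
  note AC = C1_radial[OF a(1-3) B, where 'a = 'a, folded A_def]
  have A: "A \<in> C1" and dA: "partial_deriv b A x = of_real (a' (norm x) * (b \<bullet> sgn x))" for b x
    using AC by (auto simp: A_def[abs_def])
  note PC = polynomial_function_C1(1)[OF P(1)]
  have dPC: "partial_deriv b P \<in> C1" for b by (rule polynomial_function_C1(1)[OF polynomial_function_C1(2)[OF P(1)]])
  show v: "(\<lambda>x. of_real (a (norm x)) * P x) \<in> C1"
    using C1_mult(1)[OF A PC] by (simp add: A_def[abs_def])
  note euler = euler_homogeneous[OF PC P(2)]
  have lap: "(\<Sum>b\<in>Basis. partial_deriv b (partial_deriv b P) x) = 0" for x
    using P(3)[of x] by (simp add: laplacian_def)
  have \<phi>c: "continuous_on T \<phi>" "continuous_on T (partial_deriv b \<phi>)" for T b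
    by (rule C1_continuous[OF \<phi>], rule C1_continuous_partial[OF \<phi>])
  have Pc: "continuous_on T P" "continuous_on T (partial_deriv b P)" for T b
    by (rule C1_continuous[OF PC], rule C1_continuous_partial[OF PC])
  have Ac: "continuous_on T A" "continuous_on T (partial_deriv b A)" for T b
    by (rule C1_continuous[OF A], rule C1_continuous_partial[OF A])
  have FC: "(\<lambda>x. partial_deriv b P x * (A x * \<phi> x)) \<in> C1" for b
    by (intro C1_mult(1) dPC A \<phi>)
  define h1 where "h1 x = (\<Sum>b\<in>Basis. partial_deriv b (\<lambda>x. partial_deriv b P x * (A x * \<phi> x)) x)" for x
  define c2 where "c2 x = (\<Sum>b\<in>Basis. P x * partial_deriv b A x * partial_deriv b \<phi> x - partial_deriv b P x * \<phi> x * partial_deriv b A x)" for x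
  define h2 where "h2 x = c2 x + of_real (g (norm x)) * (A x * P x * \<phi> x)" for x
  have c2c: "continuous_on UNIV c2" unfolding c2_def by (intro continuous_intros Pc Ac \<phi>c)
  have pc: "continuous_on UNIV (\<lambda>x. A x * P x * \<phi> x)" by (intro continuous_intros Pc Ac \<phi>c)
  note [measurable] = g(1) borel_measurable_continuous_onI[OF c2c] borel_measurable_continuous_onI[OF pc]
  have h2m: "h2 \<in> borel_measurable borel" unfolding h2_def by measurable
  have h1i: "integrable (ball_measure R) h1" unfolding h1_def
    by (intro Bochner_Integration.integrable_sum integrable_ball_continuous C1_continuous_partial FC)
  have h2i: "integrable (ball_measure R) h2"
  proof -
    obtain M where M: "M > 0" "\<And>x. x \<in> cball 0 R \<Longrightarrow> norm (A x * P x * \<phi> x) \<le> M"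
      using continuous_bounded_ball[OF pc, where R = R] by blast
    have "integrable (ball_measure R) (\<lambda>x. of_real (g (norm x)) * (A x * P x * \<phi> x))"
    proof (rule integrable_ball_bounded[where B = "C * M"])
      show "(\<lambda>x. of_real (g (norm x)) * (A x * P x * \<phi> x)) \<in> borel_measurable (ball_measure R)"
        by (rule borel_measurable_ball_measure) measurable
      show "AE x in ball_measure R. norm (of_real (g (norm x)) * (A x * P x * \<phi> x)) \<le> C * M"
      proof (rule AE_I2)
        fix x :: 'a assume "x \<in> space (ball_measure R)"
        then have "norm (A x * P x * \<phi> x) \<le> M" by (intro M(2)) (simp add: space_restrict_space)
        moreover have "0 \<le> C" using g(2)[of 0] by linarith
        ultimately show "norm (of_real (g (norm x)) * (A x * P x * \<phi> x)) \<le> C * M"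
          unfolding norm_mult[of "of_real (g (norm x))"] norm_of_real by (intro mult_mono g(2)) auto
      qed
    qed
    then show ?thesis unfolding h2_def
      by (rule Bochner_Integration.integrable_add[OF integrable_ball_continuous[OF c2c]])
  qed
  have pointwise: "(\<Sum>b\<in>Basis. partial_deriv b (\<lambda>x. A x * P x) x * partial_deriv b \<phi> x) + of_real (g (norm x)) * (A x * P x) * \<phi> x
     = h1 x + h2 x" for x
  proof -
    have "h1 x = (\<Sum>b\<in>Basis. partial_deriv b P x * (A x * partial_deriv b \<phi> x + partial_deriv b A x * \<phi> x)
        + partial_deriv b (partial_deriv b P) x * (A x * \<phi> x))"
      unfolding h1_def by (simp add: C1_mult(2)[OF dPC C1_mult(1)[OF A \<phi>]] C1_mult(2)[OF A \<phi>])
    also have "\<dots> = (\<Sum>b\<in>Basis. partial_deriv b P x * (A x * partial_deriv b \<phi> x + partial_deriv b A x * \<phi> x))"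
      by (simp add: sum.distrib sum_distrib_right[symmetric] lap)
    finally have "h1 x + c2 x = (\<Sum>b\<in>Basis. partial_deriv b P x * (A x * partial_deriv b \<phi> x + partial_deriv b A x * \<phi> x)
      + (P x * partial_deriv b A x * partial_deriv b \<phi> x - partial_deriv b P x * \<phi> x * partial_deriv b A x))"
      by (simp add: c2_def sum.distrib)
    also have "\<dots> = (\<Sum>b\<in>Basis. partial_deriv b (\<lambda>x. A x * P x) x * partial_deriv b \<phi> x)"
      by (intro sum.cong refl) (simp add: C1_mult(2)[OF A PC] algebra_simps)
    finally show ?thesis by (simp add: h2_def)
  qed
  have "schroedinger_form R q (\<lambda>x. A x * P x) \<phi> = (\<integral>x. h1 x + h2 x \<partial>ball_measure R)"
  proof -
    have qm: "q \<in> borel_measurable (ball_measure R)" using q(1) by (simp add: Linfty_def)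
    have APC: "(\<lambda>x. A x * P x) \<in> C1" by (rule C1_mult(1)[OF A PC])
    have ms: "partial_deriv b (\<lambda>x. A x * P x) \<in> borel_measurable (ball_measure R)"
      "partial_deriv b \<phi> \<in> borel_measurable (ball_measure R)" "\<phi> \<in> borel_measurable (ball_measure R)"
      "A \<in> borel_measurable (ball_measure R)" "P \<in> borel_measurable (ball_measure R)" for b
      by (intro borel_measurable_ball_measure borel_measurable_continuous_onI C1_continuous_partial[OF APC] Ac Pc \<phi>c)+
    show ?thesis unfolding schroedinger_form_C1[OF R q(1) APC \<phi>]
    proof (rule integral_cong_AE)
      show "(\<lambda>x. (\<Sum>b\<in>Basis. partial_deriv b (\<lambda>x. A x * P x) x * partial_deriv b \<phi> x) + of_real (q x) * (A x * P x) * \<phi> x) \<in> borel_measurable (ball_measure R)"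
        using ms by (intro borel_measurable_add borel_measurable_sum borel_measurable_times)
          (auto intro!: measurable_compose[OF qm])
      show "(\<lambda>x. h1 x + h2 x) \<in> borel_measurable (ball_measure R)"
        using h1i h2i by (intro borel_measurable_add borel_measurable_integrable)
      show "AE x in ball_measure R. (\<Sum>b\<in>Basis. partial_deriv b (\<lambda>x. A x * P x) x * partial_deriv b \<phi> x) + of_real (q x) * (A x * P x) * \<phi> x = h1 x + h2 x"
        using q(2) by eventually_elim (simp only: pointwise[symmetric])
    qed
  qed
  also have "\<dots> = (\<integral>x. h1 x \<partial>ball_measure R) + (\<integral>x. h2 x \<partial>ball_measure R)"
    by (rule Bochner_Integration.integral_add[OF h1i h2i])
  also have "(\<integral>x. h1 x \<partial>ball_measure R) = (\<integral>w. of_real (real k / R * a R) * (P w * \<phi> w) \<partial>sphere_measure R)"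
  proof -
    have "(\<integral>x. h1 x \<partial>ball_measure R) = (\<Sum>b\<in>Basis. \<integral>x. partial_deriv b (\<lambda>x. partial_deriv b P x * (A x * \<phi> x)) x \<partial>ball_measure R)"
      unfolding h1_def by (intro Bochner_Integration.integral_sum integrable_ball_continuous C1_continuous_partial FC)
    also have "\<dots> = (\<Sum>b\<in>Basis. \<integral>w. of_real ((w \<bullet> b) / R) * (partial_deriv b P w * (A w * \<phi> w)) \<partial>sphere_measure R)"
      by (intro sum.cong refl integral_partial_deriv_ball FC R dim)
    also have "\<dots> = (\<integral>w. (\<Sum>b\<in>Basis. of_real ((w \<bullet> b) / R) * (partial_deriv b P w * (A w * \<phi> w))) \<partial>sphere_measure R)"
      by (intro Bochner_Integration.integral_sum[symmetric] integrable_sphere_continuous[OF R] continuous_on_mult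
          Pc Ac \<phi>c continuous_intros) (use R in auto)
    also have "\<dots> = (\<integral>w. of_real (real k / R * a R) * (P w * \<phi> w) \<partial>sphere_measure R)"
    proof (intro Bochner_Integration.integral_cong refl)
      fix w :: 'a assume "w \<in> space (sphere_measure R)"
      then have w: "A w = of_real (a R)" by (simp add: A_def)
      have "(\<Sum>b\<in>Basis. of_real ((w \<bullet> b) / R) * (partial_deriv b P w * (A w * \<phi> w))) =
         (\<Sum>b\<in>Basis. of_real (w \<bullet> b) * partial_deriv b P w) * (of_real (1 / R) * (A w * \<phi> w))"
        unfolding sum_distrib_right by (intro sum.cong refl) simp
      also have "\<dots> = of_real (real k / R * a R) * (P w * \<phi> w)" unfolding euler w by simp
      finally show "(\<Sum>b\<in>Basis. of_real ((w \<bullet> b) / R) * (partial_deriv b P w * (A w * \<phi> w))) = of_real (real k / R * a R) * (P w * \<phi> w)" .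
    qed
    finally show ?thesis .
  qed
  also have "(\<integral>x. h2 x \<partial>ball_measure R) = (\<integral>w. of_real (a' R) * (P w * \<phi> w) \<partial>sphere_measure R)"
    unfolding polar_integral[OF R h2m h2i]
  proof (intro Bochner_Integration.integral_cong refl)
    fix w :: 'a assume "w \<in> space (sphere_measure R)"
    then have w: "norm w = R" by simp
    let ?D = "\<lambda>r. of_real (1 / R) * (\<Sum>c\<in>Basis. of_real (w \<bullet> c) * partial_deriv c \<phi> ((r / R) *\<^sub>R w))"
    have pt: "(indicat_real {0<..<R} r * (r / R) ^ (DIM('a) - 1)) *\<^sub>R h2 ((r / R) *\<^sub>R w) =
      P w * (indicat_real {0<..<R} r *\<^sub>R (of_real ((r / R) ^ (DIM('a) - 1) * (r / R) ^ k) *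
      (of_real (a' r) * (?D r - of_real (real k / r) * \<phi> ((r / R) *\<^sub>R w)) + of_real (g r * a r) * \<phi> ((r / R) *\<^sub>R w))))" for r
    proof (cases "r \<in> {0<..<R}")
      case True
      define x where "x = (r / R) *\<^sub>R w"
      have nx: "norm x = r" using True w R by (simp add: x_def)
      have sx: "sgn x = (1 / R) *\<^sub>R w" "sgn x = (1 / r) *\<^sub>R x" using True R nx by (auto simp: sgn_div_norm x_def)
      have Px: "P x = of_real ((r / R) ^ k) * P w" by (simp add: x_def P(2))
      have 1: "(\<Sum>b\<in>Basis. partial_deriv b A x * partial_deriv b \<phi> x) = of_real (a' r) * ?D r"
        unfolding dA nx sx(1) x_def[symmetric] sum_distrib_left by (intro sum.cong refl) (simp add: inner_commute)
      have "(\<Sum>b\<in>Basis. partial_deriv b P x * partial_deriv b A x) = of_real (a' r) * (of_real (1 / r) * (\<Sum>b\<in>Basis. of_real (x \<bullet> b) * partial_deriv b P x))"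
        unfolding dA nx sx(2) sum_distrib_left by (intro sum.cong refl) (simp add: inner_commute)
      then have 2: "(\<Sum>b\<in>Basis. partial_deriv b P x * partial_deriv b A x) = of_real (a' r) * (of_real (real k / r) * P x)"
        unfolding euler by simp
      have "c2 x = P x * (\<Sum>b\<in>Basis. partial_deriv b A x * partial_deriv b \<phi> x) - \<phi> x * (\<Sum>b\<in>Basis. partial_deriv b P x * partial_deriv b A x)"
        unfolding c2_def sum_subtractf sum_distrib_left by (simp add: mult_ac)
      also have "\<dots> = P x * (of_real (a' r) * (?D r - of_real (real k / r) * \<phi> x))"
        unfolding 1 2 by (simp only: right_diff_distrib mult_ac)
      finally have "h2 x = P x * (of_real (a' r) * (?D r - of_real (real k / r) * \<phi> x) + of_real (g r * a r) * \<phi> x)"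
        unfolding h2_def nx A_def of_real_mult by (simp only: distrib_left mult_ac)
      then show ?thesis using True unfolding x_def[symmetric] Px by (simp add: scaleR_conv_of_real)
    qed simp
    have "(\<integral>r. (indicat_real {0<..<R} r * (r / R) ^ (DIM('a) - 1)) *\<^sub>R h2 ((r / R) *\<^sub>R w) \<partial>lborel) = P w * (of_real (a' R) * \<phi> w)"
      unfolding pt integral_mult_right_zero
      by (rule arg_cong[where f = "\<lambda>t. P w * t"]) (rule radial_ray_integral[OF R m dim g a(1) a(5) \<phi>])
    then show "(\<integral>r. (indicat_real {0<..<R} r * (r / R) ^ (DIM('a) - 1)) *\<^sub>R h2 ((r / R) *\<^sub>R w) \<partial>lborel) = of_real (a' R) * (P w * \<phi> w)"
      by (simp only: mult_ac)
  qed
  finally show "schroedinger_form R q (\<lambda>x. of_real (a (norm x)) * P x) \<phi> =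
      of_real (a' R + real k / R * a R) * (\<integral>w. P w * \<phi> w \<partial>sphere_measure R)"
    unfolding A_def integral_mult_right_zero by (simp add: distrib_right)
qed

section \<open>The Dirichlet to Neumann map\<close>

definition homogeneous_harmonic :: "nat \<Rightarrow> ('a::euclidean_space \<Rightarrow> complex) \<Rightarrow> bool" where
  "homogeneous_harmonic k P \<longleftrightarrow> polynomial_function P \<and> (\<forall>t x. P (t *\<^sub>R x) = of_real (t ^ k) * P x) \<and> (\<forall>x. laplacian P x = 0)"

lemma homogeneous_harmonicD:
  assumes "homogeneous_harmonic k P"
  shows "polynomial_function P" "P (t *\<^sub>R x) = of_real (t ^ k) * P x" "laplacian P x = 0"
  using assms by (auto simp: homogeneous_harmonic_def)

text \<open>
  With two coordinates \<open>x\<^sub>1\<close> and \<open>x\<^sub>2\<close>, the polynomial \<open>(x\<^sub>1 + \<i> x\<^sub>2) ^ k\<close> is harmonic because \<open>1 + \<i>\<^sup>2 = 0\<close>, and its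
  zeros lie in a hyperplane.
\<close>

lemma homogeneous_harmonic_exists:
  assumes dim: "DIM('a::euclidean_space) \<ge> 2"
  obtains P :: "'a::euclidean_space \<Rightarrow> complex" where "homogeneous_harmonic k P" "AE x in ball_measure R. P x \<noteq> 0"
proof -
  obtain b1 :: 'a where b1: "b1 \<in> Basis" using nonempty_Basis by blast
  have "card (Basis - {b1}) > 0" using dim b1 by (simp add: card_Diff_singleton)
  then obtain b2 where b2: "b2 \<in> Basis" "b2 \<noteq> b1" by (metis Diff_iff card_gt_0_iff ex_in_conv singletonI)
  define z :: "'a \<Rightarrow> complex" where "z x = Complex (x \<bullet> b1) (x \<bullet> b2)" for x
  have zD: "(z has_derivative z) (at x)" for x
  proof (rule bounded_linear_imp_has_derivative)
    have "bounded_linear (\<lambda>x. of_real (x \<bullet> b1) + \<i> * of_real (x \<bullet> b2))"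
      by (intro bounded_linear_add bounded_linear_compose[OF bounded_linear_of_real]
          bounded_linear_compose[OF bounded_linear_mult_right] bounded_linear_inner_left)
    then show "bounded_linear z" by (simp add: z_def[abs_def] complex_eq_iff Complex_eq)
  qed
  have poly: "polynomial_function (\<lambda>x. z x ^ n)" for n
  proof (induction n)
    case (Suc n)
    have i: "real_polynomial_function (\<lambda>x. x \<bullet> b)" for b :: 'a
      by (rule real_polynomial_function.intros(1)) (rule bounded_linear_inner_left)
    have "Re (z x ^ Suc n) = (x \<bullet> b1) * Re (z x ^ n) - (x \<bullet> b2) * Im (z x ^ n)"
      "Im (z x ^ Suc n) = (x \<bullet> b1) * Im (z x ^ n) + (x \<bullet> b2) * Re (z x ^ n)" for x
      by (simp_all add: z_def)
    then show ?case using Suc unfolding polynomial_function_complex_iff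
      by (auto intro!: real_polynomial_function_diff real_polynomial_function.intros(3,4) i simp del: power_Suc)
  qed auto
  have d: "partial_deriv b (\<lambda>x. c * z x ^ n) = (\<lambda>x. c * (of_nat n * z b) * z x ^ (n - 1))" for b c n
  proof
    fix x
    show "partial_deriv b (\<lambda>x. c * z x ^ n) x = c * (of_nat n * z b) * z x ^ (n - 1)"
      by (rule partial_deriv_eq[THEN trans]) (auto intro!: derivative_eq_intros zD)
  qed
  have "(\<Sum>b\<in>Basis. (z b)\<^sup>2) = (\<Sum>b\<in>{b1, b2}. (z b)\<^sup>2)"
    using b1 b2 by (intro sum.mono_neutral_right) (auto simp: z_def inner_Basis complex_eq_iff power2_eq_square)
  also have "\<dots> = 0" using b1 b2 by (auto simp: z_def inner_Basis complex_eq_iff power2_eq_square)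
  finally have zz: "(\<Sum>b\<in>Basis. (z b)\<^sup>2) = 0" .
  have "laplacian (\<lambda>x. z x ^ k) x = 0" for x
  proof -
    have "laplacian (\<lambda>x. z x ^ k) x = (\<Sum>b\<in>Basis. (z b)\<^sup>2 * (of_nat k * of_nat (k - 1) * z x ^ (k - 1 - 1)))"
      unfolding laplacian_def using d[of _ 1 k] d by (intro sum.cong refl) (simp add: power2_eq_square)
    also have "\<dots> = 0" unfolding sum_distrib_right[symmetric] zz by simp
    finally show ?thesis .
  qed
  moreover have "z (t *\<^sub>R x) ^ k = of_real (t ^ k) * z x ^ k" for t x
  proof -
    have "z (t *\<^sub>R x) = of_real t * z x" by (simp add: z_def complex_eq_iff)
    then show ?thesis by (simp add: power_mult_distrib)
  qed
  ultimately have "homogeneous_harmonic k (\<lambda>x. z x ^ k)"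
    using poly by (simp add: homogeneous_harmonic_def)
  moreover have "AE x in ball_measure R. z x ^ k \<noteq> 0"
  proof -
    have "negligible {x. x \<bullet> b1 = 0}" using b1 by (rule negligible_standard_hyperplane)
    then have "AE x in lebesgue. x \<notin> {x. x \<bullet> b1 = 0}"
      by (intro AE_not_in) (simp add: negligible_iff_null_sets)
    then have "AE x in lebesgue. x \<in> ball 0 R \<longrightarrow> z x ^ k \<noteq> 0"
    proof eventually_elim
      case (elim x)
      then have "z x \<noteq> 0" by (simp add: z_def complex_eq_iff)
      then show ?case by simp
    qed
    then show ?thesis by (subst AE_restrict_space_iff) auto
  qed
  ultimately show ?thesis by (rule that)
qed

lemma H1norm_zero:
  assumes "R > 0" shows "H1norm R (\<lambda>x::'a::euclidean_space. 0) = 0"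
proof -
  have z: "(\<lambda>x::'a. 0) \<in> L2 (ball_measure R)" by (intro L2_ball_continuous continuous_intros)
  have w: "weak_partial R b (\<lambda>x::'a. 0) (\<lambda>x. 0)" for b by (simp add: weak_partial_def)
  have "L2norm (ball_measure R) (wderiv R b (\<lambda>x::'a. 0)) = L2norm (ball_measure R) (\<lambda>x::'a. 0)" for b
    by (rule L2norm_cong_AE[OF L2_measurable[OF z] L2_measurable[OF wderiv_AE(2)[OF assms z w]] wderiv_AE(1)[OF assms z w]])
  then show ?thesis by (simp add: H1norm_def L2norm_def)
qed

lemma L2_sphere_continuous:
  fixes f :: "'a::euclidean_space \<Rightarrow> complex"
  assumes R: "R > 0" and f: "continuous_on UNIV f" and g: "\<And>x. norm x = R \<Longrightarrow> g x = f x"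
  shows "g \<in> L2 (sphere_measure R)"
proof -
  have "integrable (sphere_measure R) (\<lambda>x. (norm (f x))\<^sup>2)"
    by (intro integrable_sphere_continuous[OF R] continuous_intros f)
  moreover have "f \<in> borel_measurable (sphere_measure R)"
    using f by (intro borel_measurable_sphere_measure borel_measurable_continuous_onI)
  moreover have "integrable (sphere_measure R) (\<lambda>x. (norm (g x))\<^sup>2) \<longleftrightarrow> integrable (sphere_measure R) (\<lambda>x. (norm (f x))\<^sup>2)"
    using g by (intro Bochner_Integration.integrable_cong) auto
  moreover have "g \<in> borel_measurable (sphere_measure R) \<longleftrightarrow> f \<in> borel_measurable (sphere_measure R)"
    using g by (intro measurable_cong) auto
  ultimately show ?thesis by (simp add: L2_def)
qed

lemma L2norm_sphere_zero:
  assumes "\<And>x. norm x = R \<Longrightarrow> g x = 0"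
  shows "L2norm (sphere_measure R) (g :: 'a::euclidean_space \<Rightarrow> complex) = 0"
proof -
  have "(\<integral>x. (norm (g x))\<^sup>2 \<partial>sphere_measure R) = (\<integral>x. 0 \<partial>(sphere_measure R :: 'a measure))"
    using assms by (intro Bochner_Integration.integral_cong) auto
  then show ?thesis by (simp add: L2norm_def)
qed

lemma has_trace_C1:
  assumes R: "R > 0" and f: "f \<in> C1" and g: "\<And>x. norm x = R \<Longrightarrow> g x = f x"
  shows "has_trace R f g"
  unfolding has_trace_def
proof (intro conjI exI[of _ "\<lambda>n. f"])
  show "f \<in> H1 R" by (rule H1_C1(1)[OF f])
  show "g \<in> L2 (sphere_measure R)" by (rule L2_sphere_continuous[OF R C1_continuous[OF f] g])
  show "(\<lambda>n::nat. H1norm R (\<lambda>x. f x - f x)) \<longlonglongrightarrow> 0" by (simp add: H1norm_zero[OF R])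
  show "(\<lambda>n::nat. L2norm (sphere_measure R) (\<lambda>x. f x - g x)) \<longlonglongrightarrow> 0"
    using L2norm_sphere_zero[of R "\<lambda>x. f x - g x"] g by simp
qed (use f in simp)

lemma Q_class_Linfty: "q \<in> Q_class R \<Longrightarrow> q \<in> Linfty (ball_measure R)"
  by (simp add: Q_class_def)

text \<open>
  The resolvent estimate at \<open>z = 0\<close> with right-hand side zero.
\<close>

lemma Q_class_dirichlet_unique:
  assumes R: "R > 0" and q: "q \<in> Q_class R" and u: "u \<in> H10 R" "schroedinger_eq R q u (\<lambda>x. 0)"
  shows "AE x in ball_measure R. u x = 0"
proof -
  have z: "(\<lambda>x. 0) \<in> L2 (ball_measure R)" by (intro L2_ball_continuous continuous_intros)
  have "0 \<in> dirichlet_resolvent_set R q" using q by (simp add: Q_class_def dirichlet_spectrum_def)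
  then obtain C where "\<forall>f\<in>L2 (ball_measure R). \<forall>u\<in>H10 R. schroedinger_eq R q u (\<lambda>x. 0 * u x + f x) \<longrightarrow>
     L2norm (ball_measure R) u \<le> C * L2norm (ball_measure R) f"
    unfolding dirichlet_resolvent_set_def by auto
  from bspec[OF bspec[OF this z] u(1)] u(2)
  have "L2norm (ball_measure R) u \<le> 0" by (simp add: L2norm_def)
  then have "(\<integral>x. (norm (u x))\<^sup>2 \<partial>ball_measure R) = 0"
    using L2norm_nonneg[of "ball_measure R" u] L2norm_square[of "ball_measure R" u] by simp
  moreover have "u \<in> L2 (ball_measure R)" using u(1) by (simp add: H10_def H1_def)
  ultimately have "AE x in ball_measure R. (norm (u x))\<^sup>2 = 0"
    by (subst integral_nonneg_eq_0_iff_AE[symmetric]) (auto intro: L2_integrable)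
  then show ?thesis by simp
qed

lemma schroedinger_form_AE_zero:
  fixes u v :: "'a::euclidean_space \<Rightarrow> complex"
  assumes R: "R > 0" and q: "q \<in> Linfty (ball_measure R)" and u: "u \<in> H1 R" "AE x in ball_measure R. u x = 0" and v: "v \<in> H1 R"
  shows "schroedinger_form R q u v = 0"
proof -
  have z: "(\<lambda>x::'a. 0) \<in> L2 (ball_measure R)" by (intro L2_ball_continuous continuous_intros)
  have w: "weak_partial R b u (\<lambda>x. 0)" for b
  proof -
    have "(\<integral>x. u x * partial_deriv b \<phi> x \<partial>ball_measure R) = (\<integral>x. 0 \<partial>(ball_measure R :: 'a measure))" if "\<phi> \<in> C1_c R" for \<phi> :: "'a \<Rightarrow> complex"
      using u(2) L2_measurable[OF H1_L2[OF u(1)]] L2_measurable[OF C1_c_partial_L2[OF that]]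
      by (intro integral_cong_AE) auto
    then show ?thesis by (simp add: weak_partial_def)
  qed
  have "schroedinger_form R q u v = (\<integral>x. (\<Sum>b\<in>Basis. 0 * wderiv R b v x) + of_real (q x) * u x * v x \<partial>ball_measure R)"
    by (rule schroedinger_form_cong[OF R q u(1) v])
       (auto intro!: wderiv_AE(1)[OF R z w] L2_measurable H1_wderiv(1)[OF v])
  also have "\<dots> = (\<integral>x. 0 \<partial>(ball_measure R :: 'a measure))"
  proof (rule integral_cong_AE)
    have qm: "q \<in> borel_measurable (ball_measure R)" using q by (simp add: Linfty_def)
    show "(\<lambda>x. (\<Sum>b\<in>Basis. 0 * wderiv R b v x) + of_real (q x) * u x * v x) \<in> borel_measurable (ball_measure R)"
      using L2_measurable[OF H1_L2[OF u(1)]] L2_measurable[OF H1_L2[OF v]]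
      by (auto intro!: borel_measurable_times measurable_compose[OF qm])
    show "AE x in ball_measure R. (\<Sum>b\<in>Basis. 0 * wderiv R b v x) + of_real (q x) * u x * v x = 0"
      using u(2) by eventually_elim simp
  qed simp
  finally show ?thesis by simp
qed

text \<open>
  The value of the Dirichlet to Neumann map does not depend on the choices in its definition, and it can
  be read off from any \<open>C1\<close> solution \<open>v\<close> whose form is a boundary integral. The chosen solution differs from
  \<open>v\<close> by a solution of vanishing trace, which is zero because it belongs to \<open>H\<^sup>1\<^sub>0\<close>. The chosen extension of
  \<open>g\<close> is a limit of \<open>C1\<close> functions, on which the form depends through boundary values only.
\<close>

lemma DtN_eq_of_flux:
  fixes v f h :: "'a::euclidean_space \<Rightarrow> complex"
  assumes R: "R > 0" and dim: "DIM('a) \<ge> 2" and q: "q \<in> Q_class R"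
    and v: "v \<in> C1" and f: "\<And>x. norm x = R \<Longrightarrow> f x = v x" and h: "h \<in> L2 (sphere_measure R)"
    and flux: "\<And>\<phi>. \<phi> \<in> C1 \<Longrightarrow> schroedinger_form R q v \<phi> = (\<integral>x. h x * \<phi> x \<partial>sphere_measure R)"
    and g: "g \<in> H_half R"
  shows "DtN R q f g = (\<integral>x. h x * g x \<partial>sphere_measure R)"
proof -
  note qL = Q_class_Linfty[OF q]
  have vH: "v \<in> H1 R" by (rule H1_C1(1)[OF v])
  define G where "G = (SOME G. has_trace R G g)"
  define w where "w = (SOME v. dirichlet_solution R q f v)"
  have "has_trace R G g" unfolding G_def using g by (intro someI_ex[of "\<lambda>G. has_trace R G g"]) (simp add: H_half_def)
  then obtain \<psi> where G: "G \<in> H1 R" "g \<in> L2 (sphere_measure R)" and \<psi>: "\<And>n. \<psi> n \<in> C1"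
    "(\<lambda>n::nat. H1norm R (\<lambda>x. \<psi> n x - G x)) \<longlonglongrightarrow> 0" "(\<lambda>n. L2norm (sphere_measure R) (\<lambda>x. \<psi> n x - g x)) \<longlonglongrightarrow> 0"
    unfolding has_trace_def by blast
  have veq: "schroedinger_eq R q v (\<lambda>x. 0)"
    unfolding schroedinger_eq_def
  proof
    fix \<phi> :: "'a \<Rightarrow> complex" assume \<phi>: "\<phi> \<in> C1_c R"
    have "schroedinger_form R q v \<phi> = (\<integral>x. h x * \<phi> x \<partial>sphere_measure R)" by (rule flux[OF C1_c_C1[OF \<phi>]])
    also have "\<dots> = (\<integral>x. 0 \<partial>(sphere_measure R :: 'a measure))"
      using C1_c_zero(1)[OF \<phi>] by (intro Bochner_Integration.integral_cong) auto
    finally show "schroedinger_form R q v \<phi> = (\<integral>x. 0 * \<phi> x \<partial>ball_measure R)" by simp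
  qed
  have "dirichlet_solution R q f v"
    unfolding dirichlet_solution_def using vH veq has_trace_C1[OF R v f] by simp
  then have "dirichlet_solution R q f w" unfolding w_def by (rule someI[of "dirichlet_solution R q f"])
  then have w: "w \<in> H1 R" "schroedinger_eq R q w (\<lambda>x. 0)" "has_trace R w f"
    by (auto simp: dirichlet_solution_def)
  then obtain \<phi> where \<phi>: "\<And>n. \<phi> n \<in> C1" "(\<lambda>n::nat. H1norm R (\<lambda>x. \<phi> n x - w x)) \<longlonglongrightarrow> 0"
    "(\<lambda>n. L2norm (sphere_measure R) (\<lambda>x. \<phi> n x - f x)) \<longlonglongrightarrow> 0"
    unfolding has_trace_def by blast
  define u where "u x = w x - v x" for x
  have uH: "u \<in> H1 R" unfolding u_def by (rule H1_diff(1)[OF R w(1) vH])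
  have fd: "schroedinger_form R q u \<eta> = schroedinger_form R q w \<eta> - schroedinger_form R q v \<eta>" if "\<eta> \<in> H1 R" for \<eta>
    unfolding schroedinger_form_commute[of R q _ \<eta>] u_def
    by (rule schroedinger_form_diff_right[OF R qL that w(1) vH])
  have "schroedinger_eq R q u (\<lambda>x. 0)"
    using w(2) veq fd[OF H1_C1(1)[OF C1_c_C1]] unfolding schroedinger_eq_def by simp
  moreover have "u \<in> H10 R"
  proof (rule vanishing_trace_H10[OF R dim uH, where f = "\<lambda>n x. \<phi> n x - v x"])
    show "(\<lambda>x. \<phi> n x - v x) \<in> C1" for n by (rule C1_diff(1)[OF \<phi>(1) v])
    show "(\<lambda>n. H1norm R (\<lambda>x. (\<phi> n x - v x) - u x)) \<longlonglongrightarrow> 0" using \<phi>(2) by (simp add: u_def)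
    have "L2norm (sphere_measure R) (\<lambda>x. \<phi> n x - v x) = L2norm (sphere_measure R) (\<lambda>x. \<phi> n x - f x)" for n
      unfolding L2norm_def using f by (intro arg_cong[where f = sqrt] Bochner_Integration.integral_cong) auto
    then show "(\<lambda>n. L2norm (sphere_measure R) (\<lambda>x. \<phi> n x - v x)) \<longlonglongrightarrow> 0" using \<phi>(3) by simp
  qed
  ultimately have "AE x in ball_measure R. u x = 0" by (rule Q_class_dirichlet_unique[OF R q, rotated])
  then have "schroedinger_form R q u G = 0" by (rule schroedinger_form_AE_zero[OF R qL uH _ G(1)])
  then have 1: "DtN R q f g = schroedinger_form R q v G"
    using fd[OF G(1)] by (simp add: DtN_def G_def w_def)
  have "(\<lambda>n. schroedinger_form R q v (\<psi> n)) \<longlonglongrightarrow> schroedinger_form R q v G"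
    by (rule schroedinger_form_tendsto[OF R qL vH G(1) \<psi>(1,2)])
  moreover have "(\<lambda>n. schroedinger_form R q v (\<psi> n)) \<longlonglongrightarrow> (\<integral>x. h x * g x \<partial>sphere_measure R)"
  proof -
    have \<psi>L: "\<psi> n \<in> L2 (sphere_measure R)" for n by (rule L2_sphere_continuous[OF R C1_continuous[OF \<psi>(1)] refl])
    have "(\<lambda>n. schroedinger_form R q v (\<psi> n) - (\<integral>x. h x * g x \<partial>sphere_measure R)) \<longlonglongrightarrow> 0"
    proof (rule Lim_null_comparison)
      show "\<forall>\<^sub>F n in sequentially. norm (schroedinger_form R q v (\<psi> n) - (\<integral>x. h x * g x \<partial>sphere_measure R))
          \<le> L2norm (sphere_measure R) h * L2norm (sphere_measure R) (\<lambda>x. \<psi> n x - g x)"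
      proof (intro always_eventually allI)
        fix n
        have "schroedinger_form R q v (\<psi> n) - (\<integral>x. h x * g x \<partial>sphere_measure R) = (\<integral>x. h x * (\<psi> n x - g x) \<partial>sphere_measure R)"
          unfolding flux[OF \<psi>(1)] right_diff_distrib
          by (intro Bochner_Integration.integral_diff[symmetric] L2_mult_integrable(1) h \<psi>L G(2))
        then show "norm (schroedinger_form R q v (\<psi> n) - (\<integral>x. h x * g x \<partial>sphere_measure R))
          \<le> L2norm (sphere_measure R) h * L2norm (sphere_measure R) (\<lambda>x. \<psi> n x - g x)"
          using L2_Cauchy_Schwarz[OF h L2_diff(1)[OF \<psi>L G(2)]] by simp
      qed
      show "(\<lambda>n. L2norm (sphere_measure R) h * L2norm (sphere_measure R) (\<lambda>x. \<psi> n x - g x)) \<longlonglongrightarrow> 0"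
        using tendsto_mult_left[OF \<psi>(3)] by simp
    qed
    then show ?thesis by (rule LIM_zero_cancel)
  qed
  ultimately show ?thesis unfolding 1 by (rule LIMSEQ_unique)
qed

lemma AE_ball_not_False:
  assumes "R > 0" "AE x in ball_measure R. (x::'a::euclidean_space) \<notin> ball 0 \<delta>" "\<delta> > 0"
  shows False
proof -
  let ?S = "ball (0::'a) R \<inter> ball 0 \<delta>"
  have "AE x in lebesgue. x \<in> ball 0 R \<longrightarrow> (x::'a) \<notin> ball 0 \<delta>"
    using assms(2) by (subst (asm) AE_restrict_space_iff) auto
  then have "AE x in lebesgue. x \<notin> ?S" by eventually_elim auto
  then have "negligible ?S" by (simp add: negligible_iff_null_sets AE_iff_null_sets[of ?S lebesgue])
  moreover have "open ?S" by auto
  moreover have "0 \<in> ?S" using assms by simp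
  ultimately show False using open_not_negligible by blast
qed

text \<open>
  If \<open>a(R) = 0\<close>, then \<open>a(\<bar>x\<bar>) P(x)\<close> is a nonzero element of the kernel of the Dirichlet realization, which
  is excluded because 0 is not in the Dirichlet spectrum.
\<close>

lemma radial_factor_nonzero:
  fixes q :: "'a::euclidean_space \<Rightarrow> real"
  assumes R: "R > 0" and dim: "DIM('a) \<ge> 2" and m: "m = 2 * k + DIM('a) - 1"
    and g: "g \<in> borel_measurable borel" "\<And>r. \<bar>g r\<bar> \<le> C"
    and q: "q \<in> Q_class R" "AE x in ball_measure R. q x = g (norm x)"
    and a: "continuous_on UNIV a" "\<And>r. r > 0 \<Longrightarrow> (a has_real_derivative a' r) (at r)"
      "continuous_on {0..} a'" "\<And>L. \<exists>B. \<forall>r\<in>{0..L}. \<bar>a' r\<bar> \<le> B * r"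
      "\<And>r. r \<ge> 0 \<Longrightarrow> r ^ m * a' r = flux m g a r"
    and a0: "a 0 = 1"
  shows "a R \<noteq> 0"
proof
  assume aR: "a R = 0"
  obtain P :: "'a \<Rightarrow> complex" where P: "homogeneous_harmonic k P" "AE x in ball_measure R. P x \<noteq> 0"
    using homogeneous_harmonic_exists[OF dim] by blast
  note qL = Q_class_Linfty[OF q(1)]
  let ?v = "\<lambda>x. of_real (a (norm x)) * P x"
  have v: "?v \<in> C1"
    by (rule radial_times_harmonic_weak_equation(1)[OF R dim m homogeneous_harmonicD[OF P(1)] g qL q(2) a C1_const[of 0]])
  have form: "schroedinger_form R q ?v \<phi> = of_real (a' R + real k / R * a R) * (\<integral>w. P w * \<phi> w \<partial>sphere_measure R)"
    if "\<phi> \<in> C1" for \<phi>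
    by (rule radial_times_harmonic_weak_equation(2)[OF R dim m homogeneous_harmonicD[OF P(1)] g qL q(2) a that])
  have "schroedinger_eq R q ?v (\<lambda>x. 0)"
    unfolding schroedinger_eq_def
  proof
    fix \<phi> :: "'a \<Rightarrow> complex" assume \<phi>: "\<phi> \<in> C1_c R"
    have "(\<integral>x. P x * \<phi> x \<partial>sphere_measure R) = (\<integral>x. 0 \<partial>(sphere_measure R :: 'a measure))"
      using C1_c_zero(1)[OF \<phi>] by (intro Bochner_Integration.integral_cong) auto
    then show "schroedinger_form R q ?v \<phi> = (\<integral>x. 0 * \<phi> x \<partial>ball_measure R)"
      unfolding form[OF C1_c_C1[OF \<phi>]] by simp
  qed
  moreover have "?v \<in> H10 R"
    by (rule vanishing_trace_H10[OF R dim H1_C1(1)[OF v], where f = "\<lambda>n. ?v"])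
       (use v L2norm_sphere_zero[of R ?v] aR in \<open>simp_all add: H1norm_zero[OF R]\<close>)
  ultimately have "AE x in ball_measure R. ?v x = 0" by (rule Q_class_dirichlet_unique[OF R q(1), rotated])
  then have z: "AE x in ball_measure R. a (norm (x::'a)) = 0" using P(2) by eventually_elim simp
  have "isCont a 0" using a(1) by (simp add: continuous_on_eq_continuous_at)
  then obtain \<delta> where \<delta>: "\<delta> > 0" "\<And>r. dist r 0 < \<delta> \<Longrightarrow> dist (a r) (a 0) < 1"
    unfolding continuous_at_eps_delta by (metis zero_less_one)
  have "AE x in ball_measure R. (x::'a) \<notin> ball 0 \<delta>"
    using z
  proof eventually_elim
    case (elim x)
    then show ?case using \<delta>(2)[of "norm x"] a0 by (auto simp: dist_real_def)
  qed
  then show False by (rule AE_ball_not_False[OF R _ \<delta>(1)])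
qed

text \<open>
  By homogeneity the integral of \<open>\<bar>P\<bar>\<^sup>2\<close> over the ball is a multiple of that over the sphere. This makes the
  eigenvalue unique.
\<close>

lemma homogeneous_harmonic_sphere_norm:
  fixes P :: "'a::euclidean_space \<Rightarrow> complex"
  assumes R: "R > 0" and P: "homogeneous_harmonic k P" "AE x in ball_measure R. P x \<noteq> 0"
  shows "(\<integral>x. P x * cnj (P x) \<partial>sphere_measure R) \<noteq> 0"
proof
  assume 0: "(\<integral>x. P x * cnj (P x) \<partial>sphere_measure R) = 0"
  note PC = polynomial_function_C1(1)[OF homogeneous_harmonicD(1)[OF P(1)]]
  define c where "c = (\<integral>r. complex_of_real (indicat_real {0<..<R} r * (r / R) ^ (DIM('a) - 1) * ((r / R) ^ k)\<^sup>2) \<partial>lborel)"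
  have pc: "continuous_on UNIV (\<lambda>x. P x * cnj (P x))" by (intro continuous_intros C1_continuous PC)
  have "(\<integral>x. P x * cnj (P x) \<partial>ball_measure R) = (\<integral>w. (\<integral>r. (indicat_real {0<..<R} r * (r / R) ^ (DIM('a) - 1)) *\<^sub>R (P ((r / R) *\<^sub>R w) * cnj (P ((r / R) *\<^sub>R w))) \<partial>lborel) \<partial>sphere_measure R)"
    by (rule polar_integral[OF R]) (use pc in \<open>auto intro: borel_measurable_continuous_onI integrable_ball_continuous\<close>)
  also have "\<dots> = (\<integral>w. c * (P w * cnj (P w)) \<partial>sphere_measure R)"
  proof (intro Bochner_Integration.integral_cong refl)
    fix w :: 'a
    have "(indicat_real {0<..<R} r * (r / R) ^ (DIM('a) - 1)) *\<^sub>R (P ((r / R) *\<^sub>R w) * cnj (P ((r / R) *\<^sub>R w))) =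
       complex_of_real (indicat_real {0<..<R} r * (r / R) ^ (DIM('a) - 1) * ((r / R) ^ k)\<^sup>2) * (P w * cnj (P w))" for r
      unfolding homogeneous_harmonicD(2)[OF P(1)] by (simp add: scaleR_conv_of_real power2_eq_square)
    then show "(\<integral>r. (indicat_real {0<..<R} r * (r / R) ^ (DIM('a) - 1)) *\<^sub>R (P ((r / R) *\<^sub>R w) * cnj (P ((r / R) *\<^sub>R w))) \<partial>lborel) = c * (P w * cnj (P w))"
      unfolding c_def by (simp only: integral_mult_left_zero)
  qed
  also have "\<dots> = 0" using 0 by (simp only: integral_mult_right_zero mult_zero_right)
  finally have "(\<integral>x. complex_of_real ((norm (P x))\<^sup>2) \<partial>ball_measure R) = 0"
    by (simp only: complex_norm_square)
  then have "(\<integral>x. (norm (P x))\<^sup>2 \<partial>ball_measure R) = 0"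
    by (simp only: integral_complex_of_real of_real_eq_0_iff)
  moreover have "integrable (ball_measure R) (\<lambda>x. (norm (P x))\<^sup>2)"
    by (intro integrable_ball_continuous continuous_intros C1_continuous PC)
  ultimately have "AE x in ball_measure R. (norm (P x))\<^sup>2 = 0"
    by (subst integral_nonneg_eq_0_iff_AE[symmetric]) auto
  then have "AE x in ball_measure R. (x::'a) \<notin> ball 0 1" using P(2) by eventually_elim simp
  then show False by (rule AE_ball_not_False[OF R]) simp
qed

text \<open>
  On the sphere of radius \<open>R\<close> a spherical harmonic satisfies \<open>Y(x / R) = P(x) / R ^ k\<close>, so the solution with
  these boundary values is \<open>a(\<bar>x\<bar>) P(x)\<close> divided by \<open>a(R) R ^ k\<close>. The same \<open>a\<close> serves all harmonics of
  degree \<open>k\<close> and all radii.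
\<close>

theorem DtN_eigenvalue_radial:
  fixes q :: "'a::euclidean_space \<Rightarrow> real"
  assumes R: "R > 0" and dim: "DIM('a) \<ge> 2" and m: "m = 2 * k + DIM('a) - 1"
    and g: "g \<in> borel_measurable borel" "\<And>r. \<bar>g r\<bar> \<le> C"
    and q: "q \<in> Q_class R" "AE x in ball_measure R. q x = g (norm x)"
    and a: "continuous_on UNIV a" "\<And>r. r > 0 \<Longrightarrow> (a has_real_derivative a' r) (at r)"
      "continuous_on {0..} a'" "\<And>L. \<exists>B. \<forall>r\<in>{0..L}. \<bar>a' r\<bar> \<le> B * r"
      "\<And>r. r \<ge> 0 \<Longrightarrow> r ^ m * a' r = flux m g a r"
    and a0: "a 0 = 1"
  shows "DtN_eigenvalue R q k = a' R / a R + real k / R"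
proof -
  let ?l = "a' R / a R + real k / R"
  have aR: "a R \<noteq> 0" by (rule radial_factor_nonzero[OF R dim m g q a a0])
  have DtN: "DtN R q (\<lambda>x. Y (x /\<^sub>R R)) h = of_real ?l * (\<integral>x. Y (x /\<^sub>R R) * h x \<partial>sphere_measure R)"
    if Y: "spherical_harmonic k Y" and h: "h \<in> H_half R" for Y :: "'a \<Rightarrow> complex" and h
  proof -
    obtain P where P: "homogeneous_harmonic k P" "\<And>x. norm x = 1 \<Longrightarrow> Y x = P x"
      using Y unfolding spherical_harmonic_def homogeneous_harmonic_def by auto
    define c where "c = complex_of_real (1 / (a R * R ^ k))"
    have YP: "Y (x /\<^sub>R R) = of_real (1 / R ^ k) * P x" if "norm x = R" for x
      using that R homogeneous_harmonicD(2)[OF P(1), of "inverse R" x] P(2)[of "x /\<^sub>R R"]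
      by (simp add: power_inverse divide_inverse)
    have v0: "(\<lambda>x. of_real (a (norm x)) * P x) \<in> C1"
      by (rule radial_times_harmonic_weak_equation(1)[OF R dim m homogeneous_harmonicD[OF P(1)] g Q_class_Linfty[OF q(1)] q(2) a C1_const[of 0]])
    have form: "schroedinger_form R q (\<lambda>x. of_real (a (norm x)) * P x) \<phi> = of_real (a' R + real k / R * a R) * (\<integral>w. P w * \<phi> w \<partial>sphere_measure R)"
      if "\<phi> \<in> C1" for \<phi>
      by (rule radial_times_harmonic_weak_equation(2)[OF R dim m homogeneous_harmonicD[OF P(1)] g Q_class_Linfty[OF q(1)] q(2) a that])
    have fl: "schroedinger_form R q (\<lambda>x. c * (of_real (a (norm x)) * P x)) \<phi> = (\<integral>x. (of_real ?l * Y (x /\<^sub>R R)) * \<phi> x \<partial>sphere_measure R)" if \<phi>: "\<phi> \<in> C1" for \<phi>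
    proof -
      have "schroedinger_form R q (\<lambda>x. c * (of_real (a (norm x)) * P x)) \<phi> = c * schroedinger_form R q (\<lambda>x. of_real (a (norm x)) * P x) \<phi>"
        unfolding schroedinger_form_C1[OF R Q_class_Linfty[OF q(1)] C1_cmult(1)[OF v0] \<phi>]
          schroedinger_form_C1[OF R Q_class_Linfty[OF q(1)] v0 \<phi>] integral_mult_right_zero[symmetric] C1_cmult(2)[OF v0]
        by (intro Bochner_Integration.integral_cong refl) (simp add: sum_distrib_left algebra_simps)
      also have "\<dots> = c * of_real (a' R + real k / R * a R) * (\<integral>w. P w * \<phi> w \<partial>sphere_measure R)"
        unfolding form[OF \<phi>] by simp
      also have "c * of_real (a' R + real k / R * a R) = of_real ?l * of_real (1 / R ^ k)"
        unfolding c_def of_real_mult[symmetric] using aR R by (simp add: field_simps)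
      also have "of_real ?l * of_real (1 / R ^ k) * (\<integral>w. P w * \<phi> w \<partial>sphere_measure R) =
         (\<integral>w. of_real ?l * of_real (1 / R ^ k) * (P w * \<phi> w) \<partial>sphere_measure R)"
        by (rule integral_mult_right_zero[symmetric])
      also have "\<dots> = (\<integral>x. (of_real ?l * Y (x /\<^sub>R R)) * \<phi> x \<partial>sphere_measure R)"
        by (intro Bochner_Integration.integral_cong refl) (simp add: YP)
      finally show ?thesis .
    qed
    have hL: "(\<lambda>x. of_real ?l * Y (x /\<^sub>R R)) \<in> L2 (sphere_measure R)"
      by (rule L2_sphere_continuous[OF R, where f = "\<lambda>x. of_real ?l * (of_real (1 / R ^ k) * P x)"])
         (intro continuous_on_mult continuous_on_const C1_continuous polynomial_function_C1(1)[OF homogeneous_harmonicD(1)[OF P(1)]], simp add: YP)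
    have "DtN R q (\<lambda>x. Y (x /\<^sub>R R)) h = (\<integral>x. (of_real ?l * Y (x /\<^sub>R R)) * h x \<partial>sphere_measure R)"
    proof (rule DtN_eq_of_flux[OF R dim q(1) C1_cmult(1)[OF v0] _ hL fl h])
      show "Y (x /\<^sub>R R) = c * (of_real (a (norm x)) * P x)" if "norm x = R" for x
        using aR by (simp add: YP[OF that] that c_def)
    qed
    also have "\<dots> = of_real ?l * (\<integral>x. Y (x /\<^sub>R R) * h x \<partial>sphere_measure R)"
      unfolding mult.assoc by (rule integral_mult_right_zero)
    finally show ?thesis .
  qed
  show ?thesis
    unfolding DtN_eigenvalue_def
  proof (rule the_equality)
    show "\<forall>Y. spherical_harmonic k Y \<longrightarrow> (\<forall>h\<in>H_half R. DtN R q (\<lambda>x. Y (x /\<^sub>R R)) h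
        = of_real ?l * (\<integral>x. Y (x /\<^sub>R R) * h x \<partial>sphere_measure R))"
      using DtN by blast
    fix l :: real
    assume l: "\<forall>Y. spherical_harmonic k Y \<longrightarrow> (\<forall>h\<in>H_half R. DtN R q (\<lambda>x. Y (x /\<^sub>R R)) h
        = of_real l * (\<integral>x. Y (x /\<^sub>R R) * h x \<partial>sphere_measure R))"
    obtain P :: "'a \<Rightarrow> complex" where P: "homogeneous_harmonic k P" "AE x in ball_measure R. P x \<noteq> 0"
      using homogeneous_harmonic_exists[OF dim] by blast
    have PY: "spherical_harmonic k P" using P(1) unfolding spherical_harmonic_def homogeneous_harmonic_def by blast
    \<comment> \<open>Testing with the conjugate of \<open>P\<close> shows that no other number is an eigenvalue.\<close>
    have hh: "(\<lambda>x. cnj (P x)) \<in> H_half R"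
      unfolding H_half_def
      using has_trace_C1[OF R C1_cnj(1)[OF polynomial_function_C1(1)[OF homogeneous_harmonicD(1)[OF P(1)]]] refl] by blast
    have PR: "P (x /\<^sub>R R) = of_real (inverse R ^ k) * P x" for x by (rule homogeneous_harmonicD(2)[OF P(1)])
    have "(\<integral>x. P (x /\<^sub>R R) * cnj (P x) \<partial>sphere_measure R) = of_real (inverse R ^ k) * (\<integral>x. P x * cnj (P x) \<partial>sphere_measure R)"
      unfolding PR mult.assoc by (rule integral_mult_right_zero)
    then have "(\<integral>x. P (x /\<^sub>R R) * cnj (P x) \<partial>sphere_measure R) \<noteq> 0"
      using homogeneous_harmonic_sphere_norm[OF R P] R by simp
    moreover have "of_real l * (\<integral>x. P (x /\<^sub>R R) * cnj (P x) \<partial>sphere_measure R) = of_real ?l * (\<integral>x. P (x /\<^sub>R R) * cnj (P x) \<partial>sphere_measure R)"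
      using l PY hh DtN[OF PY hh] by metis
    ultimately have "complex_of_real l = of_real ?l" by simp
    then show "l = ?l" by (simp only: of_real_eq_iff)
  qed
qed

section \<open>Potentials supported in the unit ball\<close>

text \<open>
  The profile is replaced by a Borel function for which boundedness and support hold everywhere, so that
  the radial equation makes sense pointwise.
\<close>

lemma radial_representative:
  fixes q :: "'a::euclidean_space \<Rightarrow> real"
  assumes q: "q = (\<lambda>x. q0 (norm x))" and q0: "q0 \<in> Linfty (lebesgue_on {0<..})"
    and supp: "AE r in lebesgue_on {0<..}. r \<notin> {0<..1} \<longrightarrow> q0 r = 0"
  obtains g C where "g \<in> borel_measurable borel" "\<And>r. \<bar>g r\<bar> \<le> C" "\<And>r. r > 1 \<Longrightarrow> g r = 0"
    "\<And>R. R > 0 \<Longrightarrow> AE x in ball_measure R. q x = g (norm x)"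
proof -
  obtain C where m: "q0 \<in> borel_measurable (lebesgue_on {0<..})" and C: "AE r in lebesgue_on {0<..}. \<bar>q0 r\<bar> \<le> C"
    using q0 by (auto simp: Linfty_def)
  have "(\<lambda>r. if r \<in> {0<..} then q0 r else 0) \<in> borel_measurable lebesgue"
    by (rule borel_measurable_if_I[OF m]) auto
  then obtain f where f: "f \<in> borel_measurable lborel" "AE r in lborel. (if r \<in> {0<..} then q0 r else 0) = f r"
    using completion_ex_borel_measurable_real by blast
  have f' [measurable]: "f \<in> borel_measurable borel" using f(1) by simp
  define g where "g r = (if r > 1 then 0 else max (- \<bar>C\<bar>) (min \<bar>C\<bar> (f r)))" for r
  have gm: "g \<in> borel_measurable borel" unfolding g_def by measurable
  have gb: "\<bar>g r\<bar> \<le> \<bar>C\<bar>" for r unfolding g_def by auto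
  have "AE r in lebesgue. r \<in> {0<..} \<longrightarrow> \<bar>q0 r\<bar> \<le> C" "AE r in lebesgue. r \<in> {0<..} \<longrightarrow> r \<notin> {0<..1} \<longrightarrow> q0 r = 0"
    using C supp by (simp_all add: AE_restrict_space_iff)
  then have "AE r in lborel. r \<in> {0<..} \<longrightarrow> \<bar>q0 r\<bar> \<le> C" "AE r in lborel. r \<in> {0<..} \<longrightarrow> r \<notin> {0<..1} \<longrightarrow> q0 r = 0"
    by (simp_all add: AE_completion_iff)
  then have "AE r in lborel. r > 0 \<longrightarrow> q0 r = g r"
    using f(2) by eventually_elim (auto simp: g_def)
  then obtain N where N: "{r \<in> space lborel. \<not> (r > 0 \<longrightarrow> q0 r = g r)} \<subseteq> N" "N \<in> null_sets lborel"
    unfolding eventually_ae_filter by auto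
  have "AE x in ball_measure R. q x = g (norm x)" if R: "R > 0" for R
  proof -
    \<comment> \<open>The radius 0 is excluded because \<open>q0\<close> is compared with \<open>g\<close> at positive radii.\<close>
    have "N \<union> {0} \<in> null_sets lborel" using N(2) by (intro null_sets.Un) auto
    then have "AE x in ball_measure R. norm (x::'a) \<notin> N \<union> {0}" by (rule AE_ball_norm[OF R])
    then show ?thesis
    proof eventually_elim
      case (elim x)
      then have "norm x > 0" "norm x \<notin> N" by auto
      then have "q0 (norm x) = g (norm x)" using subsetD[OF N(1), of "norm x"] by auto
      then show ?case by (simp add: q)
    qed
  qed
  moreover have "g r = 0" if "r > 1" for r using that by (simp add: g_def)
  ultimately show ?thesis using that[OF gm gb] by blast
qed

text \<open>
  Where the potential vanishes, \<open>r ^ m a'\<close> is constant, and one more integration gives \<open>a\<close>. The case \<open>m = 1\<close>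
  is that of dimension 2 and degree 0.
\<close>

lemma radial_solution_outside:
  fixes a a' g :: "real \<Rightarrow> real" and m :: nat
  assumes R: "R \<ge> 1" and m: "m \<ge> 1" and g: "\<And>r. r > 1 \<Longrightarrow> g r = 0"
    and ac: "continuous_on UNIV a" and a: "\<And>r. r > 0 \<Longrightarrow> (a has_real_derivative a' r) (at r)"
    and fl: "\<And>r. r \<ge> 0 \<Longrightarrow> r ^ m * a' r = flux m g a r"
  shows "a' R = R powr (- real m) * a' 1"
    and "m > 1 \<Longrightarrow> (real m - 1) * a R = (real m - 1) * a 1 + a' 1 * (1 - R powr (- (real m - 1)))"
    and "m = 1 \<Longrightarrow> a R = a 1 + a' 1 * ln R"
proof -
  have slope: "a' r = a' 1 * r powr (- real m)" if r: "r \<ge> 1" for r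
  proof -
    have "flux m g a r = flux m g a 1"
      unfolding flux_def using g r by (intro Bochner_Integration.integral_cong refl) (auto simp: indicator_def)
    then have "r ^ m * a' r = a' 1" using fl[of r] fl[of 1] r by simp
    then show ?thesis using r by (simp add: powr_minus powr_realpow field_simps)
  qed
  show "a' R = R powr (- real m) * a' 1" using slope[OF R] by simp
  have const: "F R = F 1" if "continuous_on {1..R} F" "\<And>r. r > 1 \<Longrightarrow> (F has_real_derivative 0) (at r)" for F
  proof (cases "R = 1")
    case False
    then have "1 < R" using R by simp
    then show ?thesis by (rule DERIV_isconst_end) (use that in auto)
  qed simp
  note ac' = continuous_on_subset[OF ac subset_UNIV]
  show "(real m - 1) * a R = (real m - 1) * a 1 + a' 1 * (1 - R powr (- (real m - 1)))" if "m > 1"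
  proof -
    have "(real m - 1) * a R + a' 1 * R powr (- (real m - 1)) = (real m - 1) * a 1 + a' 1 * 1 powr (- (real m - 1))"
    proof (rule const)
      show "continuous_on {1..R} (\<lambda>r. (real m - 1) * a r + a' 1 * r powr (- (real m - 1)))"
        by (intro continuous_intros ac') auto
      fix r :: real assume r: "r > 1"
      have "((\<lambda>r. (real m - 1) * a r + a' 1 * r powr (- (real m - 1))) has_real_derivative
        (real m - 1) * a' r + a' 1 * (- (real m - 1) * r powr (- (real m - 1) - 1))) (at r)"
        using r by (intro DERIV_add DERIV_cmult a has_real_derivative_powr) auto
      moreover have "(real m - 1) * a' r + a' 1 * (- (real m - 1) * r powr (- (real m - 1) - 1)) = 0"
        using slope[of r] r by (simp add: algebra_simps)
      ultimately show "((\<lambda>r. (real m - 1) * a r + a' 1 * r powr (- (real m - 1))) has_real_derivative 0) (at r)"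
        by simp
    qed
    then show ?thesis by (simp add: right_diff_distrib)
  qed
  show "a R = a 1 + a' 1 * ln R" if "m = 1"
  proof -
    have "a R - a' 1 * ln R = a 1 - a' 1 * ln 1"
    proof (rule const)
      show "continuous_on {1..R} (\<lambda>r. a r - a' 1 * ln r)"
        by (intro continuous_intros ac') auto
      fix r :: real assume r: "r > 1"
      have "((\<lambda>r. a r - a' 1 * ln r) has_real_derivative a' r - a' 1 * inverse r) (at r)"
        using r by (intro DERIV_diff DERIV_cmult a DERIV_ln) auto
      moreover have "a' r - a' 1 * inverse r = 0"
        using slope[of r] r that by (simp add: powr_minus)
      ultimately show "((\<lambda>r. a r - a' 1 * ln r) has_real_derivative 0) (at r)" by simp
    qed
    then show ?thesis by simp
  qed
qed

theorem lemma2p1: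
  fixes d :: nat and R :: real and q0 :: "real \<Rightarrow> real"
    and q :: "'a::euclidean_space \<Rightarrow> real"
  assumes "DIM('a) = d" and "d \<ge> 2" and "R \<ge> 1"
    and "q = (\<lambda>x. q0 (norm x))"
    and "q0 \<in> Linfty (lebesgue_on {0<..})"
    and "AE r in lebesgue_on {0<..}. r \<notin> {0<..1} \<longrightarrow> q0 r = 0"
    and "\<forall>\<rho>\<ge>1. q \<in> Q_class \<rho>"
  shows "\<forall>k::nat.
    (2 * real k + real d - 2 \<noteq> 0 \<longrightarrow>
       DtN_eigenvalue 1 q k + real k + real d - 2
         - R powr (- (2 * real k + real d - 2)) * (DtN_eigenvalue 1 q k - real k) \<noteq> 0 \<and>
       DtN_eigenvalue R q k - real k / R =
         R powr (- (2 * real k + real d - 1)) * (DtN_eigenvalue 1 q k - real k) *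
         ((2 * real k + real d - 2) /
          (DtN_eigenvalue 1 q k + real k + real d - 2
             - R powr (- (2 * real k + real d - 2)) * (DtN_eigenvalue 1 q k - real k)))) \<and>
    (2 * real k + real d - 2 = 0 \<longrightarrow>
       1 + (DtN_eigenvalue 1 q k - real k) * ln R \<noteq> 0 \<and>
       DtN_eigenvalue R q k - real k / R =
         R powr (- (2 * real k + real d - 1)) * (DtN_eigenvalue 1 q k - real k) *
         (1 / (1 + (DtN_eigenvalue 1 q k - real k) * ln R)))"
proof
  fix k :: nat
  obtain g C where g: "g \<in> borel_measurable borel" "\<And>r. \<bar>g r\<bar> \<le> C" and g1: "\<And>r. r > 1 \<Longrightarrow> g r = 0"
    and qg: "\<And>R. R > 0 \<Longrightarrow> AE x in ball_measure R. q x = g (norm x)"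
    using radial_representative[OF assms(4-6)] by blast
  define m where "m = 2 * k + DIM('a) - 1"
  have dim: "DIM('a) \<ge> 2" and m1: "m \<ge> 1" and md: "real m = 2 * real k + real d - 1"
    using assms(1,2) by (auto simp: m_def of_nat_diff)
  obtain a a' :: "real \<Rightarrow> real" where ac: "continuous_on UNIV a" and a0: "a 0 = 1"
    and a: "\<And>r. r > 0 \<Longrightarrow> (a has_real_derivative a' r) (at r)"
      "continuous_on {0..} a'" "\<And>L. \<exists>B. \<forall>r\<in>{0..L}. \<bar>a' r\<bar> \<le> B * r"
    and fl: "\<And>r. r \<ge> 0 \<Longrightarrow> r ^ m * a' r = flux m g a r"
    using radial_solution[OF g m1] by blast
  have ev: "DtN_eigenvalue \<rho> q k = a' \<rho> / a \<rho> + real k / \<rho>" and nz: "a \<rho> \<noteq> 0" if "\<rho> \<ge> 1" for \<rho>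
  proof -
    have \<rho>: "\<rho> > 0" and qc: "q \<in> Q_class \<rho>" using that assms(7) by auto
    show "DtN_eigenvalue \<rho> q k = a' \<rho> / a \<rho> + real k / \<rho>"
      by (rule DtN_eigenvalue_radial[OF \<rho> dim m_def g qc qg[OF \<rho>] ac a fl a0])
    show "a \<rho> \<noteq> 0"
      by (rule radial_factor_nonzero[OF \<rho> dim m_def g qc qg[OF \<rho>] ac a fl a0])
  qed
  define y where "y = a' 1 / a 1"
  have l1: "DtN_eigenvalue 1 q k = y + real k" using ev[of 1] by (simp add: y_def)
  have lR: "DtN_eigenvalue R q k - real k / R = a' R / a R" using ev[OF assms(3)] by simp
  note a1 = nz[of 1, simplified] and aR = nz[OF assms(3)]
  have "a' R = R powr (- real m) * a' 1"
    by (rule radial_solution_outside(1)[OF assms(3) m1 g1 ac a(1) fl])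
  then have a'R: "a' R = R powr (- (2 * real k + real d - 1)) * a' 1" by (simp add: md)
  have out_gt: "(real m - 1) * a R = (real m - 1) * a 1 + a' 1 * (1 - R powr (- (real m - 1)))" if "m > 1"
    by (rule radial_solution_outside(2)[OF assms(3) m1 g1 ac a(1) fl that])
  have out_1: "a R = a 1 + a' 1 * ln R" if "m = 1"
    by (rule radial_solution_outside(3)[OF assms(3) m1 g1 ac a(1) fl that])
  have a'1: "a' 1 = y * a 1" using a1 by (simp add: y_def)
  show "(2 * real k + real d - 2 \<noteq> 0 \<longrightarrow>
       DtN_eigenvalue 1 q k + real k + real d - 2
         - R powr (- (2 * real k + real d - 2)) * (DtN_eigenvalue 1 q k - real k) \<noteq> 0 \<and>
       DtN_eigenvalue R q k - real k / R =
         R powr (- (2 * real k + real d - 1)) * (DtN_eigenvalue 1 q k - real k) *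
         ((2 * real k + real d - 2) /
          (DtN_eigenvalue 1 q k + real k + real d - 2
             - R powr (- (2 * real k + real d - 2)) * (DtN_eigenvalue 1 q k - real k)))) \<and>
    (2 * real k + real d - 2 = 0 \<longrightarrow>
       1 + (DtN_eigenvalue 1 q k - real k) * ln R \<noteq> 0 \<and>
       DtN_eigenvalue R q k - real k / R =
         R powr (- (2 * real k + real d - 1)) * (DtN_eigenvalue 1 q k - real k) *
         (1 / (1 + (DtN_eigenvalue 1 q k - real k) * ln R)))"
  proof (intro conjI impI)
    \<comment> \<open>Up to the factor \<open>s\<close>, or 1 if \<open>s = 0\<close>, the denominator is \<open>a(R) / a(1)\<close>, so it is not zero.\<close>
    define s where "s = 2 * real k + real d - 2"
    define p where "p = R powr (- (2 * real k + real d - 1))"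
    have ms: "real m - 1 = s" by (simp add: md s_def)
    {
      assume "2 * real k + real d - 2 \<noteq> 0"
      then have s: "s \<noteq> 0" by (simp add: s_def)
      then have "m > 1" using m1 ms by (cases "m = 1") auto
      from out_gt[OF this] have e1: "s * a R = (s + y - R powr (- s) * y) * a 1"
        unfolding ms by (simp add: a'1 algebra_simps)
      have e2: "DtN_eigenvalue 1 q k + real k + real d - 2 - R powr (- s) * (DtN_eigenvalue 1 q k - real k)
          = s + y - R powr (- s) * y"
        by (simp add: l1 s_def)
      have e: "DtN_eigenvalue 1 q k + real k + real d - 2 - R powr (- s) * (DtN_eigenvalue 1 q k - real k) = s * a R / a 1"
        unfolding e1 e2 using a1 by simp
      then show "DtN_eigenvalue 1 q k + real k + real d - 2
         - R powr (- (2 * real k + real d - 2)) * (DtN_eigenvalue 1 q k - real k) \<noteq> 0"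
        using s aR a1 by (simp add: s_def[symmetric])
      show "DtN_eigenvalue R q k - real k / R =
         R powr (- (2 * real k + real d - 1)) * (DtN_eigenvalue 1 q k - real k) *
         ((2 * real k + real d - 2) /
          (DtN_eigenvalue 1 q k + real k + real d - 2
             - R powr (- (2 * real k + real d - 2)) * (DtN_eigenvalue 1 q k - real k)))"
        unfolding s_def[symmetric] e lR a'R p_def[symmetric] using s aR a1 by (simp add: l1 a'1)
    }
    assume s: "2 * real k + real d - 2 = 0"
    then have "m = 1" using ms by (simp add: s_def)
    from out_1[OF this] have "a R = (1 + y * ln R) * a 1" by (simp add: a'1 algebra_simps)
    then have e: "1 + (DtN_eigenvalue 1 q k - real k) * ln R = a R / a 1" using a1 by (simp add: l1)
    then show "1 + (DtN_eigenvalue 1 q k - real k) * ln R \<noteq> 0" using aR a1 by simp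
    show "DtN_eigenvalue R q k - real k / R =
         R powr (- (2 * real k + real d - 1)) * (DtN_eigenvalue 1 q k - real k) *
         (1 / (1 + (DtN_eigenvalue 1 q k - real k) * ln R))"
      unfolding e lR a'R p_def[symmetric] using aR a1 by (simp add: l1 a'1)
  qed
qed

end
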